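(* Let $(G_i \mid i \in I)$ be a family of groups, let $F$ be a free group, and let $G = F \ast \mathop{\ast}_{i\in I} G_i$ be the free product of $F$ and all the $G_i$. Let $\mathcal{F}$ be the set of all finitely generated subgroups $H$ of $G$ such that $H \cap G_i^{g} = \{1\}$ for each $g \in G$ and each $i \in I$, and assume that some element of $\mathcal{F}$ has rank at least two. Let $H$ and $K$ be elements of $\mathcal{F}$, and let $S$ be a set of $(H,K)$-double coset representatives in $G$. Then $$\sum_{s\in S} \bar r(H^s\cap K) \;\le\; 2\cdot\theta\alpha_3(G)\cdot \bar r(H)\cdot\bar r(K).$$
   Context: For $a,b \in G$ and $S \subseteq G$: $b^a := a^{-1}ba$ and $S^a := \{c^a \mid c \in S\}$. For a set $S$, $|S| \in \mathbb{N}\cup\{\infty\}$ is its cardinal if $S$ is finite, and $\infty$ otherwise. The rank of a group is the minimum of $|S|$ over its generating sets $S$. For a free group $H$, the reduced rank is $\bar r(H) := \max\{\operatorname{rank}(H)-1, 0\} \in \mathbb{N}\cup\{\infty\}$. By the Kurosh Subgroup Theorem, every element of $\mathcal{F}$ is a free group. A set $S$ of $(H,K)$-double coset representatives in $G$ is a subset of $G$ containing exactly one element of each double coset $HgK$, $g\in G$. Define $\alpha_3(G) := \inf\{|L| : L \text{ is a subgroup of } G \text{ and } |L|\ge 3\}$, where the infimum of the empty set is $\infty$ (so $\alpha_3(G)$ is $\infty$, $4$, or an odd prime). Define $\theta:[3,\infty]\to[1,3]$ by $\theta(x) = \frac{x}{x-2}$ with $\theta(\infty)=1$, and write $\theta\alpha_3(G)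 := \theta(\alpha_3(G))$. *)

theory Defs
  imports "HOL-Analysis.Infinite_Sum" "HOL-Algebra.Generated_Groups"
begin

section \<open>Free products and free groups\<close>

text \<open>
  The free product of a family \<open>A\<close> of groups indexed by a set \<open>I\<close> is realised on its normal forms:
  words in letters \<open>(j, x)\<close> with \<open>x\<close> a nontrivial element of \<open>A j\<close>, adjacent letters coming from
  different factors. Multiplying a normal form on the left by one letter merges that
  letter with the head of the word when both lie in the same factor, and deletes the result
  when it is trivial.
\<close>

definition normal_words :: "'i set \<Rightarrow> ('i \<Rightarrow> 'a monoid) \<Rightarrow> ('i \<times> 'a) list set" where
  "normal_words I A =
    {w. (\<forall>(j, x) \<in> set w. j \<in> I \<and> x \<in> carrier (A j) \<and> x \<noteq> \<one>\<^bsub>A j\<^esub>) \<and>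
        successively (\<lambda>(j, x) (k, y). j \<noteq> k) w}"

definition letter :: "('i \<Rightarrow> 'a monoid) \<Rightarrow> 'i \<Rightarrow> 'a \<Rightarrow> ('i \<times> 'a) list" where
  "letter A j x = (if x = \<one>\<^bsub>A j\<^esub> then [] else [(j, x)])"

fun prepend :: "('i \<Rightarrow> 'a monoid) \<Rightarrow> 'i \<times> 'a \<Rightarrow> ('i \<times> 'a) list \<Rightarrow> ('i \<times> 'a) list" where
  "prepend A (j, x) [] = letter A j x"
| "prepend A (j, x) ((k, y) # w) =
    (if j = k then letter A j (x \<otimes>\<^bsub>A j\<^esub> y) @ w else letter A j x @ (k, y) # w)"

definition free_product :: "'i set \<Rightarrow> ('i \<Rightarrow> 'a monoid) \<Rightarrow> ('i \<times> 'a) list monoid" where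
  "free_product I A =
    \<lparr>carrier = normal_words I A, mult = (\<lambda>u v. foldr (prepend A) u v), one = []\<rparr>"

text \<open>The copy of the factor \<open>A j\<close> inside the free product.\<close>

definition factor :: "('i \<Rightarrow> 'a monoid) \<Rightarrow> 'i \<Rightarrow> ('i \<times> 'a) list set" where
  "factor A j = letter A j ` carrier (A j)"

text \<open>
  A group is free if it has a basis: a generating set in which no nonempty reduced word
  represents the identity. A letter \<open>(x, True)\<close> stands for \<open>x\<close>, and \<open>(x, False)\<close> for its inverse.
\<close>

definition word_value :: "'a monoid \<Rightarrow> ('a \<times> bool) list \<Rightarrow> 'a" where
  "word_value F w =
    foldr (\<lambda>(x, b) g. (if b then x else inv\<^bsub>F\<^esub> x) \<otimes>\<^bsub>F\<^esub> g) w \<one>\<^bsub>F\<^esub>"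

definition reduced_word :: "('a \<times> bool) list \<Rightarrow> bool" where
  "reduced_word w \<longleftrightarrow> successively (\<lambda>(x, b) (y, c). \<not> (x = y \<and> b \<noteq> c)) w"

definition is_basis :: "'a monoid \<Rightarrow> 'a set \<Rightarrow> bool" where
  "is_basis F X \<longleftrightarrow>
    X \<subseteq> carrier F \<and> generate F X = carrier F \<and>
    (\<forall>w \<in> lists (X \<times> UNIV). w \<noteq> [] \<and> reduced_word w \<longrightarrow> word_value F w \<noteq> \<one>\<^bsub>F\<^esub>)"

definition free_group :: "'a monoid \<Rightarrow> bool" where
  "free_group F \<longleftrightarrow> group F \<and> (\<exists>X. is_basis F X)"

section \<open>Ranks\<close>

definition ecard :: "'a set \<Rightarrow> enat" where
  "ecard S = (if finite S then enat (card S) else \<infinity>)"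

definition group_rank :: "'a monoid \<Rightarrow> enat" where
  "group_rank G = (INF S \<in> {S. S \<subseteq> carrier G \<and> generate G S = carrier G}. ecard S)"

text \<open>Subtraction on \<^typ>\<open>enat\<close> is truncated at \<open>0\<close> and satisfies \<open>\<infinity> - 1 = \<infinity>\<close>.\<close>

definition reduced_rank :: "'a monoid \<Rightarrow> enat" where
  "reduced_rank G = group_rank G - 1"

definition fin_gen :: "'a monoid \<Rightarrow> bool" where
  "fin_gen G \<longleftrightarrow> (\<exists>S \<subseteq> carrier G. finite S \<and> generate G S = carrier G)"

section \<open>Conjugates, double cosets and small subgroups\<close>

definition conjugate :: "('a, 'm) monoid_scheme \<Rightarrow> 'a set \<Rightarrow> 'a \<Rightarrow> 'a set" where
  "conjugate G S a = (\<lambda>c. inv\<^bsub>G\<^esub> a \<otimes>\<^bsub>G\<^esub> c \<otimes>\<^bsub>G\<^esub> a) ` S"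

definition double_coset_reps ::
    "('a, 'm) monoid_scheme \<Rightarrow> 'a set \<Rightarrow> 'a set \<Rightarrow> 'a set \<Rightarrow> bool" where
  "double_coset_reps G H K S \<longleftrightarrow>
    S \<subseteq> carrier G \<and>
    (\<forall>g \<in> carrier G. \<exists>!s. s \<in> S \<and> s \<in> (H #>\<^bsub>G\<^esub> g) <#>\<^bsub>G\<^esub> K)"

definition alpha3 :: "('a, 'm) monoid_scheme \<Rightarrow> enat" where
  "alpha3 G = (INF L \<in> {L. subgroup L G \<and> ecard L \<ge> 3}. ecard L)"

text \<open>The intended domain is \<open>[3, \<infinity>]\<close>.\<close>

definition theta :: "ennreal \<Rightarrow> ennreal" where
  "theta x = (if x = \<infinity> then 1 else x / (x - 2))"

section \<open>The family of subgroups under consideration\<close>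

definition factor_free_subgroups ::
    "('i \<times> 'a) list monoid \<Rightarrow> 'i set \<Rightarrow> ('i \<Rightarrow> 'a monoid) \<Rightarrow> ('i \<times> 'a) list set set" where
  "factor_free_subgroups G J A =
    {H. subgroup H G \<and> fin_gen (G\<lparr>carrier := H\<rparr>) \<and>
        (\<forall>g \<in> carrier G. \<forall>j \<in> J. H \<inter> conjugate G (factor A j) g = {\<one>\<^bsub>G\<^esub>})}"

end

theory Submission
  imports Defs
begin

text \<open>
  Let \<open>G\<close> act on the right on the bipartite tree with one vertex for each \<open>g\<close>, one for each coset
  \<open>G\<^sub>i g\<close>, and, for each element \<open>x\<close> of a basis of \<open>F\<close>, a midpoint between \<open>g\<close> and \<open>x g\<close>. Edges
  have trivial stabilizers, and the stabilizers of vertices are trivial or conjugates of the \<open>G\<^sub>i\<close>,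
  so \<open>H\<close> and \<open>K\<close> act freely on the vertices.

  A finitely generated nontrivial group \<open>H\<close> acting freely preserves a subtree \<open>Y\<^sub>H\<close> without leaves
  and with finite quotient, and \<open>2 * (rank H - 1)\<close> is the sum of \<open>deg v - 2\<close> over the vertex orbits
  of \<open>Y\<^sub>H\<close>. Only two inequalities are needed. The bound of \<open>H\<close> from below is linear algebra over
  the field with two elements: a \<open>0\<close>-\<open>1\<close> labelling of the edges of the quotient is determined by its
  sums along the generators and by a potential on the vertices (\<open>rank_lower_bound\<close>). The bound of an
  intersection from above reads generators off the quotient graph
  (\<open>generating_set_of_connected_quotient\<close>), after leaves have been removed (\<open>exists_core\<close>).

  The intersection of the conjugate of \<open>H\<close> by \<open>s\<close> with \<open>K\<close> preserves the translate of \<open>Y\<^sub>H\<close> by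
  \<open>s\<close> intersected with \<open>Y\<^sub>K\<close>. When \<open>s\<close> runs through double coset representatives, the vertex
  orbits of these intersections correspond to triples of a vertex orbit of \<open>Y\<^sub>H\<close> with star \<open>A\<close>, one
  of \<open>Y\<^sub>K\<close> with star \<open>B\<close>, and an element \<open>g\<close> for which the translate \<open>A g\<close> meets \<open>B\<close>; the star at
  the vertex is the intersection of \<open>A g\<close> with \<open>B\<close> (\<open>pullback_weight_bound\<close>). So everything rests
  on an inequality in the style of Kneser, Kemperman and Pollard for finite subsets of a free
  \<open>G\<close>-set with at least two elements, \<open>excess_bound\<close>: the sum over \<open>g\<close> of the positive parts of
  \<open>\<bar>A g \<inter> B\<bar> - 2\<close> is at most \<open>\<theta> * (\<bar>A\<bar> - 2) * (\<bar>B\<bar> - 2)\<close>. With \<open>a, b\<close> the weights of \<open>Y\<^sub>H\<close> at the two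
  kinds of vertices and \<open>x, y\<close> those of \<open>Y\<^sub>K\<close>, twice the sum of reduced ranks is at most
  \<open>\<theta> * (a * x + b * y)\<close>, hence at most \<open>\<theta> * (a + b) * (x + y)\<close>, which is at most
  \<open>4 * \<theta>\<close> times the product of the reduced ranks of \<open>H\<close> and \<open>K\<close>.

  Paths are avoided throughout. A subgraph is a set of edges with two vertex maps; it is connected if
  every predicate on edges that is constant around each vertex is constant, and a connected graph is
  a tree if every \<open>0\<close>-\<open>1\<close> labelling of its edges is a coboundary of a labelling of its vertices.
\<close>

section \<open>Overlaps of translates in a free group action\<close>

locale free_action = group G for G (structure) +
  fixes E :: "'e set" and act :: "'e \<Rightarrow> 'a \<Rightarrow> 'e" (infixl "\<cdot>" 75)
  assumes act_closed [simp]: "\<lbrakk>e \<in> E; g \<in> carrier G\<rbrakk> \<Longrightarrow> e \<cdot> g \<in> E"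
    and act_one [simp]: "e \<in> E \<Longrightarrow> e \<cdot> \<one> = e"
    and act_mult: "\<lbrakk>e \<in> E; g \<in> carrier G; h \<in> carrier G\<rbrakk> \<Longrightarrow> e \<cdot> (g \<otimes> h) = e \<cdot> g \<cdot> h"
    and act_free: "\<lbrakk>e \<in> E; g \<in> carrier G; e \<cdot> g = e\<rbrakk> \<Longrightarrow> g = \<one>"
begin

lemma act_inv [simp]:
  assumes "e \<in> E" "g \<in> carrier G"
  shows "e \<cdot> g \<cdot> inv g = e" "e \<cdot> inv g \<cdot> g = e"
  using assms act_mult[of e g "inv g"] act_mult[of e "inv g" g] by auto

lemma act_eq_iff:
  assumes "e \<in> E" "e' \<in> E" "g \<in> carrier G"
  shows "e \<cdot> g = e' \<cdot> g \<longleftrightarrow> e = e'"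
  by (metis act_inv(1) assms)

lemma act_inj:
  assumes "e \<in> E" "g \<in> carrier G" "h \<in> carrier G" "e \<cdot> g = e \<cdot> h"
  shows "g = h"
proof -
  have "e \<cdot> (g \<otimes> inv h) = e"
    using assms by (simp add: act_mult)
  then have "g \<otimes> inv h = \<one>"
    using act_free assms by simp
  then show ?thesis
    using assms by (metis inv_closed inv_equality inv_inv)
qed

definition transporters :: "'e set \<Rightarrow> 'e set \<Rightarrow> 'a set" where
  "transporters A B = {g \<in> carrier G. \<exists>x \<in> A. x \<cdot> g \<in> B}"

definition overlap :: "'e set \<Rightarrow> 'e set \<Rightarrow> 'a \<Rightarrow> nat" where
  "overlap A B g = card {x \<in> A. x \<cdot> g \<in> B}"

definition excess :: "'e set \<Rightarrow> 'e set \<Rightarrow> nat" where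
  "excess A B = (\<Sum>g \<in> transporters A B. overlap A B g - 2)"

lemma overlap_triples:
  assumes "A \<subseteq> E" "B \<subseteq> E" "finite A" "finite B"
  shows "finite (transporters A B)"
    and "(\<Sum>g \<in> transporters A B. overlap A B g) \<le> card A * card B"
proof -
  let ?P = "SIGMA g : transporters A B. {x \<in> A. x \<cdot> g \<in> B}"
  let ?f = "\<lambda>(g, x). (x, x \<cdot> g)"
  have inj: "inj_on ?f ?P"
    using assms act_inj by (auto simp: inj_on_def transporters_def subset_iff)
  have sub: "?f ` ?P \<subseteq> A \<times> B"
    by auto
  have fin: "finite ?P"
    using inj sub assms by (meson finite_SigmaI finite_imageD finite_subset)
  have "transporters A B \<subseteq> fst ` ?P"
    by (force simp: transporters_def)
  then show ft: "finite (transporters A B)"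
    using fin finite_surj by blast
  have "card ?P \<le> card (A \<times> B)"
    by (rule card_inj_on_le[OF inj sub]) (use assms in simp)
  then show "(\<Sum>g \<in> transporters A B. overlap A B g) \<le> card A * card B"
    using ft assms by (simp add: overlap_def card_cartesian_product)
qed

lemma overlap_le:
  assumes "A \<subseteq> E" "B \<subseteq> E" "finite A" "finite B" "g \<in> carrier G"
  shows "overlap A B g \<le> card B"
  unfolding overlap_def
proof (rule card_inj_on_le[of "\<lambda>x. x \<cdot> g"])
  show "inj_on (\<lambda>x. x \<cdot> g) {x \<in> A. x \<cdot> g \<in> B}"
    using assms by (auto simp: inj_on_def act_eq_iff subset_iff)
qed (use assms in auto)

text \<open>
  Each translate of \<open>A\<close> meets \<open>B\<close> in at most \<open>card B\<close> points, and \<open>b * (r - 2) \<le> (b - 2) * r\<close> for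
  \<open>r \<le> b\<close>; the overlaps add up to at most \<open>card A * card B\<close>. This crude bound is what settles the case that a
  subgroup with at least three elements stabilizes \<open>A\<close>.
\<close>

lemma excess_le:
  assumes "A \<subseteq> E" "B \<subseteq> E" "finite A" "finite B" "card B \<ge> 2"
  shows "excess A B \<le> card A * (card B - 2)"
proof -
  have "card B * excess A B = (\<Sum>g \<in> transporters A B. card B * (overlap A B g - 2))"
    by (simp add: excess_def sum_distrib_left)
  also have "\<dots> \<le> (\<Sum>g \<in> transporters A B. (card B - 2) * overlap A B g)"
  proof (rule sum_mono)
    fix g assume "g \<in> transporters A B"
    then have "overlap A B g \<le> card B"
      using overlap_le assms by (simp add: transporters_def)
    then show "card B * (overlap A B g - 2) \<le> (card B - 2) * overlap A B g"
      by (simp add: diff_mult_distrib diff_mult_distrib2 mult.commute diff_le_mono2)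
  qed
  also have "\<dots> = (card B - 2) * (\<Sum>g \<in> transporters A B. overlap A B g)"
    by (simp add: sum_distrib_left)
  also have "\<dots> \<le> (card B - 2) * (card A * card B)"
    using overlap_triples(2)[OF assms(1-4)] by simp
  finally have "card B * excess A B \<le> card B * (card A * (card B - 2))"
    by (simp add: algebra_simps)
  then show ?thesis
    using assms by simp
qed

lemma excess_commute:
  assumes "A \<subseteq> E" "B \<subseteq> E"
  shows "excess A B = excess B A"
proof -
  have *: "transporters B A \<subseteq> m_inv G ` transporters A B" if "A \<subseteq> E" "B \<subseteq> E" for A B
  proof
    fix g assume "g \<in> transporters B A"
    then obtain x where "g \<in> carrier G" "x \<in> B" "x \<cdot> g \<in> A"
      by (auto simp: transporters_def)
    then have "inv g \<in> transporters A B"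
      using that by (auto simp: transporters_def intro!: bexI[of _ "x \<cdot> g"] dest: subsetD)
    then show "g \<in> m_inv G ` transporters A B"
      using \<open>g \<in> carrier G\<close> by (metis image_eqI inv_inv)
  qed
  have tr: "transporters B A = m_inv G ` transporters A B"
  proof
    show "m_inv G ` transporters A B \<subseteq> transporters B A"
      using *[OF assms(2,1)] by (force simp: transporters_def)
  qed (use * assms in blast)
  have inj: "inj_on (m_inv G) (transporters A B)"
    by (rule inj_onI) (metis (mono_tags, lifting) inv_inv mem_Collect_eq transporters_def)
  have ov: "overlap B A (inv g) = overlap A B g" if "g \<in> transporters A B" for g
  proof -
    have g: "g \<in> carrier G" using that by (simp add: transporters_def)
    have "{x \<in> B. x \<cdot> inv g \<in> A} = (\<lambda>x. x \<cdot> g) ` {x \<in> A. x \<cdot> g \<in> B}"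
      using g assms by (force simp: subset_iff image_iff)
    moreover have "inj_on (\<lambda>x. x \<cdot> g) {x \<in> A. x \<cdot> g \<in> B}"
      using g assms by (auto simp: inj_on_def act_eq_iff subset_iff)
    ultimately show ?thesis
      by (simp add: overlap_def card_image)
  qed
  show ?thesis
    unfolding excess_def tr using inj ov by (simp add: sum.reindex)
qed

lemma excess_translate:
  assumes "A \<subseteq> E" "B \<subseteq> E" "h \<in> carrier G"
  shows "excess ((\<lambda>x. x \<cdot> h) ` A) B = excess A B"
proof -
  let ?A = "(\<lambda>x. x \<cdot> h) ` A"
  have eq: "x \<cdot> h \<cdot> (inv h \<otimes> g) = x \<cdot> g" if "x \<in> A" "g \<in> carrier G" for x g
    using that assms by (simp add: subset_iff act_mult)
  have tr: "transporters ?A B = (\<lambda>g. inv h \<otimes> g) ` transporters A B"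
  proof (intro equalityI subsetI)
    fix g assume "g \<in> transporters ?A B"
    then obtain x where g: "g \<in> carrier G" "x \<in> A" "x \<cdot> h \<cdot> g \<in> B"
      by (auto simp: transporters_def)
    then have "h \<otimes> g \<in> transporters A B"
      using assms by (auto simp: transporters_def act_mult subset_iff intro!: bexI[of _ x])
    moreover have "g = inv h \<otimes> (h \<otimes> g)"
      using g assms by (simp add: m_assoc[symmetric])
    ultimately show "g \<in> (\<lambda>g. inv h \<otimes> g) ` transporters A B"
      by blast
  next
    fix g assume "g \<in> (\<lambda>g. inv h \<otimes> g) ` transporters A B"
    then show "g \<in> transporters ?A B"
      using assms eq by (force simp: transporters_def)
  qed
  have inj: "inj_on (\<lambda>g. inv h \<otimes> g) (transporters A B)"
    using assms by (auto simp: inj_on_def transporters_def)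
  have ov: "overlap ?A B (inv h \<otimes> g) = overlap A B g" if "g \<in> transporters A B" for g
  proof -
    have g: "g \<in> carrier G" using that by (simp add: transporters_def)
    have "{x \<in> ?A. x \<cdot> (inv h \<otimes> g) \<in> B} = (\<lambda>x. x \<cdot> h) ` {x \<in> A. x \<cdot> g \<in> B}"
      using eq g by auto
    moreover have "inj_on (\<lambda>x. x \<cdot> h) {x \<in> A. x \<cdot> g \<in> B}"
      using g assms by (auto simp: inj_on_def act_eq_iff subset_iff)
    ultimately show ?thesis
      by (simp add: overlap_def card_image)
  qed
  show ?thesis
    unfolding excess_def tr using inj ov by (simp add: sum.reindex)
qed

lemma excess_superset:
  assumes "A \<subseteq> C" "C \<subseteq> E" "B \<subseteq> E" "finite C" "finite B"
  shows "excess A B = (\<Sum>g \<in> transporters C B. overlap A B g - 2)"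
  unfolding excess_def
proof (rule sum.mono_neutral_left)
  show "finite (transporters C B)"
    using overlap_triples assms by simp
  show "transporters A B \<subseteq> transporters C B"
    using assms by (auto simp: transporters_def)
  show "\<forall>g \<in> transporters C B - transporters A B. overlap A B g - 2 = 0"
  proof
    fix g assume "g \<in> transporters C B - transporters A B"
    then have "{x \<in> A. x \<cdot> g \<in> B} = {}"
      by (auto simp: transporters_def)
    then show "overlap A B g - 2 = 0"
      by (simp only: overlap_def card.empty)
  qed
qed

text \<open>
  For fixed \<open>g\<close> the overlap is a modular function of \<open>A\<close>, and \<open>r - 2\<close> cut off at \<open>0\<close> is convex in \<open>r\<close>.
\<close>

lemma excess_supermodular:
  assumes "A \<subseteq> E" "A' \<subseteq> E" "B \<subseteq> E" "finite A" "finite A'" "finite B"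
  shows "excess A B + excess A' B \<le> excess (A \<inter> A') B + excess (A \<union> A') B"
proof -
  let ?T = "transporters (A \<union> A') B"
  have ex: "excess X B = (\<Sum>g \<in> ?T. overlap X B g - 2)" if "X \<subseteq> A \<union> A'" for X
    using excess_superset[OF that] assms by simp
  have "overlap A B g - 2 + (overlap A' B g - 2)
      \<le> overlap (A \<inter> A') B g - 2 + (overlap (A \<union> A') B g - 2)" for g
  proof -
    let ?X = "{x \<in> A. x \<cdot> g \<in> B}" and ?Y = "{x \<in> A'. x \<cdot> g \<in> B}"
    have "card ?X + card ?Y = card (?X \<union> ?Y) + card (?X \<inter> ?Y)"
      using assms by (intro card_Un_Int) auto
    moreover have "card ?X \<le> card (?X \<union> ?Y)" "card ?Y \<le> card (?X \<union> ?Y)"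
      using assms by (auto intro!: card_mono)
    moreover have "?X \<union> ?Y = {x \<in> A \<union> A'. x \<cdot> g \<in> B}" "?X \<inter> ?Y = {x \<in> A \<inter> A'. x \<cdot> g \<in> B}"
      by auto
    ultimately show ?thesis
      unfolding overlap_def by simp
  qed
  then have "(\<Sum>g \<in> ?T. overlap A B g - 2) + (\<Sum>g \<in> ?T. overlap A' B g - 2)
      \<le> (\<Sum>g \<in> ?T. overlap (A \<inter> A') B g - 2) + (\<Sum>g \<in> ?T. overlap (A \<union> A') B g - 2)"
    unfolding sum.distrib[symmetric] by (intro sum_mono)
  then show ?thesis
    using ex[of A] ex[of A'] ex[of "A \<inter> A'"] ex[of "A \<union> A'"] by (simp add: le_infI1)
qed

definition setwise_stabilizer :: "'e set \<Rightarrow> 'a set" where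
  "setwise_stabilizer A = {h \<in> carrier G. (\<lambda>x. x \<cdot> h) ` A = A}"

lemma subgroup_stabilizer:
  assumes "A \<subseteq> E"
  shows "subgroup (setwise_stabilizer A) G"
proof
  show "setwise_stabilizer A \<subseteq> carrier G"
    by (auto simp: setwise_stabilizer_def)
  have "(\<lambda>x. x \<cdot> \<one>) ` A = (\<lambda>x. x) ` A"
    using assms by (intro image_cong) auto
  then show "\<one> \<in> setwise_stabilizer A"
    by (simp add: setwise_stabilizer_def)
next
  fix g h assume *: "g \<in> setwise_stabilizer A" "h \<in> setwise_stabilizer A"
  have "(\<lambda>x. x \<cdot> (g \<otimes> h)) ` A = (\<lambda>x. x \<cdot> h) ` (\<lambda>x. x \<cdot> g) ` A"
    using assms * unfolding image_image
    by (intro image_cong) (auto simp: setwise_stabilizer_def act_mult)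
  then show "g \<otimes> h \<in> setwise_stabilizer A"
    using * by (simp add: setwise_stabilizer_def)
next
  fix g assume *: "g \<in> setwise_stabilizer A"
  then have "(\<lambda>x. x \<cdot> inv g) ` A = (\<lambda>x. x \<cdot> inv g) ` (\<lambda>x. x \<cdot> g) ` A"
    by (simp add: setwise_stabilizer_def)
  also have "\<dots> = (\<lambda>x. x) ` A"
    using assms * unfolding image_image
    by (intro image_cong) (auto simp: setwise_stabilizer_def)
  finally show "inv g \<in> setwise_stabilizer A"
    using * by (simp add: setwise_stabilizer_def)
qed

lemma card_stabilizer_le:
  assumes "A \<subseteq> E" "finite A" "A \<noteq> {}"
  shows "finite (setwise_stabilizer A)" "card (setwise_stabilizer A) \<le> card A"
proof -
  obtain x where x: "x \<in> A" using assms by blast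
  have inj: "inj_on (\<lambda>h. x \<cdot> h) (setwise_stabilizer A)"
    using assms x act_inj by (auto simp: inj_on_def setwise_stabilizer_def)
  have sub: "(\<lambda>h. x \<cdot> h) ` setwise_stabilizer A \<subseteq> A"
    using x by (auto simp: setwise_stabilizer_def)
  show "finite (setwise_stabilizer A)"
    using inj sub assms by (meson finite_imageD finite_subset)
  show "card (setwise_stabilizer A) \<le> card A"
    using card_inj_on_le[OF inj sub] assms by simp
qed

text \<open>
  If distinct translates of \<open>A\<close> share at most one point, then two different points of \<open>B\<close> are together in
  few translates of \<open>A\<close>: two such translates differ by an element of the stabilizer. Counting the
  pairs of distinct points of \<open>B\<close> covered by the same translate bounds the sum of \<open>r * (r - 1)\<close>, and
  \<open>6 * (r - 2) \<le> r * (r - 1)\<close>.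
\<close>

lemma excess_le_if_translates_almost_disjoint:
  assumes "A \<subseteq> E" "B \<subseteq> E" "finite A" "finite B" "A \<noteq> {}"
    and disj: "\<And>h. \<lbrakk>h \<in> carrier G; card (A \<inter> (\<lambda>x. x \<cdot> h) ` A) \<ge> 2\<rbrakk> \<Longrightarrow> (\<lambda>x. x \<cdot> h) ` A = A"
  shows "6 * excess A B \<le> card (setwise_stabilizer A) * (card B * (card B - 1))"
proof -
  let ?L = "setwise_stabilizer A"
  have offdiag: "card {(x, y). x \<in> X \<and> y \<in> X \<and> x \<noteq> y} = card X * (card X - 1)" (is "card ?D = _")
    if "finite X" for X :: "'e set"
  proof -
    have "?D = (SIGMA x : X. X - {x})" by auto
    then show ?thesis using that by simp
  qed
  define Q where "Q = (SIGMA g : transporters A B.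
    {(x, y). x \<in> {x \<in> A. x \<cdot> g \<in> B} \<and> y \<in> {x \<in> A. x \<cdot> g \<in> B} \<and> x \<noteq> y})"
  have ft: "finite (transporters A B)"
    using overlap_triples assms by blast
  have cardQ: "card Q = (\<Sum>g \<in> transporters A B. overlap A B g * (overlap A B g - 1))"
  proof -
    have "card Q = (\<Sum>g \<in> transporters A B. card {(x, y). x \<in> {x \<in> A. x \<cdot> g \<in> B} \<and> y \<in> {x \<in> A. x \<cdot> g \<in> B} \<and> x \<noteq> y})"
      unfolding Q_def
    proof (rule card_SigmaI[OF ft], rule ballI)
      fix g
      show "finite {(x, y). x \<in> {x \<in> A. x \<cdot> g \<in> B} \<and> y \<in> {x \<in> A. x \<cdot> g \<in> B} \<and> x \<noteq> y}"
        by (rule finite_subset[of _ "A \<times> A"]) (use assms in auto)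
    qed
    then show ?thesis
      using assms by (simp add: offdiag overlap_def del: mem_Collect_eq)
  qed
  have "6 * excess A B = (\<Sum>g \<in> transporters A B. 6 * (overlap A B g - 2))"
    by (simp add: excess_def sum_distrib_left)
  also have "\<dots> \<le> card Q"
    unfolding cardQ
  proof (rule sum_mono)
    fix g
    have "6 * (k - 2) \<le> k * (k - 1)" for k :: nat
    proof (cases "k \<ge> 3")
      case True
      then obtain m where "k = m + 3" by (metis add.commute le_Suc_ex)
      then show ?thesis by (simp add: algebra_simps)
    next
      case False
      then show ?thesis by simp
    qed
    then show "6 * (overlap A B g - 2) \<le> overlap A B g * (overlap A B g - 1)" .
  qed
  also have "card Q \<le> card ({(b, b'). b \<in> B \<and> b' \<in> B \<and> b \<noteq> b'} \<times> ?L)"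
  proof -
    define ends where "ends = (\<lambda>(g, x, y). (x \<cdot> g, y \<cdot> g))"
    define g0 where "g0 = (\<lambda>p. fst (SOME t. t \<in> Q \<and> ends t = p))"
    let ?f = "\<lambda>t. (ends t, fst t \<otimes> inv (g0 (ends t)))"
    have Q: "g \<in> carrier G \<and> x \<in> A \<and> y \<in> A \<and> x \<noteq> y \<and> x \<cdot> g \<in> B \<and> y \<cdot> g \<in> B"
      if "(g, x, y) \<in> Q" for g x y
      using that by (auto simp: Q_def transporters_def)
    have g0: "\<exists>x0 y0. (g0 (ends t), x0, y0) \<in> Q \<and> ends (g0 (ends t), x0, y0) = ends t"
      if "t \<in> Q" for t
    proof -
      have "(SOME t'. t' \<in> Q \<and> ends t' = ends t) \<in> Q \<and> ends (SOME t'. t' \<in> Q \<and> ends t' = ends t) = ends t"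
        by (rule someI[of _ t]) (use that in auto)
      then show ?thesis
        unfolding g0_def by (cases "SOME t'. t' \<in> Q \<and> ends t' = ends t") auto
    qed
    have sub: "?f ` Q \<subseteq> {(b, b'). b \<in> B \<and> b' \<in> B \<and> b \<noteq> b'} \<times> ?L"
    proof (rule image_subsetI)
      fix t assume t: "t \<in> Q"
      obtain g x y where teq: "t = (g, x, y)" by (cases t)
      note q = Q[OF t[unfolded teq]]
      obtain x0 y0 where t0: "(g0 (ends t), x0, y0) \<in> Q" "ends (g0 (ends t), x0, y0) = ends t"
        using g0 t by blast
      note q0 = Q[OF t0(1)]
      let ?g0 = "g0 (ends t)"
      let ?h = "g \<otimes> inv ?g0"
      have h: "?h \<in> carrier G" using q q0 by simp
      have e: "x0 \<cdot> ?g0 = x \<cdot> g" "y0 \<cdot> ?g0 = y \<cdot> g"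
        using t0(2) by (auto simp: ends_def teq)
      have in_E: "x \<in> E" "y \<in> E" "x0 \<in> E" "y0 \<in> E"
        using q q0 assms(1) by auto
      have xh: "x \<cdot> ?h = x0" "y \<cdot> ?h = y0"
        using q q0 in_E by (simp_all add: act_mult flip: e)
      have "card {x0, y0} \<le> card (A \<inter> (\<lambda>x. x \<cdot> ?h) ` A)"
        using q q0 xh assms(3) by (intro card_mono) auto
      then have "card (A \<inter> (\<lambda>x. x \<cdot> ?h) ` A) \<ge> 2"
        using q0 by simp
      then have "?h \<in> ?L"
        using disj h by (simp add: setwise_stabilizer_def)
      moreover have "x \<cdot> g \<noteq> y \<cdot> g"
        using q assms(1) by (auto simp: act_eq_iff subset_iff)
      ultimately show "?f t \<in> {(b, b'). b \<in> B \<and> b' \<in> B \<and> b \<noteq> b'} \<times> ?L"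
        using q by (simp add: teq ends_def)
    qed
    have inj: "inj_on ?f Q"
    proof (rule inj_onI)
      fix t t' assume t: "t \<in> Q" and t': "t' \<in> Q" and eq: "?f t = ?f t'"
      obtain g x y g' x' y' where teq: "t = (g, x, y)" "t' = (g', x', y')" by (cases t, cases t')
      note q = Q[OF t[unfolded teq]] and q' = Q[OF t'[unfolded teq]]
      have g0c: "g0 (ends t) \<in> carrier G"
        using g0[OF t] Q by blast
      have "g \<otimes> inv (g0 (ends t)) = g' \<otimes> inv (g0 (ends t))"
        using eq by (auto simp: teq)
      then have g: "g = g'"
        using q q' g0c by simp
      have "ends t = ends t'" using eq by simp
      then have "x = x'" "y = y'"
        using q q' assms(1) by (auto simp: teq ends_def g act_eq_iff subset_iff)
      then show "t = t'" using g teq by simp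
    qed
    have "finite {(b, b'). b \<in> B \<and> b' \<in> B \<and> b \<noteq> b'}"
      by (rule finite_subset[of _ "B \<times> B"]) (use assms in auto)
    then show ?thesis
      using card_inj_on_le[OF inj sub] card_stabilizer_le[OF assms(1,3,5)] by simp
  qed
  also have "\<dots> = card ?L * (card B * (card B - 1))"
    using assms by (simp add: card_cartesian_product offdiag)
  finally show ?thesis .
qed

text \<open>
  With a stabilizer of order one or two, the pair count is strong enough as soon as \<open>B\<close> is not larger
  than \<open>A\<close>. The one case that escapes the arithmetic, \<open>card A = card B = 3\<close> with a stabilizer of order
  two, cannot occur.
\<close>

lemma excess_le_if_extremal:
  assumes "A \<subseteq> E" "B \<subseteq> E" "finite A" "finite B" "3 \<le> card B" "card B \<le> card A"
    and disj: "\<And>h. \<lbrakk>h \<in> carrier G; card (A \<inter> (\<lambda>x. x \<cdot> h) ` A) \<ge> 2\<rbrakk> \<Longrightarrow> (\<lambda>x. x \<cdot> h) ` A = A"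
    and stab: "card (setwise_stabilizer A) \<le> 2"
  shows "excess A B \<le> (card A - 2) * (card B - 2)"
proof -
  let ?L = "setwise_stabilizer A"
  have "A \<noteq> {}" using assms by auto
  have bound: "6 * excess A B \<le> card ?L * (card B * (card B - 1))"
    by (rule excess_le_if_translates_almost_disjoint) (use assms \<open>A \<noteq> {}\<close> in auto)
  obtain k where k: "card B = k + 3"
    using assms by (metis add.commute le_Suc_ex)
  obtain l where l: "card A = k + 3 + l"
    using assms k by (metis le_Suc_ex)
  have "finite ?L" using card_stabilizer_le assms \<open>A \<noteq> {}\<close> by blast
  have one: "\<one> \<in> ?L" using subgroup_stabilizer[OF assms(1)] by (rule subgroup.one_closed)
  show ?thesis
  proof (cases "card ?L = 2")
    case False
    then have "card ?L \<le> 1" using stab by simp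
    then have "6 * excess A B \<le> 1 * (card B * (card B - 1))"
      using bound by (meson le_trans mult_le_mono1)
    then show ?thesis by (simp add: k l algebra_simps)
  next
    case True
    \<comment> \<open>The stabilizer contains an involution, which acts on \<open>A\<close> without fixed points.\<close>
    have "card A \<noteq> 3"
    proof
      assume "card A = 3"
      obtain h where h: "?L = {\<one>, h}" "h \<noteq> \<one>"
        using True one by (auto simp: card_2_iff insert_commute)
      then have hc: "h \<in> carrier G" and stable: "(\<lambda>x. x \<cdot> h) ` A = A"
        by (auto simp: setwise_stabilizer_def)
      have "h \<otimes> h \<in> ?L"
        using subgroup.m_closed[OF subgroup_stabilizer[OF assms(1)]] h by simp
      then have hh: "h \<otimes> h = \<one>"
        using h hc by (metis insertE r_cancel_one singletonD)
      have inv: "x \<cdot> h \<cdot> h = x" if "x \<in> A" for x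
        using that hc hh assms(1) by (metis act_mult act_one subsetD)
      have move: "x \<cdot> h \<noteq> x" if "x \<in> A" for x
        using that act_free hc h assms(1) by blast
      have stay: "x \<cdot> h \<in> A" if "x \<in> A" for x
        using that stable by blast
      obtain x where x: "x \<in> A" using \<open>A \<noteq> {}\<close> by blast
      have "card (A - {x, x \<cdot> h}) = 1"
        using \<open>card A = 3\<close> x stay[OF x] move[OF x] assms(3) by (simp add: card_Diff_subset)
      then obtain z where z: "A - {x, x \<cdot> h} = {z}"
        by (auto simp: card_1_singleton_iff)
      then have "z \<in> A" "z \<noteq> x" "z \<noteq> x \<cdot> h" by auto
      then have "z \<cdot> h \<in> {x, x \<cdot> h}"
        using z stay move by blast
      then show False
        using inv[OF \<open>z \<in> A\<close>] inv[OF x] \<open>z \<noteq> x\<close> \<open>z \<noteq> x \<cdot> h\<close> by auto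
    qed
    then have "k + l \<ge> 1" using l by linarith
    have "3 * excess A B \<le> card B * (card B - 1)"
      using bound True by simp
    also have "\<dots> = (k + 3) * (k + 2)" by (simp add: k)
    also have "\<dots> \<le> 3 * ((k + l + 1) * (k + 1))"
    proof (cases k)
      case 0
      then show ?thesis using \<open>k + l \<ge> 1\<close> by simp
    next
      case (Suc m)
      then show ?thesis by (simp add: algebra_simps)
    qed
    finally show ?thesis by (simp add: k l algebra_simps)
  qed
qed

text \<open>
  The constant is \<open>n / d\<close>. Take a counterexample in which \<open>B\<close> is as small as possible; the roles of
  \<open>A\<close> and \<open>B\<close> can be exchanged, so \<open>A\<close> is at least as large as \<open>B\<close>. For this \<open>B\<close> choose \<open>A\<close> with the largest
  value of \<open>d * excess A B - n * (card B - 2) * card A\<close>, and of the least cardinality among those. The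
  function is supermodular and invariant under translation. If a translate \<open>A'\<close> of \<open>A\<close> differed
  from \<open>A\<close> but shared two points with it, then \<open>A \<inter> A'\<close> would be another maximizer, of smaller
  cardinality. So distinct translates of \<open>A\<close> share at most one point. Then \<open>A\<close> satisfies the inequality after all, by
  \<open>excess_le_if_extremal\<close> if the stabilizer of \<open>A\<close> has order one or two, and by \<open>excess_le\<close> and the
  hypothesis on subgroups otherwise.
\<close>

theorem excess_bound:
  fixes n d :: nat
  assumes "A \<subseteq> E" "B \<subseteq> E" "finite A" "finite B" "card A \<ge> 2" "card B \<ge> 2"
    and "d \<le> n"
    and small: "\<And>L. \<lbrakk>subgroup L G; finite L; card L \<ge> 3\<rbrakk> \<Longrightarrow> d * card L \<le> n * (card L - 2)"
  shows "d * excess A B \<le> n * ((card A - 2) * (card B - 2))"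
proof (rule ccontr)
  assume contra: "\<not> ?thesis"
  define bad where "bad = (\<lambda>A B. A \<subseteq> E \<and> B \<subseteq> E \<and> finite A \<and> finite B \<and> card A \<ge> 2 \<and> card B \<ge> 2 \<and>
    n * ((card A - 2) * (card B - 2)) < d * excess A B)"
  have bad_sym: "bad B A" if "bad A B" for A B
    using that excess_commute by (auto simp: bad_def mult.commute)
  obtain B where ex_bad: "\<exists>A. bad A B" and B_least: "\<And>A B'. bad A B' \<Longrightarrow> card B \<le> card B'"
  proof -
    have "\<exists>B. (\<exists>A. bad A B) \<and> (\<forall>B'. (\<exists>A. bad A B') \<longrightarrow> card B \<le> card B')"
    proof (rule ex_has_least_nat)
      show "\<exists>A. bad A B"
        by (rule exI[of _ A]) (use contra assms in \<open>simp add: bad_def\<close>)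
    qed
    then show thesis using that by blast
  qed
  then have B: "B \<subseteq> E" "finite B" "card B \<ge> 2"
    by (auto simp: bad_def)
  \<comment> \<open>The negative of the function to be maximized; by \<open>excess_le\<close> the subtraction is not truncated.\<close>
  define q where "q = (\<lambda>A. n * (card B - 2) * card A - d * excess A B)"
  have q_add: "q A + d * excess A B = n * (card B - 2) * card A" if "A \<subseteq> E" "finite A" for A
  proof -
    have "d * excess A B \<le> n * (card A * (card B - 2))"
      using excess_le[OF that(1) B(1) that(2) B(2,3)] \<open>d \<le> n\<close> by (rule mult_le_mono[rotated])
    then show ?thesis
      by (simp add: q_def algebra_simps)
  qed
  have bad_iff: "bad A B \<longleftrightarrow> q A < 2 * (n * (card B - 2))"
    if "A \<subseteq> E" "finite A" and two: "card A \<ge> 2" for A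
  proof -
    define x where "x = n * (card B - 2)"
    obtain m where m: "card A = m + 2"
      using le_Suc_ex[OF two] by (auto simp: add.commute)
    have "n * ((card A - 2) * (card B - 2)) = m * x"
      unfolding m x_def by (metis diff_add_inverse2 mult.left_commute)
    then have "bad A B \<longleftrightarrow> m * x < d * excess A B"
      unfolding bad_def using that two B by metis
    moreover have "q A + d * excess A B = m * x + 2 * x"
      using q_add[OF that(1,2)] unfolding m x_def[symmetric] by (simp only: add_mult_distrib2 mult.commute)
    ultimately show ?thesis
      unfolding x_def[symmetric] by linarith
  qed
  obtain A where A: "bad A B" and A_least: "\<And>A'. bad A' B \<Longrightarrow> q A \<le> q A'"
    and A_small: "\<And>A'. \<lbrakk>bad A' B; q A' = q A\<rbrakk> \<Longrightarrow> card A \<le> card A'"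
  proof -
    obtain A0 where A0: "bad A0 B" using ex_bad by blast
    obtain A1 where A1: "bad A1 B" "\<forall>A'. bad A' B \<longrightarrow> q A1 \<le> q A'"
      using ex_has_least_nat[of "\<lambda>A. bad A B" A0 q] A0 by blast
    obtain A where "bad A B \<and> q A = q A1" "\<forall>A'. bad A' B \<and> q A' = q A1 \<longrightarrow> card A \<le> card A'"
      using ex_has_least_nat[of "\<lambda>A. bad A B \<and> q A = q A1" A1 card] A1 by blast
    then show thesis using A1 that by metis
  qed
  then have A': "A \<subseteq> E" "finite A" "card A \<ge> 2" "A \<noteq> {}"
    and A_bad: "n * ((card A - 2) * (card B - 2)) < d * excess A B"
    by (auto simp: bad_def)
  have "card B \<le> card A"
    using B_least bad_sym A by blast
  have "card B \<noteq> 2"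
    using A_bad excess_le[OF A'(1) B(1) A'(2) B(2,3)] by auto
  then have "card B \<ge> 3" using B by simp
  have disj: "(\<lambda>x. x \<cdot> h) ` A = A" if "h \<in> carrier G" "card (A \<inter> (\<lambda>x. x \<cdot> h) ` A) \<ge> 2" for h
  proof (rule ccontr)
    let ?A = "(\<lambda>x. x \<cdot> h) ` A"
    assume "?A \<noteq> A"
    have fA: "?A \<subseteq> E" "finite ?A" using A' that by auto
    have cA: "card ?A = card A"
      using A' that by (intro card_image) (auto simp: inj_on_def act_eq_iff subset_iff)
    have sub_E: "A \<inter> ?A \<subseteq> E" "A \<union> ?A \<subseteq> E" and sub_fin: "finite (A \<inter> ?A)" "finite (A \<union> ?A)"
      using A' fA by auto
    have psub: "A \<inter> ?A \<subset> A"
      using \<open>?A \<noteq> A\<close> cA A' by (metis card_subset_eq inf.orderE inf_le1 inf_commute psubsetI fA(2))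
    have "card (A \<union> ?A) \<ge> card A" using A' by (intro card_mono) auto
    have "d * excess A B + d * excess ?A B \<le> d * excess (A \<inter> ?A) B + d * excess (A \<union> ?A) B"
      using mult_le_mono2[OF excess_supermodular[OF A'(1) fA(1) B(1) A'(2) fA(2) B(2)], of d]
      by (simp add: algebra_simps)
    then have ex: "2 * (d * excess A B) \<le> d * excess (A \<inter> ?A) B + d * excess (A \<union> ?A) B"
      using excess_translate[OF A'(1) B(1) that(1)] by simp
    have "card A + card A = card (A \<union> ?A) + card (A \<inter> ?A)"
      using card_Un_Int[OF A'(2) fA(2)] cA by simp
    then have "n * (card B - 2) * card A + n * (card B - 2) * card A
        = n * (card B - 2) * card (A \<union> ?A) + n * (card B - 2) * card (A \<inter> ?A)"
      by (metis add_mult_distrib2)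
    then have "q (A \<inter> ?A) + q (A \<union> ?A) \<le> q A + q A"
      using ex q_add[OF A'(1,2)] q_add[OF sub_E(1) sub_fin(1)] q_add[OF sub_E(2) sub_fin(2)] by linarith
    moreover have "q A \<le> q (A \<union> ?A)"
    proof (cases "bad (A \<union> ?A) B")
      case False
      then show ?thesis
        using bad_iff[of "A \<union> ?A"] bad_iff[of A] A A' fA \<open>card (A \<union> ?A) \<ge> card A\<close> by auto
    qed (use A_least in blast)
    ultimately have le: "q (A \<inter> ?A) \<le> q A" by simp
    then have "bad (A \<inter> ?A) B"
      using bad_iff[of "A \<inter> ?A"] bad_iff[of A] A A' that by auto
    moreover have "card (A \<inter> ?A) < card A"
      using psub A' by (simp add: psubset_card_mono)
    ultimately show False
      using A_least A_small le by (metis le_antisym not_le)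
  qed
  let ?L = "setwise_stabilizer A"
  have L: "subgroup ?L G" "finite ?L" "card ?L \<le> card A"
    using subgroup_stabilizer card_stabilizer_le A' by auto
  show False
  proof (cases "card ?L \<ge> 3")
    case True
    then obtain l where l: "card ?L = l + 3" by (metis add.commute le_Suc_ex)
    obtain m where m: "card A = l + 3 + m" using L l by (metis le_Suc_ex)
    have "d * (l + 3) \<le> n * (l + 1)"
      using small[OF L(1,2) True] by (simp add: l)
    then have "d * (l + 3) + d * m \<le> n * (l + 1) + n * m"
      using \<open>d \<le> n\<close> by (intro add_mono mult_le_mono1)
    then have "d * (l + 3 + m) \<le> n * (l + 1 + m)"
      by (simp only: add_mult_distrib2)
    then have "d * card A \<le> n * (card A - 2)"
      by (simp add: m)
    then have "d * card A * (card B - 2) \<le> n * (card A - 2) * (card B - 2)"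
      by (rule mult_le_mono1)
    moreover have "d * excess A B \<le> d * (card A * (card B - 2))"
      using excess_le[OF A'(1) B(1) A'(2) B(2,3)] by simp
    ultimately show False using A_bad unfolding mult.assoc by linarith
  next
    case False
    then have "excess A B \<le> (card A - 2) * (card B - 2)"
      using excess_le_if_extremal A' B disj \<open>card B \<ge> 3\<close> \<open>card B \<le> card A\<close> by simp
    then have "d * excess A B \<le> n * ((card A - 2) * (card B - 2))"
      using \<open>d \<le> n\<close> by (rule mult_le_mono[rotated])
    then show False using A_bad by simp
  qed
qed

end

section \<open>Invariant subgraphs and their quotients\<close>

text \<open>
  Edges are abstract, with end vertices given by the maps \<open>p\<close> and \<open>q\<close> to the two vertex classes of a
  bipartite graph. The definition says that the graph with edge set \<open>Y\<close> is connected, isolated vertices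
  being disregarded.
\<close>

definition edge_connected :: "('e \<Rightarrow> 'v) \<Rightarrow> ('e \<Rightarrow> 'w) \<Rightarrow> 'e set \<Rightarrow> bool" where
  "edge_connected p q Y \<longleftrightarrow>
    (\<forall>P :: 'e \<Rightarrow> bool. (\<forall>e \<in> Y. \<forall>e' \<in> Y. p e = p e' \<or> q e = q e' \<longrightarrow> P e = P e') \<longrightarrow>
      (\<forall>e \<in> Y. \<forall>e' \<in> Y. P e = P e'))"

lemma edge_connectedD:
  fixes P :: "'e \<Rightarrow> bool"
  assumes conn: "edge_connected p q Y"
    and p: "\<And>e e'. \<lbrakk>e \<in> Y; e' \<in> Y; p e = p e'\<rbrakk> \<Longrightarrow> P e = P e'"
    and q: "\<And>e e'. \<lbrakk>e \<in> Y; e' \<in> Y; q e = q e'\<rbrakk> \<Longrightarrow> P e = P e'"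
    and "e \<in> Y" "e' \<in> Y"
  shows "P e = P e'"
proof -
  have "(\<forall>e \<in> Y. \<forall>e' \<in> Y. p e = p e' \<or> q e = q e' \<longrightarrow> P e = P e') \<longrightarrow>
      (\<forall>e \<in> Y. \<forall>e' \<in> Y. P e = P e')"
    using conn unfolding edge_connected_def by (rule spec)
  moreover have "\<forall>e \<in> Y. \<forall>e' \<in> Y. p e = p e' \<or> q e = q e' \<longrightarrow> P e = P e'"
  proof (intro ballI impI)
    fix x y assume xy: "x \<in> Y" "y \<in> Y" and "p x = p y \<or> q x = q y"
    from this(3) show "P x = P y"
      by (rule disjE) (erule p[OF xy], erule q[OF xy])
  qed
  ultimately show ?thesis using assms(4,5) by blast
qed

lemma edge_connectedI:
  fixes p :: "'e \<Rightarrow> 'v"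
  assumes "\<And>P :: 'e \<Rightarrow> bool. \<And>e e'. \<lbrakk>\<And>e e'. \<lbrakk>e \<in> Y; e' \<in> Y; p e = p e'\<rbrakk> \<Longrightarrow> P e = P e';
      \<And>e e'. \<lbrakk>e \<in> Y; e' \<in> Y; q e = q e'\<rbrakk> \<Longrightarrow> P e = P e'; e \<in> Y; e' \<in> Y\<rbrakk> \<Longrightarrow> P e = P e'"
  shows "edge_connected p q Y"
  unfolding edge_connected_def
proof (intro allI impI ballI)
  fix P :: "'e \<Rightarrow> bool" and e e'
  assume P: "\<forall>e \<in> Y. \<forall>e' \<in> Y. p e = p e' \<or> q e = q e' \<longrightarrow> P e = P e'" and "e \<in> Y" "e' \<in> Y"
  show "P e = P e'"
    by (rule assms) (use P \<open>e \<in> Y\<close> \<open>e' \<in> Y\<close> in blast)+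
qed

lemma edge_connected_swap:
  assumes "edge_connected p q Y"
  shows "edge_connected q p Y"
proof (rule edge_connectedI)
  fix P :: "'a \<Rightarrow> bool" and e e'
  assume "\<And>e e'. \<lbrakk>e \<in> Y; e' \<in> Y; q e = q e'\<rbrakk> \<Longrightarrow> P e = P e'"
    and "\<And>e e'. \<lbrakk>e \<in> Y; e' \<in> Y; p e = p e'\<rbrakk> \<Longrightarrow> P e = P e'" and "e \<in> Y" "e' \<in> Y"
  note * = this
  show "P e = P e'"
    by (rule edge_connectedD[OF assms, where P = P, OF *(2) *(1) *(3,4)])
qed

definition star :: "('e \<Rightarrow> 'v) \<Rightarrow> 'e set \<Rightarrow> 'e \<Rightarrow> 'e set" where
  "star \<pi> Y e = {e' \<in> Y. \<pi> e' = \<pi> e}"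

context free_action
begin

definition orbit :: "'a set \<Rightarrow> 'e \<Rightarrow> 'e set" where
  "orbit H e = (\<lambda>h. e \<cdot> h) ` H"

text \<open>
  An orbit of vertices is represented by the set of edges of \<open>Y\<close> that end in it, so that only the action on
  edges has to be carried along.
\<close>

definition vertex_orbit :: "('e \<Rightarrow> 'v) \<Rightarrow> 'a set \<Rightarrow> 'e set \<Rightarrow> 'e \<Rightarrow> 'e set" where
  "vertex_orbit \<pi> H Y e = {e' \<in> Y. \<exists>h \<in> H. \<pi> e' = \<pi> (e \<cdot> h)}"

definition equivariant :: "('e \<Rightarrow> 'v) \<Rightarrow> bool" where
  "equivariant \<pi> \<longleftrightarrow>
    (\<forall>e \<in> E. \<forall>e' \<in> E. \<forall>g \<in> carrier G. \<pi> e = \<pi> e' \<longrightarrow> \<pi> (e \<cdot> g) = \<pi> (e' \<cdot> g))"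

definition free_at :: "('e \<Rightarrow> 'v) \<Rightarrow> 'a set \<Rightarrow> bool" where
  "free_at \<pi> H \<longleftrightarrow> (\<forall>e \<in> E. \<forall>h \<in> H. \<pi> (e \<cdot> h) = \<pi> e \<longrightarrow> h = \<one>)"

definition cofinite_subgraph :: "'a set \<Rightarrow> 'e set \<Rightarrow> bool" where
  "cofinite_subgraph H Y \<longleftrightarrow> subgroup H G \<and> Y \<subseteq> E \<and> (\<forall>e \<in> Y. \<forall>h \<in> H. e \<cdot> h \<in> Y) \<and>
    finite (orbit H ` Y)"

lemma cofinite_subgraphD:
  assumes "cofinite_subgraph H Y"
  shows "subgroup H G" "Y \<subseteq> E" "finite (orbit H ` Y)"
    and "\<And>e h. \<lbrakk>e \<in> Y; h \<in> H\<rbrakk> \<Longrightarrow> e \<cdot> h \<in> Y"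
    and "\<And>h. h \<in> H \<Longrightarrow> h \<in> carrier G" "\<And>e. e \<in> Y \<Longrightarrow> e \<in> E"
    and "\<one> \<in> H" "\<And>h. h \<in> H \<Longrightarrow> inv h \<in> H" "\<And>h k. \<lbrakk>h \<in> H; k \<in> H\<rbrakk> \<Longrightarrow> h \<otimes> k \<in> H"
  using assms
  by (auto simp: cofinite_subgraph_def subgroup.one_closed subgroup.m_inv_closed subgroup.m_closed
      dest: subgroup.mem_carrier)

lemma equivariantD:
  "\<lbrakk>equivariant \<pi>; e \<in> E; e' \<in> E; g \<in> carrier G; \<pi> e = \<pi> e'\<rbrakk> \<Longrightarrow> \<pi> (e \<cdot> g) = \<pi> (e' \<cdot> g)"
  unfolding equivariant_def by blast

lemma equivariant_move:
  assumes "equivariant \<pi>" "e \<in> E" "e' \<in> E" "g \<in> carrier G" "\<pi> e = \<pi> (e' \<cdot> g)"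
  shows "\<pi> e' = \<pi> (e \<cdot> inv g)"
  using equivariantD[OF assms(1), of e "e' \<cdot> g" "inv g"] assms by simp

lemma free_atD: "\<lbrakk>free_at \<pi> H; e \<in> E; h \<in> H; \<pi> (e \<cdot> h) = \<pi> e\<rbrakk> \<Longrightarrow> h = \<one>"
  unfolding free_at_def by blast

lemma free_at_subset: "\<lbrakk>free_at \<pi> H; H' \<subseteq> H\<rbrakk> \<Longrightarrow> free_at \<pi> H'"
  by (auto simp: free_at_def)

lemma free_at_inj:
  assumes "free_at \<pi> H" "equivariant \<pi>" "subgroup H G" "e \<in> E" "h \<in> H" "k \<in> H"
    "\<pi> (e \<cdot> h) = \<pi> (e \<cdot> k)"
  shows "h = k"
proof -
  have hk: "h \<in> carrier G" "k \<in> carrier G"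
    using assms(3,5,6) by (auto dest: subgroup.mem_carrier)
  have "\<pi> e = \<pi> (e \<cdot> h \<cdot> inv k)"
    using equivariant_move[OF assms(2), of "e \<cdot> h" e k] assms hk by simp
  then have "\<pi> (e \<cdot> (h \<otimes> inv k)) = \<pi> e"
    using assms hk by (simp add: act_mult)
  then have "h \<otimes> inv k = \<one>"
    using free_atD assms by (meson subgroup.m_closed subgroup.m_inv_closed)
  then show ?thesis
    using hk by (metis inv_closed inv_equality inv_inv)
qed

lemma orbit_eq_iff:
  assumes "subgroup H G" "e \<in> E" "e' \<in> E"
  shows "orbit H e = orbit H e' \<longleftrightarrow> (\<exists>h \<in> H. e' = e \<cdot> h)"
proof
  have "e' \<cdot> \<one> \<in> orbit H e'"
    using subgroup.one_closed[OF assms(1)] by (auto simp: orbit_def)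
  moreover assume "orbit H e = orbit H e'"
  ultimately have "e' \<in> orbit H e" using assms by simp
  then show "\<exists>h \<in> H. e' = e \<cdot> h" by (auto simp: orbit_def)
next
  assume "\<exists>h \<in> H. e' = e \<cdot> h"
  then obtain h where h: "h \<in> H" "e' = e \<cdot> h" by blast
  have hc: "h \<in> carrier G" using h assms(1) by (meson subgroup.mem_carrier)
  show "orbit H e = orbit H e'"
  proof (intro equalityI subsetI)
    fix x assume "x \<in> orbit H e"
    then obtain k where k: "k \<in> H" "x = e \<cdot> k" by (auto simp: orbit_def)
    have kc: "k \<in> carrier G" using k assms(1) by (meson subgroup.mem_carrier)
    have "x = e' \<cdot> (inv h \<otimes> k)"
      using assms h k hc kc by (simp add: act_mult)
    moreover have "inv h \<otimes> k \<in> H"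
      using assms h k by (simp add: subgroup.m_closed subgroup.m_inv_closed)
    ultimately show "x \<in> orbit H e'" by (auto simp: orbit_def)
  next
    fix x assume "x \<in> orbit H e'"
    then obtain k where k: "k \<in> H" "x = e' \<cdot> k" by (auto simp: orbit_def)
    have kc: "k \<in> carrier G" using k assms(1) by (meson subgroup.mem_carrier)
    have "x = e \<cdot> (h \<otimes> k)"
      using assms h k hc kc by (simp add: act_mult)
    moreover have "h \<otimes> k \<in> H"
      using assms h k by (simp add: subgroup.m_closed)
    ultimately show "x \<in> orbit H e" by (auto simp: orbit_def)
  qed
qed

lemma mem_vertex_orbit: "\<lbrakk>cofinite_subgraph H Y; e \<in> Y\<rbrakk> \<Longrightarrow> e \<in> vertex_orbit \<pi> H Y e"
  unfolding vertex_orbit_def using cofinite_subgraphD(6,7)[of H Y] by (auto intro!: bexI[of _ \<one>])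

lemma vertex_orbit_eq_iff:
  assumes Y: "cofinite_subgraph H Y" and \<pi>: "equivariant \<pi>" and "e \<in> Y" "e' \<in> Y"
  shows "vertex_orbit \<pi> H Y e = vertex_orbit \<pi> H Y e' \<longleftrightarrow> (\<exists>h \<in> H. \<pi> e' = \<pi> (e \<cdot> h))"
proof
  note D = cofinite_subgraphD[OF Y]
  show "\<exists>h \<in> H. \<pi> e' = \<pi> (e \<cdot> h)" if "vertex_orbit \<pi> H Y e = vertex_orbit \<pi> H Y e'"
  proof -
    have "e' \<in> vertex_orbit \<pi> H Y e"
      unfolding that using Y \<open>e' \<in> Y\<close> by (rule mem_vertex_orbit)
    then show ?thesis by (simp add: vertex_orbit_def)
  qed
  assume "\<exists>h \<in> H. \<pi> e' = \<pi> (e \<cdot> h)"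
  then obtain h where h: "h \<in> H" "\<pi> e' = \<pi> (e \<cdot> h)" by blast
  show "vertex_orbit \<pi> H Y e = vertex_orbit \<pi> H Y e'"
  proof (intro equalityI subsetI)
    fix x assume "x \<in> vertex_orbit \<pi> H Y e"
    then obtain k where k: "k \<in> H" "\<pi> x = \<pi> (e \<cdot> k)" "x \<in> Y" by (auto simp: vertex_orbit_def)
    have "\<pi> e = \<pi> (e' \<cdot> inv h)"
      using equivariant_move[OF \<pi>, of e' e h] h D assms by auto
    then have "\<pi> (e \<cdot> k) = \<pi> (e' \<cdot> inv h \<cdot> k)"
      using equivariantD[OF \<pi>] k h D assms by auto
    then have "\<pi> x = \<pi> (e' \<cdot> (inv h \<otimes> k))"
      using k h D assms by (auto simp: act_mult)
    then show "x \<in> vertex_orbit \<pi> H Y e'"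
      using k h D by (auto simp: vertex_orbit_def)
  next
    fix x assume "x \<in> vertex_orbit \<pi> H Y e'"
    then obtain k where k: "k \<in> H" "\<pi> x = \<pi> (e' \<cdot> k)" "x \<in> Y" by (auto simp: vertex_orbit_def)
    have "\<pi> (e' \<cdot> k) = \<pi> (e \<cdot> h \<cdot> k)"
      using equivariantD[OF \<pi>] k h D assms by auto
    then have "\<pi> x = \<pi> (e \<cdot> (h \<otimes> k))"
      using k h D assms by (auto simp: act_mult)
    then show "x \<in> vertex_orbit \<pi> H Y e"
      using k h D by (auto simp: vertex_orbit_def)
  qed
qed

lemma vertex_orbit_eqI:
  assumes "cofinite_subgraph H Y" "equivariant \<pi>" "e \<in> Y" "e' \<in> Y" "\<pi> e = \<pi> e'"
  shows "vertex_orbit \<pi> H Y e = vertex_orbit \<pi> H Y e'"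
  using vertex_orbit_eq_iff[OF assms(1-4)] cofinite_subgraphD[OF assms(1)] assms(3,5)
  by (metis act_one)

lemma vertex_orbit_disjoint:
  assumes "cofinite_subgraph H Y" "equivariant \<pi>" "e \<in> Y" "e' \<in> Y"
    "x \<in> vertex_orbit \<pi> H Y e" "x \<in> vertex_orbit \<pi> H Y e'"
  shows "vertex_orbit \<pi> H Y e = vertex_orbit \<pi> H Y e'"
proof -
  have "x \<in> Y" using assms by (auto simp: vertex_orbit_def)
  then have "vertex_orbit \<pi> H Y e = vertex_orbit \<pi> H Y x" "vertex_orbit \<pi> H Y e' = vertex_orbit \<pi> H Y x"
    using vertex_orbit_eq_iff[OF assms(1,2)] assms(3-6) by (auto simp: vertex_orbit_def)
  then show ?thesis by simp
qed

lemma finite_vertex_orbits: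
  assumes "cofinite_subgraph H Y" "equivariant \<pi>"
  shows "finite (vertex_orbit \<pi> H Y ` Y)"
proof -
  note D = cofinite_subgraphD[OF assms(1)]
  have "vertex_orbit \<pi> H Y ` Y \<subseteq> (\<lambda>V. vertex_orbit \<pi> H Y (SOME e. e \<in> V)) ` orbit H ` Y"
  proof
    fix V assume "V \<in> vertex_orbit \<pi> H Y ` Y"
    then obtain e where e: "e \<in> Y" "V = vertex_orbit \<pi> H Y e" by blast
    have "e \<cdot> \<one> \<in> orbit H e" using D by (auto simp: orbit_def)
    then have "(SOME x. x \<in> orbit H e) \<in> orbit H e" by (rule someI)
    then obtain h where h: "h \<in> H" "(SOME x. x \<in> orbit H e) = e \<cdot> h" by (auto simp: orbit_def)
    then have "vertex_orbit \<pi> H Y e = vertex_orbit \<pi> H Y (SOME x. x \<in> orbit H e)"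
      using vertex_orbit_eq_iff[OF assms] e D by auto
    then show "V \<in> (\<lambda>V. vertex_orbit \<pi> H Y (SOME e. e \<in> V)) ` orbit H ` Y"
      using e by auto
  qed
  then show ?thesis
    using D(3) finite_surj by blast
qed

lemma degree_sum:
  assumes Y: "cofinite_subgraph H Y" and \<pi>: "equivariant \<pi>"
  shows "(\<Sum>V \<in> vertex_orbit \<pi> H Y ` Y. card (orbit H ` V)) = card (orbit H ` Y)"
proof -
  note D = cofinite_subgraphD[OF Y]
  have eq: "orbit H ` Y = (\<Union>V \<in> vertex_orbit \<pi> H Y ` Y. orbit H ` V)"
  proof
    show "orbit H ` Y \<subseteq> (\<Union>V \<in> vertex_orbit \<pi> H Y ` Y. orbit H ` V)"
      using mem_vertex_orbit[OF Y] by blast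
  qed (auto simp: vertex_orbit_def)
  show ?thesis
    unfolding eq
  proof (rule card_UN_disjoint[symmetric])
    show "finite (vertex_orbit \<pi> H Y ` Y)" using finite_vertex_orbits[OF assms] .
    show "\<forall>V \<in> vertex_orbit \<pi> H Y ` Y. finite (orbit H ` V)"
      using D(3) by (auto intro: finite_subset[of _ "orbit H ` Y"] simp: vertex_orbit_def)
    show "\<forall>V \<in> vertex_orbit \<pi> H Y ` Y. \<forall>W \<in> vertex_orbit \<pi> H Y ` Y. V \<noteq> W \<longrightarrow> orbit H ` V \<inter> orbit H ` W = {}"
    proof (intro ballI impI)
      fix V W assume VW: "V \<in> vertex_orbit \<pi> H Y ` Y" "W \<in> vertex_orbit \<pi> H Y ` Y" "V \<noteq> W"
      show "orbit H ` V \<inter> orbit H ` W = {}"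
      proof (rule ccontr)
        assume "orbit H ` V \<inter> orbit H ` W \<noteq> {}"
        then obtain x y where xy: "x \<in> V" "y \<in> W" "orbit H x = orbit H y" by blast
        obtain e e' where e: "e \<in> Y" "e' \<in> Y" "V = vertex_orbit \<pi> H Y e" "W = vertex_orbit \<pi> H Y e'"
          using VW by blast
        have xyY: "x \<in> Y" "y \<in> Y" using xy e by (auto simp: vertex_orbit_def)
        obtain h where "h \<in> H" "y = x \<cdot> h"
          using xy(3) orbit_eq_iff D xyY by blast
        then have "vertex_orbit \<pi> H Y x = vertex_orbit \<pi> H Y y"
          using vertex_orbit_eq_iff[OF assms xyY] by auto
        moreover have "vertex_orbit \<pi> H Y e = vertex_orbit \<pi> H Y x" "vertex_orbit \<pi> H Y e' = vertex_orbit \<pi> H Y y"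
          using vertex_orbit_disjoint[OF assms] mem_vertex_orbit[OF Y] xy e xyY by blast+
        ultimately show False using VW e by simp
      qed
    qed
  qed
qed

text \<open>
  Since \<open>H\<close> acts freely on the vertices, the star of a vertex maps bijectively to the star of its image
  in the quotient graph.
\<close>

lemma star_orbits:
  assumes Y: "cofinite_subgraph H Y" and \<pi>: "equivariant \<pi>" and free: "free_at \<pi> H" and "e \<in> Y"
  shows "card (orbit H ` vertex_orbit \<pi> H Y e) = card (star \<pi> Y e)" "finite (star \<pi> Y e)"
proof -
  note D = cofinite_subgraphD[OF Y]
  have inj: "inj_on (orbit H) (star \<pi> Y e)"
  proof (rule inj_onI)
    fix x y assume xy: "x \<in> star \<pi> Y e" "y \<in> star \<pi> Y e" "orbit H x = orbit H y"
    then have xyY: "x \<in> Y" "y \<in> Y" by (auto simp: star_def)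
    obtain h where h: "h \<in> H" "y = x \<cdot> h"
      using xy(3) orbit_eq_iff D xyY by blast
    then have "h = \<one>"
      using free_atD[OF free, of x h] xy xyY D by (auto simp: star_def)
    then show "x = y" using h xyY D by simp
  qed
  have img: "orbit H ` star \<pi> Y e = orbit H ` vertex_orbit \<pi> H Y e"
  proof (intro equalityI subsetI)
    fix V assume "V \<in> orbit H ` star \<pi> Y e"
    moreover have "star \<pi> Y e \<subseteq> vertex_orbit \<pi> H Y e"
      using D(6)[OF \<open>e \<in> Y\<close>] D(7) by (force simp: star_def vertex_orbit_def)
    ultimately show "V \<in> orbit H ` vertex_orbit \<pi> H Y e" by blast
  next
    fix V assume "V \<in> orbit H ` vertex_orbit \<pi> H Y e"
    then obtain x h where x: "V = orbit H x" "x \<in> Y" "h \<in> H" "\<pi> x = \<pi> (e \<cdot> h)"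
      by (auto simp: vertex_orbit_def)
    have "\<pi> e = \<pi> (x \<cdot> inv h)"
      by (rule equivariant_move[OF \<pi>]) (use x D(5,6) \<open>e \<in> Y\<close> in auto)
    then have "x \<cdot> inv h \<in> star \<pi> Y e"
      using D(4)[OF x(2) D(8)[OF x(3)]] by (simp add: star_def)
    moreover have "orbit H x = orbit H (x \<cdot> inv h)"
      using orbit_eq_iff[OF D(1)] x(2) D(4)[OF x(2) D(8)[OF x(3)]] D(6) D(8)[OF x(3)] by blast
    ultimately show "V \<in> orbit H ` star \<pi> Y e" using x by blast
  qed
  show "card (orbit H ` vertex_orbit \<pi> H Y e) = card (star \<pi> Y e)"
    using card_image[OF inj] img by simp
  have "finite (orbit H ` star \<pi> Y e)"
    by (rule finite_subset[OF _ D(3)]) (auto simp: star_def)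
  then show "finite (star \<pi> Y e)" using inj finite_imageD by blast
qed

text \<open>
  In a finite graph with all degrees at least two, the sum of \<open>deg v - 2\<close> over all vertices is twice the
  difference of the numbers of edges and vertices, so it measures the rank. The weight is the share of
  the vertices in one class of the bipartition of the quotient graph.
\<close>

definition weight :: "('e \<Rightarrow> 'v) \<Rightarrow> 'a set \<Rightarrow> 'e set \<Rightarrow> nat" where
  "weight \<pi> H Y = (\<Sum>V \<in> vertex_orbit \<pi> H Y ` Y. card (orbit H ` V) - 2)"

lemma weight_eq:
  assumes "cofinite_subgraph H Y" "equivariant \<pi>" "free_at \<pi> H"
    and deg: "\<And>e. e \<in> Y \<Longrightarrow> card (star \<pi> Y e) \<ge> 2"
  shows "weight \<pi> H Y + 2 * card (vertex_orbit \<pi> H Y ` Y) = card (orbit H ` Y)"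
proof -
  have "weight \<pi> H Y + 2 * card (vertex_orbit \<pi> H Y ` Y) = (\<Sum>V \<in> vertex_orbit \<pi> H Y ` Y. card (orbit H ` V) - 2 + 2)"
    by (simp only: weight_def sum.distrib) simp
  also have "\<dots> = (\<Sum>V \<in> vertex_orbit \<pi> H Y ` Y. card (orbit H ` V))"
  proof (rule sum.cong)
    fix V assume "V \<in> vertex_orbit \<pi> H Y ` Y"
    then obtain e where "e \<in> Y" "V = vertex_orbit \<pi> H Y e" by blast
    then have "2 \<le> card (orbit H ` V)" using star_orbits[OF assms(1-3)] deg by simp
    then show "card (orbit H ` V) - 2 + 2 = card (orbit H ` V)" by simp
  qed simp
  finally show ?thesis
    using degree_sum[OF assms(1,2)] by simp
qed

lemma weight_mono:
  assumes Y: "cofinite_subgraph H Y" "cofinite_subgraph H Y'" and "Y' \<subseteq> Y" and \<pi>: "equivariant \<pi>"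
  shows "weight \<pi> H Y' \<le> weight \<pi> H Y"
proof -
  have sub: "vertex_orbit \<pi> H Y' ` Y' \<subseteq> (\<lambda>V. V \<inter> Y') ` vertex_orbit \<pi> H Y ` Y"
  proof
    fix V assume "V \<in> vertex_orbit \<pi> H Y' ` Y'"
    then obtain e where e: "e \<in> Y'" "V = vertex_orbit \<pi> H Y' e" by blast
    then have "V = vertex_orbit \<pi> H Y e \<inter> Y'" using \<open>Y' \<subseteq> Y\<close> by (auto simp: vertex_orbit_def)
    then show "V \<in> (\<lambda>V. V \<inter> Y') ` vertex_orbit \<pi> H Y ` Y" using e \<open>Y' \<subseteq> Y\<close> by blast
  qed
  have fin: "finite (vertex_orbit \<pi> H Y ` Y)" using finite_vertex_orbits Y \<pi> by blast
  have "weight \<pi> H Y' \<le> (\<Sum>V \<in> (\<lambda>V. V \<inter> Y') ` vertex_orbit \<pi> H Y ` Y. card (orbit H ` V) - 2)"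
    unfolding weight_def using fin sub by (intro sum_mono2) auto
  also have "\<dots> \<le> (\<Sum>V \<in> vertex_orbit \<pi> H Y ` Y. card (orbit H ` (V \<inter> Y')) - 2)"
    using sum_image_le[OF fin, of "\<lambda>V. card (orbit H ` V) - 2" "\<lambda>V. V \<inter> Y'"] by (simp add: comp_def)
  also have "\<dots> \<le> weight \<pi> H Y"
    unfolding weight_def
  proof (intro sum_mono diff_le_mono card_mono)
    fix V assume "V \<in> vertex_orbit \<pi> H Y ` Y"
    then show "finite (orbit H ` V)"
      using cofinite_subgraphD(3)[OF Y(1)] by (auto intro: finite_subset[of _ "orbit H ` Y"] simp: vertex_orbit_def)
  qed auto
  finally show ?thesis .
qed

section \<open>Generators from a connected quotient graph\<close>

text \<open>
  \<open>X\<close> is a set of edges from different orbits, a growing piece of a fundamental domain, and \<open>S\<close> generates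
  all elements of \<open>L\<close> by which the orbit of \<open>X\<close> is glued to itself at vertices. The last clause says
  that \<open>S\<close> is no larger than the rank of the quotient graph of the orbit of \<open>X\<close>.
\<close>

definition transversal :: "('e \<Rightarrow> 'v) \<Rightarrow> ('e \<Rightarrow> 'w) \<Rightarrow> 'a set \<Rightarrow> 'e set \<Rightarrow> 'e set \<Rightarrow> 'a set \<Rightarrow> bool" where
  "transversal p q L Y X S \<longleftrightarrow> X \<subseteq> Y \<and> finite X \<and> finite S \<and> S \<subseteq> L \<and> inj_on (orbit L) X \<and>
    (\<forall>x \<in> X. \<forall>y \<in> X. \<forall>l \<in> L. p x = p (y \<cdot> l) \<or> q x = q (y \<cdot> l) \<longrightarrow> l \<in> generate G S) \<and>
    card S + card (vertex_orbit p L Y ` X) + card (vertex_orbit q L Y ` X) \<le> card X + 1"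

lemma transversal_swap: "transversal p q L Y X S \<Longrightarrow> transversal q p L Y X S"
  unfolding transversal_def by (elim conjE, intro conjI) (assumption | blast | simp)+

lemma transversalD:
  assumes "transversal p q L Y X S"
  shows "X \<subseteq> Y" "finite X" "finite S" "S \<subseteq> L" "inj_on (orbit L) X"
    and "\<And>x y l. \<lbrakk>x \<in> X; y \<in> X; l \<in> L; p x = p (y \<cdot> l)\<rbrakk> \<Longrightarrow> l \<in> generate G S"
    and "\<And>x y l. \<lbrakk>x \<in> X; y \<in> X; l \<in> L; q x = q (y \<cdot> l)\<rbrakk> \<Longrightarrow> l \<in> generate G S"
    and "card S + card (vertex_orbit p L Y ` X) + card (vertex_orbit q L Y ` X) \<le> card X + 1"
  using assms unfolding transversal_def by (elim conjE; blast)+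

text \<open>
  An edge attached to the transversal at one end either has a new vertex orbit at the other end, and
  then no generator is needed, or it closes a loop in the quotient graph, and then one generator
  accounts for all new coincidences.
\<close>

lemma transversal_extend:
  assumes Y: "cofinite_subgraph L Y" and p: "equivariant p" and q: "equivariant q"
    and fp: "free_at p L" and fq: "free_at q L"
    and T: "transversal p q L Y X S" and "x \<in> X" "e \<in> Y" "p e = p x" and new: "orbit L e \<notin> orbit L ` X"
  shows "\<exists>S'. transversal p q L Y (insert e X) S'"
proof -
  note D = cofinite_subgraphD[OF Y] and TD = transversalD[OF T]
  have E: "\<And>y. y \<in> X \<Longrightarrow> y \<in> E" "e \<in> E" using TD(1) D(2) \<open>e \<in> Y\<close> by auto
  have xY: "x \<in> Y" using TD(1) \<open>x \<in> X\<close> by blast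
  have "e \<notin> X" using new by blast
  have SG: "S \<subseteq> carrier G" using TD(4) D(5) by blast
  have inj: "inj_on (orbit L) (insert e X)"
    using TD(5) new by (auto simp: inj_on_def)
  have vp: "vertex_orbit p L Y ` insert e X = vertex_orbit p L Y ` X"
    using vertex_orbit_eqI[OF Y p \<open>e \<in> Y\<close> xY \<open>p e = p x\<close>] \<open>x \<in> X\<close> by auto
  have pe: "p (e \<cdot> k) = p (x \<cdot> k)" if "k \<in> L" for k
    using equivariantD[OF p E(2) E(1)[OF \<open>x \<in> X\<close>] D(5)[OF that] \<open>p e = p x\<close>] .
  \<comment> \<open>At \<open>p\<close> the new edge has the same end as \<open>x\<close>, whose coincidences are already accounted for.\<close>
  have p_new: "k \<in> generate G S"
    if "y \<in> insert e X" "z \<in> insert e X" "k \<in> L" "p y = p (z \<cdot> k)" for y z k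
  proof -
    define r where "r = (\<lambda>y. if y = e then x else y)"
    have "p (r y) = p y" for y using \<open>p e = p x\<close> by (simp add: r_def)
    moreover have "p (r z \<cdot> k) = p (z \<cdot> k)" using pe \<open>k \<in> L\<close> by (simp add: r_def)
    moreover have "r y \<in> X" "r z \<in> X" using that \<open>x \<in> X\<close> by (auto simp: r_def)
    ultimately show ?thesis
      using TD(6)[of "r y" "r z" k] that(3,4) by simp
  qed
  show ?thesis
  proof (cases "\<exists>x' \<in> X. \<exists>l \<in> L. q e = q (x' \<cdot> l)")
    case True
    then obtain x' l where x': "x' \<in> X" "l \<in> L" "q e = q (x' \<cdot> l)" by blast
    let ?M = "generate G (insert l S)"
    have lc: "l \<in> carrier G" using D(5) x' by blast
    have SG': "insert l S \<subseteq> carrier G" using SG lc by blast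
    have M: "subgroup ?M G" using generate_is_subgroup[OF SG'] .
    have SM: "generate G S \<subseteq> ?M" by (rule mono_generate) blast
    have lM: "l \<in> ?M" by (rule generate.incl) simp
    have q_old: "k \<in> ?M" if "y \<in> X" "z \<in> X" "k \<in> L" "q y = q (z \<cdot> k)" for y z k
      using TD(7)[OF that] SM by blast
    have q1: "k \<in> ?M" if "z \<in> X" "k \<in> L" "q e = q (z \<cdot> k)" for z k
    proof -
      have kc: "k \<in> carrier G" using D(5) that by blast
      have "q (x' \<cdot> l) = q (z \<cdot> k)" using x' that by simp
      then have "q x' = q (z \<cdot> k \<cdot> inv l)"
        by (intro equivariant_move[OF q, where g = l]) (use E that x' lc kc in auto)
      then have "q x' = q (z \<cdot> (k \<otimes> inv l))" using E that x' lc kc by (simp add: act_mult)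
      then have "k \<otimes> inv l \<in> ?M" using q_old x' that D(8,9) by blast
      then have "k \<otimes> inv l \<otimes> l \<in> ?M" using lM M by (meson subgroup.m_closed)
      then show ?thesis using kc lc by (simp add: m_assoc)
    qed
    have q2: "k \<in> ?M" if "y \<in> X" "k \<in> L" "q y = q (e \<cdot> k)" for y k
    proof -
      have kc: "k \<in> carrier G" using D(5) that by blast
      have "q e = q (y \<cdot> inv k)"
        by (rule equivariant_move[OF q]) (use E that kc in auto)
      then have "inv k \<in> ?M" using q1 that D(8) by blast
      then have "inv (inv k) \<in> ?M" using M by (meson subgroup.m_inv_closed)
      then show ?thesis using kc by simp
    qed
    have q3: "k \<in> ?M" if "k \<in> L" "q e = q (e \<cdot> k)" for k
      using free_atD[OF fq E(2) that(1)] that(2) generate.one by auto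
    have q_new: "k \<in> ?M" if "y \<in> insert e X" "z \<in> insert e X" "k \<in> L" "q y = q (z \<cdot> k)" for y z k
      using that q_old q1 q2 q3 by blast
    have vq: "vertex_orbit q L Y ` insert e X = vertex_orbit q L Y ` X"
    proof -
      have "q x' = q (e \<cdot> inv l)"
        by (rule equivariant_move[OF q]) (use E x' lc in auto)
      then have "vertex_orbit q L Y e = vertex_orbit q L Y x'"
        using vertex_orbit_eq_iff[OF Y q \<open>e \<in> Y\<close>] x' TD(1) D(8) by blast
      then show ?thesis using x' by auto
    qed
    have "transversal p q L Y (insert e X) (insert l S)"
      unfolding transversal_def
    proof (intro conjI ballI impI)
      fix y z k assume yzk: "y \<in> insert e X" "z \<in> insert e X" "k \<in> L" "p y = p (z \<cdot> k) \<or> q y = q (z \<cdot> k)"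
      from this(4) show "k \<in> ?M"
        using p_new[OF yzk(1-3)] q_new[OF yzk(1-3)] SM by blast
    next
      show "card (insert l S) + card (vertex_orbit p L Y ` insert e X) + card (vertex_orbit q L Y ` insert e X) \<le> card (insert e X) + 1"
        using TD(2,3,8) \<open>e \<notin> X\<close> unfolding vp vq by (simp add: card_insert_if)
    qed (use TD \<open>e \<in> Y\<close> x' inj in auto)
    then show ?thesis by blast
  next
    case False
    have q_new: "k \<in> generate G S" if hyp: "y \<in> insert e X" "z \<in> insert e X" "k \<in> L" "q y = q (z \<cdot> k)" for y z k
    proof -
      have kc: "k \<in> carrier G" using D(5) hyp by blast
      have "\<not> (y \<in> X \<and> z = e)"
      proof
        assume "y \<in> X \<and> z = e"
        then have "q e = q (y \<cdot> inv k)"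
          by (intro equivariant_move[OF q]) (use E hyp kc in auto)
        then show False using False \<open>y \<in> X \<and> z = e\<close> D(8) hyp by blast
      qed
      then consider "y \<in> X" "z \<in> X" | "y = e" "z \<in> X" | "y = e" "z = e"
        using hyp by blast
      then show ?thesis
      proof cases
        case 1
        then show ?thesis using TD(7) hyp by blast
      next
        case 2
        then show ?thesis using False hyp by blast
      next
        case 3
        then show ?thesis
          using free_atD[OF fq E(2) hyp(3)] hyp(4) generate.one by auto
      qed
    qed
    have "transversal p q L Y (insert e X) S"
      unfolding transversal_def
    proof (intro conjI ballI impI)
      fix y z k assume yzk: "y \<in> insert e X" "z \<in> insert e X" "k \<in> L" "p y = p (z \<cdot> k) \<or> q y = q (z \<cdot> k)"
      from this(4) show "k \<in> generate G S"
        using p_new[OF yzk(1-3)] q_new[OF yzk(1-3)] by blast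
    next
      show "card S + card (vertex_orbit p L Y ` insert e X) + card (vertex_orbit q L Y ` insert e X) \<le> card (insert e X) + 1"
        using TD(2,3,8) \<open>e \<notin> X\<close> unfolding vp by (simp add: card_insert_if)
    qed (use TD \<open>e \<in> Y\<close> inj in auto)
    then show ?thesis by blast
  qed
qed

text \<open>
  A maximal transversal meets all edge orbits, for otherwise connectedness yields an edge that extends it.
  For the group \<open>M\<close> generated by the associated \<open>S\<close>, edges sharing a vertex lie together in or
  outside the translates of the transversal by \<open>M\<close>; by connectedness these translates fill \<open>Y\<close>, so \<open>M\<close>
  is all of \<open>L\<close>.
\<close>

theorem generating_set_of_connected_quotient:
  assumes Y: "cofinite_subgraph L Y" and conn: "edge_connected p q Y" and "Y \<noteq> {}"
    and p: "equivariant p" and q: "equivariant q" and fp: "free_at p L" and fq: "free_at q L"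
  shows "\<exists>S \<subseteq> L. finite S \<and> generate G S = L \<and>
    card S + card (vertex_orbit p L Y ` Y) + card (vertex_orbit q L Y ` Y) \<le> card (orbit L ` Y) + 1"
proof -
  note D = cofinite_subgraphD[OF Y]
  obtain e0 where e0: "e0 \<in> Y" using \<open>Y \<noteq> {}\<close> by blast
  have start: "transversal p q L Y {e0} {}"
    unfolding transversal_def
  proof (intro conjI ballI impI)
    fix y z k assume yz: "y \<in> {e0}" "z \<in> {e0}" and k: "k \<in> L" and "p y = p (z \<cdot> k) \<or> q y = q (z \<cdot> k)"
    from this(4) have "p (e0 \<cdot> k) = p e0 \<or> q (e0 \<cdot> k) = q e0" using yz by auto
    then have "k = \<one>"
      using free_atD[OF fp D(6)[OF e0] k] free_atD[OF fq D(6)[OF e0] k] by blast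
    then show "k \<in> generate G {}" using generate.one by blast
  qed (use e0 in auto)
  have bound: "card X \<le> card (orbit L ` Y)" if "transversal p q L Y X S" for X S
    using card_inj_on_le[OF transversalD(5)[OF that] _ D(3)] transversalD(1)[OF that] by blast
  obtain X where X: "\<exists>S. transversal p q L Y X S" "X \<noteq> {}"
    and max: "\<And>X'. \<lbrakk>\<exists>S. transversal p q L Y X' S; X' \<noteq> {}\<rbrakk> \<Longrightarrow> card X' \<le> card X"
  proof -
    have "\<exists>X. ((\<exists>S. transversal p q L Y X S) \<and> X \<noteq> {}) \<and>
        (\<forall>X'. (\<exists>S. transversal p q L Y X' S) \<and> X' \<noteq> {} \<longrightarrow> card X' \<le> card X)"
      by (rule ex_has_greatest_nat[of _ "{e0}" _ "card (orbit L ` Y) + 1"])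
        (use start bound less_Suc_eq_le in auto)
    then show thesis using that by blast
  qed
  then obtain S where T: "transversal p q L Y X S" by blast
  note TD = transversalD[OF T]
  have maximal: "orbit L e \<in> orbit L ` X"
    if hyp: "e \<in> Y" "e' \<in> Y" "orbit L e' \<in> orbit L ` X" "p e = p e' \<or> q e = q e'" for e e'
  proof (rule ccontr)
    assume "orbit L e \<notin> orbit L ` X"
    obtain x where x: "x \<in> X" "orbit L e' = orbit L x" using hyp by blast
    then have xY: "x \<in> Y" using TD by blast
    obtain l where l: "l \<in> L" "x = e' \<cdot> l"
      using x(2) orbit_eq_iff[OF D(1)] D(6) hyp(2) xY by blast
    have lc: "l \<in> carrier G" using D(5) l by blast
    have el: "e \<cdot> l \<in> Y" using D(4) hyp l by blast
    have "orbit L (e \<cdot> l) = orbit L e"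
      using orbit_eq_iff[OF D(1) D(6)[OF hyp(1)] D(6)[OF el]] l by blast
    then have new: "orbit L (e \<cdot> l) \<notin> orbit L ` X" using \<open>orbit L e \<notin> orbit L ` X\<close> by simp
    have "\<exists>S'. transversal p q L Y (insert (e \<cdot> l) X) S'"
    proof (cases "p e = p e'")
      case True
      then have "p (e \<cdot> l) = p x"
        unfolding l(2) using equivariantD[OF p] D(6) hyp lc by blast
      then show ?thesis
        using transversal_extend[OF Y p q fp fq T x(1) el _ new] by blast
    next
      case False
      then have "q e = q e'" using hyp by blast
      then have "q (e \<cdot> l) = q x"
        unfolding l(2) using equivariantD[OF q] D(6) hyp lc by blast
      then show ?thesis
        using transversal_extend[OF Y q p fq fp transversal_swap[OF T] x(1) el _ new] transversal_swap by blast
    qed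
    then have "card (insert (e \<cdot> l) X) \<le> card X" using max by blast
    moreover have "e \<cdot> l \<notin> X" using new by blast
    ultimately show False using TD(2) by simp
  qed
  obtain x0 where x0: "x0 \<in> X" using X(2) by blast
  then have x0Y: "x0 \<in> Y" using TD by blast
  have cover: "orbit L e \<in> orbit L ` X" if "e \<in> Y" for e
  proof -
    have "(orbit L e \<in> orbit L ` X) = (orbit L x0 \<in> orbit L ` X)"
      by (rule edge_connectedD[OF conn, where P = "\<lambda>e. orbit L e \<in> orbit L ` X"])
        (use maximal that x0Y in metis)+
    then show ?thesis using x0 by blast
  qed
  let ?M = "generate G S"
  have SG: "S \<subseteq> carrier G" using TD(4) D(5) by blast
  have M: "subgroup ?M G" using generate_is_subgroup[OF SG] .
  have M_le: "?M \<subseteq> L" using generate_subgroup_incl[OF TD(4) D(1)] .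
  define P where "P = (\<lambda>e. \<exists>x \<in> X. \<exists>m \<in> ?M. e = x \<cdot> m)"
  have P_step: "P e'" if hyp: "e \<in> Y" "e' \<in> Y" "P e" "p e = p e' \<or> q e = q e'" for e e'
  proof -
    obtain x m where x: "x \<in> X" "m \<in> ?M" "e = x \<cdot> m" using hyp by (auto simp: P_def)
    obtain y where y: "y \<in> X" "orbit L y = orbit L e'" using cover[OF hyp(2)] by blast
    then obtain l where l: "l \<in> L" "e' = y \<cdot> l"
      using orbit_eq_iff[OF D(1)] D(6) hyp(2) TD(1) by blast
    have c: "m \<in> carrier G" "l \<in> carrier G" "x \<in> E" "y \<in> E"
      using x y l D(2,5) M_le TD(1) by blast+
    have "p x = p (y \<cdot> (l \<otimes> inv m)) \<or> q x = q (y \<cdot> (l \<otimes> inv m))"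
    proof (cases "p e = p e'")
      case True
      then have "p (y \<cdot> l) = p (x \<cdot> m)" using x l by simp
      then have "p x = p (y \<cdot> l \<cdot> inv m)"
        by (intro equivariant_move[OF p]) (use c in auto)
      then show ?thesis using c by (simp add: act_mult)
    next
      case False
      then have "q (y \<cdot> l) = q (x \<cdot> m)" using x l hyp(4) by simp
      then have "q x = q (y \<cdot> l \<cdot> inv m)"
        by (intro equivariant_move[OF q]) (use c in auto)
      then show ?thesis using c by (simp add: act_mult)
    qed
    moreover have "l \<otimes> inv m \<in> L" using l x M_le D(8,9) by blast
    ultimately have "l \<otimes> inv m \<in> ?M" using TD(6,7) x y by blast
    then have "l \<otimes> inv m \<otimes> m \<in> ?M" using x M by (meson subgroup.m_closed)
    then have "l \<in> ?M" using c by (simp add: m_assoc)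
    then show ?thesis using y l by (auto simp: P_def)
  qed
  have "P x0"
    using x0 D(6)[OF x0Y] generate.one[of G S] by (auto simp: P_def intro!: bexI[of _ x0] bexI[of _ \<one>])
  have all: "P e" if "e \<in> Y" for e
  proof -
    have "P e = P x0"
      by (rule edge_connectedD[OF conn, where P = P]) (use P_step that x0Y in metis)+
    then show ?thesis using \<open>P x0\<close> by blast
  qed
  have "L \<subseteq> ?M"
  proof
    fix l assume l: "l \<in> L"
    then have x0l: "x0 \<cdot> l \<in> Y" using D(4) x0Y by blast
    then obtain x m where x: "x \<in> X" "m \<in> ?M" "x0 \<cdot> l = x \<cdot> m" using all P_def by blast
    have c: "m \<in> carrier G" "l \<in> carrier G" "x \<in> E" "x0 \<in> E" "x \<in> Y"
      using x l D(2,5) M_le TD(1) x0Y by blast+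
    have "orbit L x0 = orbit L (x0 \<cdot> l)"
      using orbit_eq_iff[OF D(1) c(4) D(6)[OF x0l]] l by blast
    moreover have "orbit L x = orbit L (x0 \<cdot> l)"
      using orbit_eq_iff[OF D(1) c(3) D(6)[OF x0l]] x M_le by blast
    ultimately have "x0 = x" using TD(5) x x0 by (auto simp: inj_on_def)
    then have "l = m" using act_inj c x by blast
    then show "l \<in> ?M" using x by simp
  qed
  then have gen: "generate G S = L" using M_le by blast
  have vs: "vertex_orbit \<pi> L Y ` X = vertex_orbit \<pi> L Y ` Y" if "equivariant \<pi>" for \<pi> :: "'e \<Rightarrow> 'z"
  proof
    show "vertex_orbit \<pi> L Y ` Y \<subseteq> vertex_orbit \<pi> L Y ` X"
    proof
      fix V assume "V \<in> vertex_orbit \<pi> L Y ` Y"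
      then obtain e where e: "e \<in> Y" "V = vertex_orbit \<pi> L Y e" by blast
      then obtain x where x: "x \<in> X" "orbit L x = orbit L e" using cover by blast
      then have "\<exists>l \<in> L. e = x \<cdot> l"
        using orbit_eq_iff[OF D(1)] D(6) e TD(1) by blast
      then have "vertex_orbit \<pi> L Y x = vertex_orbit \<pi> L Y e"
        using vertex_orbit_eq_iff[OF Y that] e x TD(1) by blast
      then show "V \<in> vertex_orbit \<pi> L Y ` X" using x e by blast
    qed
  qed (use TD(1) in blast)
  have "card X \<le> card (orbit L ` Y)" using bound T by blast
  then have "card S + card (vertex_orbit p L Y ` Y) + card (vertex_orbit q L Y ` Y) \<le> card (orbit L ` Y) + 1"
    using TD(8) vs[OF p] vs[OF q] by simp
  then show ?thesis using TD(3,4) gen by blast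
qed

section \<open>Removing leaves\<close>

text \<open>
  If \<open>e\<close> is the only edge at its \<open>p\<close>-end, the whole orbit of \<open>e\<close> can be removed. Another edge \<open>e'\<close> at the
  \<open>q\<close>-end of \<open>e\<close> exists because \<open>L\<close> is nontrivial, and sending \<open>e\<close> to \<open>e'\<close> equivariantly gives a
  retraction onto the smaller graph that preserves adjacency; so connectedness is inherited.
\<close>

lemma remove_leaf:
  assumes Y: "cofinite_subgraph L Y" and conn: "edge_connected p q Y"
    and p: "equivariant p" and q: "equivariant q" and fp: "free_at p L" and fq: "free_at q L"
    and nontriv: "L \<noteq> {\<one>}" and "e \<in> Y" and leaf: "card (star p Y e) < 2"
  shows "\<exists>Y' \<subseteq> Y. cofinite_subgraph L Y' \<and> edge_connected p q Y' \<and> Y' \<noteq> {} \<and>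
    card (orbit L ` Y') < card (orbit L ` Y)"
proof -
  note D = cofinite_subgraphD[OF Y]
  have eE: "e \<in> E" using D(6) \<open>e \<in> Y\<close> .
  have "finite (star p Y e)" using star_orbits(2)[OF Y p fp \<open>e \<in> Y\<close>] .
  moreover have "{e} \<subseteq> star p Y e" using \<open>e \<in> Y\<close> by (simp add: star_def)
  moreover have "card (star p Y e) \<le> card {e}" using leaf by simp
  ultimately have "{e} = star p Y e" by (rule card_seteq)
  then have leafD: "x = e" if "x \<in> Y" "p x = p e" for x
    using that by (auto simp: star_def)
  obtain l where l: "l \<in> L" "l \<noteq> \<one>" using nontriv D(7) by blast
  have "\<exists>e' \<in> Y. e' \<noteq> e \<and> q e' = q e"
  proof (rule ccontr)
    assume no: "\<not> ?thesis"
    have "(e \<cdot> l = e) = (e = e)"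
      by (rule edge_connectedD[OF conn, where P = "\<lambda>x. x = e"])
        (use leafD no D(4) l \<open>e \<in> Y\<close> in metis)+
    then show False using act_free[OF eE D(5)[OF l(1)]] l by blast
  qed
  then obtain e' where e': "e' \<in> Y" "e' \<noteq> e" "q e' = q e" by blast
  have e'E: "e' \<in> E" using D(6) e' by blast
  define Y' where "Y' = Y - orbit L e"
  have "e' \<notin> orbit L e"
  proof
    assume "e' \<in> orbit L e"
    then obtain h where h: "h \<in> L" "e' = e \<cdot> h" by (auto simp: orbit_def)
    then have "h = \<one>" using free_atD[OF fq eE h(1)] e' by simp
    then show False using h e' eE by simp
  qed
  then have e'Y': "e' \<in> Y'" using e' by (simp add: Y'_def)
  have inv: "x \<cdot> h \<in> Y'" if "x \<in> Y'" "h \<in> L" for x h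
  proof -
    have "x \<in> Y" using that by (simp add: Y'_def)
    have "x \<cdot> h \<notin> orbit L e"
    proof
      assume "x \<cdot> h \<in> orbit L e"
      then obtain k where k: "k \<in> L" "x \<cdot> h = e \<cdot> k" by (auto simp: orbit_def)
      then have "x = e \<cdot> (k \<otimes> inv h)"
        using act_inv(1)[of x h] D(5)[OF that(2)] D(5)[OF k(1)] eE D(6)[OF \<open>x \<in> Y\<close>] by (simp add: act_mult)
      then have "x \<in> orbit L e" using D(8,9) k that by (auto simp: orbit_def)
      then show False using that by (simp add: Y'_def)
    qed
    then show ?thesis using D(4) \<open>x \<in> Y\<close> that by (simp add: Y'_def)
  qed
  \<comment> \<open>The retraction; the element \<open>h\<close> is unique because the action on edges is free.\<close>
  define r where "r = (\<lambda>x. if x \<in> Y' then x else e' \<cdot> (THE h. h \<in> L \<and> x = e \<cdot> h))"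
  have r_removed: "r (e \<cdot> h) = e' \<cdot> h" if "h \<in> L" for h
  proof -
    have "(THE k. k \<in> L \<and> e \<cdot> h = e \<cdot> k) = h"
    proof (rule the_equality)
      fix k assume "k \<in> L \<and> e \<cdot> h = e \<cdot> k"
      then show "k = h" using act_inj[OF eE D(5)[of k] D(5)[OF that]] by simp
    qed (use that in simp)
    then show ?thesis using that by (auto simp: r_def Y'_def orbit_def)
  qed
  have r_mem: "r x \<in> Y'" if xY: "x \<in> Y" for x
  proof (cases "x \<in> Y'")
    case False
    then obtain h where h: "h \<in> L" "x = e \<cdot> h" using xY by (auto simp: Y'_def orbit_def)
    then show ?thesis using r_removed inv e'Y' by simp
  qed (simp add: r_def)
  have cross_p: False if "x \<in> Y'" "h \<in> L" "p x = p (e \<cdot> h)" for x h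
  proof -
    have xY: "x \<in> Y" using that by (simp add: Y'_def)
    have "p e = p (x \<cdot> inv h)"
      by (rule equivariant_move[OF p]) (use that D(5) D(6) xY eE in auto)
    then have "x \<cdot> inv h = e" using leafD D(4) xY D(8) that by metis
    then have "x = e \<cdot> h" using act_inv(2)[OF D(6)[OF xY] D(5)[OF that(2)]] by simp
    then show False using that by (auto simp: Y'_def orbit_def)
  qed
  have r_q: "q (r (e \<cdot> h)) = q (e \<cdot> h)" if "h \<in> L" for h
    unfolding r_removed[OF that] by (rule equivariantD[OF q e'E eE D(5)[OF that] e'(3)])
  have conn': "edge_connected p q Y'"
  proof (rule edge_connectedI)
    fix P :: "'e \<Rightarrow> bool" and a b
    assume Pp: "\<And>x y. \<lbrakk>x \<in> Y'; y \<in> Y'; p x = p y\<rbrakk> \<Longrightarrow> P x = P y"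
      and Pq: "\<And>x y. \<lbrakk>x \<in> Y'; y \<in> Y'; q x = q y\<rbrakk> \<Longrightarrow> P x = P y" and ab: "a \<in> Y'" "b \<in> Y'"
    have rq: "q (r x) = q x" if xY: "x \<in> Y" for x
    proof (cases "x \<in> Y'")
      case False
      then obtain h where h: "h \<in> L" "x = e \<cdot> h" using xY by (auto simp: Y'_def orbit_def)
      then show ?thesis using r_q by simp
    qed (simp add: r_def)
    have "P (r a) = P (r b)"
    proof (rule edge_connectedD[OF conn, where P = "\<lambda>x. P (r x)"])
      fix x y assume xy: "x \<in> Y" "y \<in> Y" "q x = q y"
      have "q (r x) = q (r y)" unfolding rq[OF xy(1)] rq[OF xy(2)] using xy(3) .
      then show "P (r x) = P (r y)" by (rule Pq[OF r_mem[OF xy(1)] r_mem[OF xy(2)]])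
    next
      fix x y assume xy: "x \<in> Y" "y \<in> Y" "p x = p y"
      show "P (r x) = P (r y)"
      proof (cases "x \<in> Y'")
        case True
        have "y \<in> Y'"
        proof (rule ccontr)
          assume "y \<notin> Y'"
          then obtain h where "h \<in> L" "y = e \<cdot> h" using xy by (auto simp: Y'_def orbit_def)
          then show False using cross_p True xy by blast
        qed
        then have "r x = x" "r y = y" using True by (simp_all add: r_def)
        then show ?thesis using Pp[OF True \<open>y \<in> Y'\<close> xy(3)] by simp
      next
        case False
        then obtain h where h: "h \<in> L" "x = e \<cdot> h" using xy by (auto simp: Y'_def orbit_def)
        then have "y \<notin> Y'" using cross_p[of y h] xy by auto
        then obtain k where k: "k \<in> L" "y = e \<cdot> k" using xy by (auto simp: Y'_def orbit_def)
        have "h = k" using free_at_inj[OF fp p D(1) eE h(1) k(1)] xy h k by simp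
        then show ?thesis using h k by simp
      qed
    qed (use ab in \<open>auto simp: Y'_def\<close>)
    then show "P a = P b" using ab by (simp add: r_def)
  qed
  have "orbit L e \<notin> orbit L ` Y'"
  proof
    assume "orbit L e \<in> orbit L ` Y'"
    then obtain x where x: "x \<in> Y'" "orbit L e = orbit L x" by blast
    then have "\<exists>h \<in> L. x = e \<cdot> h"
      by (intro iffD1[OF orbit_eq_iff[OF D(1) eE D(6)]]) (auto simp: Y'_def)
    then have "x \<in> orbit L e" by (auto simp: orbit_def)
    then show False using x by (simp add: Y'_def)
  qed
  then have "orbit L ` Y' \<subset> orbit L ` Y" using \<open>e \<in> Y\<close> by (auto simp: Y'_def)
  then have "card (orbit L ` Y') < card (orbit L ` Y)" and fin: "finite (orbit L ` Y')"
    using D(3) by (auto intro: psubset_card_mono finite_subset)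
  moreover have "cofinite_subgraph L Y'"
    unfolding cofinite_subgraph_def using D(1,2) inv fin by (auto simp: Y'_def)
  ultimately show ?thesis
    using conn' e'Y' by (intro exI[of _ Y']) (auto simp: Y'_def)
qed

theorem exists_core:
  assumes Y: "cofinite_subgraph L Y" and conn: "edge_connected p q Y" and "Y \<noteq> {}"
    and p: "equivariant p" and q: "equivariant q" and fp: "free_at p L" and fq: "free_at q L"
    and nontriv: "L \<noteq> {\<one>}"
  obtains Y' where "Y' \<subseteq> Y" "cofinite_subgraph L Y'" "edge_connected p q Y'" "Y' \<noteq> {}"
    "\<And>e. e \<in> Y' \<Longrightarrow> card (star p Y' e) \<ge> 2" "\<And>e. e \<in> Y' \<Longrightarrow> card (star q Y' e) \<ge> 2"
proof -
  let ?Q = "\<lambda>Z. Z \<subseteq> Y \<and> cofinite_subgraph L Z \<and> edge_connected p q Z \<and> Z \<noteq> {}"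
  obtain Z where Z: "?Q Z" and min: "\<forall>Z'. ?Q Z' \<longrightarrow> card (orbit L ` Z) \<le> card (orbit L ` Z')"
    using ex_has_least_nat[of ?Q Y "\<lambda>Z. card (orbit L ` Z)"] assms(1-3) by blast
  have "card (star p Z e) \<ge> 2" if eZ: "e \<in> Z" for e
  proof (rule ccontr)
    assume "\<not> ?thesis"
    then obtain Z' where "Z' \<subseteq> Z" "cofinite_subgraph L Z'" "edge_connected p q Z'" "Z' \<noteq> {}"
      "card (orbit L ` Z') < card (orbit L ` Z)"
      using remove_leaf[OF _ _ p q fp fq nontriv eZ] Z by (meson not_le)
    then show False using min Z by (meson not_le order_trans)
  qed
  moreover have "card (star q Z e) \<ge> 2" if eZ: "e \<in> Z" for e
  proof (rule ccontr)
    assume "\<not> ?thesis"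
    then obtain Z' where "Z' \<subseteq> Z" "cofinite_subgraph L Z'" "edge_connected q p Z'" "Z' \<noteq> {}"
      "card (orbit L ` Z') < card (orbit L ` Z)"
      using remove_leaf[OF _ _ q p fq fp nontriv eZ] Z edge_connected_swap by (meson not_le)
    then show False using min Z edge_connected_swap by (meson not_le order_trans)
  qed
  ultimately show thesis using that Z by blast
qed

end

section \<open>Groups acting on trees\<close>

text \<open>
  Every labelling of the edges by truth values, read as an element of the field with two elements, is
  the coboundary of a labelling of the vertices. For a connected graph this says that there are no
  cycles.
\<close>

locale tree_action = free_action G E act
  for G (structure) and E :: "'e set" and act :: "'e \<Rightarrow> 'a \<Rightarrow> 'e" (infixl "\<cdot>" 75) +
  fixes p :: "'e \<Rightarrow> 'v" and q :: "'e \<Rightarrow> 'w"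
  assumes p_equiv: "equivariant p" and q_equiv: "equivariant q"
    and tree_connected: "edge_connected p q E"
    and coboundary: "\<And>f :: 'e \<Rightarrow> bool. \<exists>(c :: 'v \<Rightarrow> bool) (d :: 'w \<Rightarrow> bool). \<forall>e \<in> E. f e \<longleftrightarrow> c (p e) \<noteq> d (q e)"
begin

text \<open>
  If the coboundary of a vertex labelling is invariant under \<open>l\<close>, then the labelling and its translate by
  \<open>l\<close> have the same coboundary, so they differ by a constant: the value at \<open>l\<close> of the homomorphism
  that the labelling induces.
\<close>

lemma displacement_constant:
  fixes c :: "'v \<Rightarrow> bool" and d :: "'w \<Rightarrow> bool"
  assumes Y: "Y \<subseteq> E" and conn: "edge_connected p q Y" and l: "l \<in> carrier G"
    and inv: "\<And>e. e \<in> Y \<Longrightarrow> (c (p (e \<cdot> l)) \<noteq> d (q (e \<cdot> l))) = (c (p e) \<noteq> d (q e))"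
    and "e \<in> Y" "e' \<in> Y"
  shows "(c (p (e \<cdot> l)) \<noteq> c (p e)) = (c (p (e' \<cdot> l)) \<noteq> c (p e'))"
proof (rule edge_connectedD[OF conn, where P = "\<lambda>e. c (p (e \<cdot> l)) \<noteq> c (p e)"])
  fix x y assume xy: "x \<in> Y" "y \<in> Y"
  then have E: "x \<in> E" "y \<in> E" using Y by auto
  {
    assume "p x = p y"
    moreover have "p (x \<cdot> l) = p (y \<cdot> l)"
      by (rule equivariantD[OF p_equiv E l \<open>p x = p y\<close>])
    ultimately show "(c (p (x \<cdot> l)) \<noteq> c (p x)) = (c (p (y \<cdot> l)) \<noteq> c (p y))"
      by presburger
  next
    assume "q x = q y"
    moreover have "q (x \<cdot> l) = q (y \<cdot> l)"
      by (rule equivariantD[OF q_equiv E l \<open>q x = q y\<close>])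
    ultimately show "(c (p (x \<cdot> l)) \<noteq> c (p x)) = (c (p (y \<cdot> l)) \<noteq> c (p y))"
      using inv[OF xy(1)] inv[OF xy(2)] by auto
  }
qed (use assms in auto)

text \<open>
  A set of edge orbits is an invariant edge labelling. Lifted to the tree it has a potential, normalized at
  one vertex. The labelling can be recovered from the displacements of the potential under \<open>hs\<close> and
  its values at one representative of each vertex orbit: if two labellings agree in these data, then the
  difference of their potentials is invariant under \<open>L\<close> by the last hypothesis, and vanishes at all
  representatives. Comparing numbers of labellings gives the bound.
\<close>

lemma cochain_count:
  assumes Y: "cofinite_subgraph L Y" and conn: "edge_connected p q Y" and "Y \<noteq> {}"
    and hs: "finite hs" "hs \<subseteq> L"
    and determined: "\<And>(c :: 'v \<Rightarrow> bool) (d :: 'w \<Rightarrow> bool) l e. \<lbrakk>\<And>e l. \<lbrakk>e \<in> E; l \<in> L\<rbrakk> \<Longrightarrow> (c (p (e \<cdot> l)) \<noteq> d (q (e \<cdot> l))) = (c (p e) \<noteq> d (q e));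
        \<And>e. e \<in> E - Y \<Longrightarrow> c (p e) = d (q e);
        \<And>e l. \<lbrakk>e \<in> Y; l \<in> hs\<rbrakk> \<Longrightarrow> c (p (e \<cdot> l)) = c (p e); e \<in> Y; l \<in> L\<rbrakk>
      \<Longrightarrow> c (p (e \<cdot> l)) = c (p e)"
  shows "card (orbit L ` Y) + 1 \<le> card hs + card (vertex_orbit p L Y ` Y) + card (vertex_orbit q L Y ` Y)"
proof -
  note D = cofinite_subgraphD[OF Y]
  let ?VP = "vertex_orbit p L Y ` Y" and ?VQ = "vertex_orbit q L Y ` Y"
  have fin: "finite ?VP" "finite ?VQ"
    using finite_vertex_orbits[OF Y] p_equiv q_equiv by blast+
  define rep where "rep = (\<lambda>V :: 'e set. SOME e. e \<in> V)"
  have repP: "rep (vertex_orbit p L Y e) \<in> Y \<and> (\<exists>l \<in> L. p (rep (vertex_orbit p L Y e)) = p (e \<cdot> l))" if "e \<in> Y" for e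
  proof -
    have "rep (vertex_orbit p L Y e) \<in> vertex_orbit p L Y e"
      unfolding rep_def by (rule someI, rule mem_vertex_orbit[OF Y that])
    then show ?thesis by (simp add: vertex_orbit_def)
  qed
  have repQ: "rep (vertex_orbit q L Y e) \<in> Y \<and> (\<exists>l \<in> L. q (rep (vertex_orbit q L Y e)) = q (e \<cdot> l))" if "e \<in> Y" for e
  proof -
    have "rep (vertex_orbit q L Y e) \<in> vertex_orbit q L Y e"
      unfolding rep_def by (rule someI, rule mem_vertex_orbit[OF Y that])
    then show ?thesis by (simp add: vertex_orbit_def)
  qed
  obtain y0 where "y0 \<in> Y" using \<open>Y \<noteq> {}\<close> by blast
  \<comment> \<open>Potentials are normalized at the representative of \<open>V0\<close>, which saves one value and gives the \<open>1\<close> in the bound.\<close>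
  define V0 where "V0 = vertex_orbit p L Y y0"
  define e0 where "e0 = rep V0"
  have e0: "e0 \<in> Y" using repP[OF \<open>y0 \<in> Y\<close>] by (simp add: e0_def V0_def)
  have V0: "V0 \<in> ?VP" using \<open>y0 \<in> Y\<close> by (simp add: V0_def)
  have "\<exists>(c :: 'v \<Rightarrow> bool) (d :: 'w \<Rightarrow> bool). (\<forall>e \<in> E. orbit L e \<in> F \<longleftrightarrow> c (p e) \<noteq> d (q e)) \<and> \<not> c (p e0)" for F
  proof -
    obtain c :: "'v \<Rightarrow> bool" and d :: "'w \<Rightarrow> bool" where cd: "\<forall>e \<in> E. orbit L e \<in> F \<longleftrightarrow> c (p e) \<noteq> d (q e)"
      using coboundary[of "\<lambda>e. orbit L e \<in> F"] by blast
    show ?thesis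
    proof (cases "c (p e0)")
      case True
      then show ?thesis
        using cd by (intro exI[of _ "\<lambda>v. \<not> c v"] exI[of _ "\<lambda>v. \<not> d v"]) auto
    qed (use cd in blast)
  qed
  then obtain C D' where CD: "\<And>F e. e \<in> E \<Longrightarrow> orbit L e \<in> F \<longleftrightarrow> C F (p e) \<noteq> D' F (q e)"
    and C0: "\<And>F. \<not> C F (p e0)" by metis
  define \<Phi> where "\<Phi> = (\<lambda>F. ({l \<in> hs. C F (p (e0 \<cdot> l))},
    {V \<in> ?VP - {V0}. C F (p (rep V))}, {V \<in> ?VQ. D' F (q (rep V))}))"
  have inj: "inj_on \<Phi> (Pow (orbit L ` Y))"
  proof (rule inj_onI)
    fix F F' assume F: "F \<in> Pow (orbit L ` Y)" "F' \<in> Pow (orbit L ` Y)" and eq: "\<Phi> F = \<Phi> F'"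
    define c where "c = (\<lambda>v. C F v \<noteq> C F' v)"
    define d where "d = (\<lambda>v. D' F v \<noteq> D' F' v)"
    have cd: "(c (p e) \<noteq> d (q e)) = ((orbit L e \<in> F) \<noteq> (orbit L e \<in> F'))" if "e \<in> E" for e
      using CD[OF that, of F] CD[OF that, of F'] unfolding c_def d_def by argo
    have orbl: "orbit L (e \<cdot> l) = orbit L e" if "e \<in> E" "l \<in> L" for e l
      using orbit_eq_iff[OF D(1) that(1), of "e \<cdot> l"] D(5) that by auto
    have inv: "(c (p (e \<cdot> l)) \<noteq> d (q (e \<cdot> l))) = (c (p e) \<noteq> d (q e))" if "e \<in> E" "l \<in> L" for e l
      using cd[OF that(1)] cd[OF act_closed[OF that(1) D(5)[OF that(2)]]] orbl[OF that] by simp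
    have out: "c (p e) = d (q e)" if eEY: "e \<in> E - Y" for e
    proof -
      have "orbit L e \<notin> orbit L ` Y"
      proof
        assume "orbit L e \<in> orbit L ` Y"
        then obtain y where y: "y \<in> Y" "orbit L y = orbit L e" by auto
        have "\<exists>l \<in> L. e = y \<cdot> l"
          using eEY y(2) by (intro iffD1[OF orbit_eq_iff[OF D(1) D(6)[OF y(1)]]]) auto
        then show False using D(4) y that by blast
      qed
      then show ?thesis using cd F that by blast
    qed
    have on_hs: "c (p (e \<cdot> l)) = c (p e)" if "e \<in> Y" "l \<in> hs" for e l
    proof -
      have lL: "l \<in> L" using that hs by blast
      have "(c (p (e \<cdot> l)) \<noteq> c (p e)) = (c (p (e0 \<cdot> l)) \<noteq> c (p e0))"
        by (rule displacement_constant[OF D(2) conn D(5)[OF lL] inv that(1) e0]) (use D(6) lL in auto)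
      moreover have "l \<in> fst (\<Phi> F) \<longleftrightarrow> l \<in> fst (\<Phi> F')" using eq by simp
      then have "C F (p (e0 \<cdot> l)) = C F' (p (e0 \<cdot> l))" using that by (simp add: \<Phi>_def)
      ultimately show ?thesis using C0 by (simp add: c_def)
    qed
    have cL: "c (p (e \<cdot> l)) = c (p e)" if "e \<in> Y" "l \<in> L" for e l
      by (rule determined[of c d, OF inv out on_hs that])
    have dL: "d (q (e \<cdot> l)) = d (q e)" if "e \<in> Y" "l \<in> L" for e l
      using cL[OF that] inv[OF D(6)[OF that(1)] that(2)] by argo
    have c_rep: "\<not> c (p (rep V))" if "V \<in> ?VP" for V
    proof (cases "V = V0")
      case True
      then show ?thesis using C0 by (simp add: c_def e0_def)
    next
      case False
      have "V \<in> fst (snd (\<Phi> F)) \<longleftrightarrow> V \<in> fst (snd (\<Phi> F'))" using eq by simp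
      then show ?thesis using False that by (simp add: \<Phi>_def c_def)
    qed
    have d_rep: "\<not> d (q (rep V))" if "V \<in> ?VQ" for V
    proof -
      have "V \<in> snd (snd (\<Phi> F)) \<longleftrightarrow> V \<in> snd (snd (\<Phi> F'))" using eq by simp
      then show ?thesis using that by (simp add: \<Phi>_def d_def)
    qed
    have "(orbit L e \<in> F) = (orbit L e \<in> F')" if "e \<in> Y" for e
    proof -
      obtain l where l: "l \<in> L" "p (rep (vertex_orbit p L Y e)) = p (e \<cdot> l)" using repP[OF \<open>e \<in> Y\<close>] by blast
      then have "\<not> c (p e)" using c_rep[of "vertex_orbit p L Y e"] cL[OF that l(1)] that by simp
      moreover obtain k where k: "k \<in> L" "q (rep (vertex_orbit q L Y e)) = q (e \<cdot> k)" using repQ[OF \<open>e \<in> Y\<close>] by blast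
      then have "\<not> d (q e)" using d_rep[of "vertex_orbit q L Y e"] dL[OF that k(1)] that by simp
      ultimately show ?thesis using cd[OF D(6)[OF that]] by simp
    qed
    then show "F = F'" using F by blast
  qed
  have sub: "\<Phi> ` Pow (orbit L ` Y) \<subseteq> Pow hs \<times> Pow (?VP - {V0}) \<times> Pow ?VQ"
    by (auto simp: \<Phi>_def)
  have "card (Pow (orbit L ` Y)) \<le> card (Pow hs \<times> Pow (?VP - {V0}) \<times> Pow ?VQ)"
    by (rule card_inj_on_le[OF inj sub]) (use fin hs in simp)
  then have "(2::nat) ^ card (orbit L ` Y) \<le> 2 ^ (card hs + (card ?VP - 1 + card ?VQ))"
    using D(3) hs fin V0 by (simp add: card_Pow card_cartesian_product power_add)
  then have "card (orbit L ` Y) \<le> card hs + (card ?VP - 1 + card ?VQ)"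
    by (simp add: power_increasing_iff)
  moreover have "card ?VP \<ge> 1"
    using fin V0 by (metis One_nat_def Suc_leI card_gt_0_iff empty_iff)
  ultimately show ?thesis by simp
qed

text \<open>
  A potential that is invariant under generators is invariant under the group, so a generating set can serve
  as \<open>hs\<close> in \<open>cochain_count\<close>: the quotient graph has rank at most the number of generators.
\<close>

lemma rank_lower_bound:
  assumes Y: "cofinite_subgraph L Y" and conn: "edge_connected p q Y" and "Y \<noteq> {}"
    and hs: "finite hs" "hs \<subseteq> L" "generate G hs = L"
  shows "card (orbit L ` Y) + 1 \<le> card hs + card (vertex_orbit p L Y ` Y) + card (vertex_orbit q L Y ` Y)"
proof (rule cochain_count[OF Y conn \<open>Y \<noteq> {}\<close> hs(1,2)])
  note D = cofinite_subgraphD[OF Y]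
  fix c :: "'v \<Rightarrow> bool" and d :: "'w \<Rightarrow> bool" and l e
  assume on_hs: "\<And>e l. \<lbrakk>e \<in> Y; l \<in> hs\<rbrakk> \<Longrightarrow> c (p (e \<cdot> l)) = c (p e)"
    and "e \<in> Y" "l \<in> L"
  have "l \<in> generate G hs" using \<open>l \<in> L\<close> hs(3) by simp
  then have "l \<in> L \<and> (\<forall>e \<in> Y. c (p (e \<cdot> l)) = c (p e))"
  proof (induction rule: generate.induct)
    case one
    then show ?case using D(6,7) by simp
  next
    case (incl h)
    then show ?case using on_hs hs(2) by blast
  next
    case (inv h)
    then have h: "h \<in> L" using hs(2) by blast
    have "c (p (e \<cdot> inv h)) = c (p e)" if "e \<in> Y" for e
      using on_hs[OF D(4)[OF that D(8)[OF h]] inv] act_inv(2)[OF D(6)[OF that] D(5)[OF h]] by simp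
    then show ?case using D(8)[OF h] by blast
  next
    case (eng h k)
    have "c (p (e \<cdot> (h \<otimes> k))) = c (p e)" if "e \<in> Y" for e
      using eng that D(4,5,6) by (simp add: act_mult)
    then show ?case using eng D(9) by blast
  qed
  then show "c (p (e \<cdot> l)) = c (p e)" using \<open>e \<in> Y\<close> by blast
qed

text \<open>
  Labellings supported on \<open>Y\<close> have potentials that are constant on \<open>Z\<close>, so all their displacements vanish.
  Hence \<open>cochain_count\<close> applies with no generators at all: the quotient of \<open>Y\<close> has rank zero, and \<open>L\<close> is
  trivial.
\<close>

lemma trivial_if_disjoint_subtrees:
  assumes Y: "cofinite_subgraph L Y" and conn: "edge_connected p q Y" and "Y \<noteq> {}"
    and Z: "Z \<subseteq> E" "\<And>e l. \<lbrakk>e \<in> Z; l \<in> L\<rbrakk> \<Longrightarrow> e \<cdot> l \<in> Z" "edge_connected p q Z" "Z \<noteq> {}"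
    and disj: "Y \<inter> Z = {}" and fp: "free_at p L" and fq: "free_at q L"
  shows "L = {\<one>}"
proof -
  note D = cofinite_subgraphD[OF Y]
  have "card (orbit L ` Y) + 1 \<le> card ({} :: 'a set) + card (vertex_orbit p L Y ` Y) + card (vertex_orbit q L Y ` Y)"
  proof (rule cochain_count[OF Y conn \<open>Y \<noteq> {}\<close>])
    fix c :: "'v \<Rightarrow> bool" and d :: "'w \<Rightarrow> bool" and l e
    assume inv: "\<And>e l. \<lbrakk>e \<in> E; l \<in> L\<rbrakk> \<Longrightarrow> (c (p (e \<cdot> l)) \<noteq> d (q (e \<cdot> l))) = (c (p e) \<noteq> d (q e))"
      and out: "\<And>e. e \<in> E - Y \<Longrightarrow> c (p e) = d (q e)" and "e \<in> Y" "l \<in> L"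
    obtain z where z: "z \<in> Z" using Z by blast
    have on_Z: "c (p x) = d (q x)" if "x \<in> Z" for x
      using out that Z(1) disj by blast
    have Z_const: "c (p x) = c (p y)" if "x \<in> Z" "y \<in> Z" for x y
    proof (rule edge_connectedD[OF Z(3), where P = "\<lambda>e. c (p e)"])
      fix x y assume "x \<in> Z" "y \<in> Z" "q x = q y"
      then show "c (p x) = c (p y)" using on_Z by simp
    qed (use that in auto)
    have lc: "l \<in> carrier G" using D(5) \<open>l \<in> L\<close> .
    have "(c (p (e \<cdot> l)) \<noteq> c (p e)) = (c (p (z \<cdot> l)) \<noteq> c (p z))"
      by (rule displacement_constant[OF order_refl tree_connected lc inv])
        (use D(6)[OF \<open>e \<in> Y\<close>] \<open>l \<in> L\<close> z Z(1) in auto)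
    then show "c (p (e \<cdot> l)) = c (p e)"
      using Z_const[OF Z(2)[OF z \<open>l \<in> L\<close>] z] by simp
  qed auto
  moreover obtain S where "S \<subseteq> L" "finite S" "generate G S = L"
    "card S + card (vertex_orbit p L Y ` Y) + card (vertex_orbit q L Y ` Y) \<le> card (orbit L ` Y) + 1"
    using generating_set_of_connected_quotient[OF Y conn \<open>Y \<noteq> {}\<close> p_equiv q_equiv fp fq] by blast
  ultimately have "card S = 0" unfolding card.empty by linarith
  then have "generate G {} = L" using \<open>finite S\<close> \<open>generate G S = L\<close> by simp
  then show ?thesis using generate_empty by simp
qed

text \<open>
  A Mayer-Vietoris argument: a locally constant function on the intersection, extended to the vertices of
  \<open>Y\<close>, has a coboundary that vanishes on \<open>Z\<close>. A potential for the part of it on \<open>Y\<close> is constant on \<open>Z\<close> and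
  differs from the extension by a constant on \<open>Y\<close>.
\<close>

lemma intersection_connected:
  assumes Y: "Y \<subseteq> E" "edge_connected p q Y" and Z: "Z \<subseteq> E" "edge_connected p q Z"
  shows "edge_connected p q (Y \<inter> Z)"
proof (rule edge_connectedI)
  fix P :: "'e \<Rightarrow> bool" and a b
  assume Pp: "\<And>x y. \<lbrakk>x \<in> Y \<inter> Z; y \<in> Y \<inter> Z; p x = p y\<rbrakk> \<Longrightarrow> P x = P y"
    and Pq: "\<And>x y. \<lbrakk>x \<in> Y \<inter> Z; y \<in> Y \<inter> Z; q x = q y\<rbrakk> \<Longrightarrow> P x = P y"
    and ab: "a \<in> Y \<inter> Z" "b \<in> Y \<inter> Z"
  define c0 where "c0 = (\<lambda>v. \<exists>x \<in> Y \<inter> Z. p x = v \<and> P x)"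
  define d0 where "d0 = (\<lambda>w. \<exists>x \<in> Y \<inter> Z. q x = w \<and> P x)"
  have c0: "c0 (p x) = P x" and d0: "d0 (q x) = P x" if "x \<in> Y \<inter> Z" for x
    unfolding c0_def d0_def using Pp Pq that by blast+
  obtain c :: "'v \<Rightarrow> bool" and d :: "'w \<Rightarrow> bool"
    where cd: "\<forall>e \<in> E. (e \<in> Y \<and> c0 (p e) \<noteq> d0 (q e)) \<longleftrightarrow> c (p e) \<noteq> d (q e)"
    using coboundary[of "\<lambda>e. e \<in> Y \<and> c0 (p e) \<noteq> d0 (q e)"] by blast
  have onZ: "c (p x) = d (q x)" if "x \<in> Z" for x
    using cd Z(1) c0 d0 that by blast
  have onY: "(c0 (p x) \<noteq> d0 (q x)) = (c (p x) \<noteq> d (q x))" if "x \<in> Y" for x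
    using cd Y(1) that by blast
  have "c (p a) = c (p b)"
  proof (rule edge_connectedD[OF Z(2), where P = "\<lambda>e. c (p e)"])
    fix x y assume "x \<in> Z" "y \<in> Z" "q x = q y"
    then show "c (p x) = c (p y)" using onZ by simp
  qed (use ab in auto)
  moreover have "(c (p a) \<noteq> c0 (p a)) = (c (p b) \<noteq> c0 (p b))"
  proof (rule edge_connectedD[OF Y(2), where P = "\<lambda>e. c (p e) \<noteq> c0 (p e)"])
    fix x y assume "x \<in> Y" "y \<in> Y" "q x = q y"
    then show "(c (p x) \<noteq> c0 (p x)) = (c (p y) \<noteq> c0 (p y))" using onY[of x] onY[of y] by auto
  qed (use ab in auto)
  ultimately show "P a = P b" using c0 ab by auto
qed

lemma translate_connected:
  assumes Y: "Y \<subseteq> E" "edge_connected p q Y" and g: "g \<in> carrier G"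
  shows "edge_connected p q ((\<lambda>e. e \<cdot> g) ` Y)"
proof (rule edge_connectedI)
  fix P :: "'e \<Rightarrow> bool" and a b
  assume Pp: "\<And>x y. \<lbrakk>x \<in> (\<lambda>e. e \<cdot> g) ` Y; y \<in> (\<lambda>e. e \<cdot> g) ` Y; p x = p y\<rbrakk> \<Longrightarrow> P x = P y"
    and Pq: "\<And>x y. \<lbrakk>x \<in> (\<lambda>e. e \<cdot> g) ` Y; y \<in> (\<lambda>e. e \<cdot> g) ` Y; q x = q y\<rbrakk> \<Longrightarrow> P x = P y"
    and ab: "a \<in> (\<lambda>e. e \<cdot> g) ` Y" "b \<in> (\<lambda>e. e \<cdot> g) ` Y"
  obtain a' b' where ab': "a' \<in> Y" "a = a' \<cdot> g" "b' \<in> Y" "b = b' \<cdot> g" using ab by blast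
  have "P (a' \<cdot> g) = P (b' \<cdot> g)"
  proof (rule edge_connectedD[OF Y(2), where P = "\<lambda>e. P (e \<cdot> g)"])
    fix x y assume xy: "x \<in> Y" "y \<in> Y"
    then have xyE: "x \<in> E" "y \<in> E" using Y by auto
    show "P (x \<cdot> g) = P (y \<cdot> g)" if "p x = p y"
      using Pp[OF imageI imageI equivariantD[OF p_equiv xyE g that]] xy by blast
    show "P (x \<cdot> g) = P (y \<cdot> g)" if "q x = q y"
      using Pq[OF imageI imageI equivariantD[OF q_equiv xyE g that]] xy by blast
  qed (use ab' in auto)
  then show "P a = P b" using ab' by simp
qed

lemma exists_finite_connected:
  assumes Y: "edge_connected p q Y" and "e0 \<in> Y" "e \<in> Y"
  obtains F where "finite F" "F \<subseteq> Y" "edge_connected p q F" "e0 \<in> F" "e \<in> F"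
proof -
  define P where "P = (\<lambda>e. \<exists>F. finite F \<and> F \<subseteq> Y \<and> edge_connected p q F \<and> e0 \<in> F \<and> e \<in> F)"
  have step: "P y" if "P x" "x \<in> Y" "y \<in> Y" "p x = p y \<or> q x = q y" for x y
  proof -
    obtain F where F: "finite F" "F \<subseteq> Y" "edge_connected p q F" "e0 \<in> F" "x \<in> F"
      using \<open>P x\<close> unfolding P_def by blast
    have "edge_connected p q (insert y F)"
    proof (rule edge_connectedI)
      fix Q :: "'e \<Rightarrow> bool" and a b
      assume Qp: "\<And>a b. \<lbrakk>a \<in> insert y F; b \<in> insert y F; p a = p b\<rbrakk> \<Longrightarrow> Q a = Q b"
        and Qq: "\<And>a b. \<lbrakk>a \<in> insert y F; b \<in> insert y F; q a = q b\<rbrakk> \<Longrightarrow> Q a = Q b"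
        and ab: "a \<in> insert y F" "b \<in> insert y F"
      have "Q x = Q y" using that(4) Qp[of x y] Qq[of x y] F(5) by blast
      moreover have "Q a = Q x" if "a \<in> F" for a
      proof (rule edge_connectedD[OF F(3), where P = Q])
        show "Q u = Q v" if "u \<in> F" "v \<in> F" "p u = p v" for u v using Qp[of u v] that by blast
        show "Q u = Q v" if "u \<in> F" "v \<in> F" "q u = q v" for u v using Qq[of u v] that by blast
      qed (use that F in auto)
      ultimately show "Q a = Q b" using ab by auto
    qed
    then show ?thesis
      unfolding P_def using F \<open>y \<in> Y\<close> by (intro exI[of _ "insert y F"]) auto
  qed
  have "P e0"
    unfolding P_def using assms by (intro exI[of _ "{e0}"]) (auto intro: edge_connectedI)
  moreover have "P e = P e0"
  proof (rule edge_connectedD[OF Y, where P = P])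
    show "P x = P y" if "x \<in> Y" "y \<in> Y" "p x = p y" for x y
      using step[of x y] step[of y x] that by metis
    show "P x = P y" if "x \<in> Y" "y \<in> Y" "q x = q y" for x y
      using step[of x y] step[of y x] that by metis
  qed (use assms in auto)
  ultimately have "P e" by simp
  then show thesis unfolding P_def using that by blast
qed

text \<open>
  Join an edge to its translates by the generators inside finite connected pieces; the translates of these
  pieces by the generated group form a connected subgraph, since passing from \<open>k\<close> to \<open>h \<otimes> k\<close> for a
  generator \<open>h\<close> stays within one translated piece.
\<close>

lemma exists_cofinite_subtree:
  assumes hs: "finite hs" "hs \<subseteq> carrier G"
    and W: "W \<subseteq> E" "edge_connected p q W" "W \<noteq> {}"
    and W_inv: "\<And>e h. \<lbrakk>e \<in> W; h \<in> generate G hs\<rbrakk> \<Longrightarrow> e \<cdot> h \<in> W"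
  obtains Y where "Y \<subseteq> W" "cofinite_subgraph (generate G hs) Y" "edge_connected p q Y" "Y \<noteq> {}"
proof -
  let ?H = "generate G hs"
  have H: "subgroup ?H G" using generate_is_subgroup[OF hs(2)] .
  have Hc: "h \<in> carrier G" if "h \<in> ?H" for h using H that by (meson subgroup.mem_carrier)
  obtain e0 where e0W: "e0 \<in> W" using W(3) by blast
  then have e0: "e0 \<in> E" using W(1) by blast
  have "\<exists>F. finite F \<and> F \<subseteq> W \<and> edge_connected p q F \<and> e0 \<in> F \<and> e0 \<cdot> h \<in> F" if hh: "h \<in> hs" for h
  proof -
    have "e0 \<cdot> h \<in> W" using W_inv[OF e0W generate.incl[OF hh]] .
    then show ?thesis using exists_finite_connected[OF W(2) e0W] by metis
  qed
  then obtain F where F: "\<And>h. h \<in> hs \<Longrightarrow>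
      finite (F h) \<and> F h \<subseteq> W \<and> edge_connected p q (F h) \<and> e0 \<in> F h \<and> e0 \<cdot> h \<in> F h"
    by metis
  define X where "X = insert e0 (\<Union>h \<in> hs. F h)"
  have XW: "X \<subseteq> W" using F e0W by (auto simp: X_def)
  have X: "finite X" "X \<subseteq> E" "e0 \<in> X" using F hs XW W(1) by (auto simp: X_def)
  define Y where "Y = (\<Union>x \<in> X. orbit ?H x)"
  have YI: "x \<cdot> h \<in> Y" if "x \<in> X" "h \<in> ?H" for x h using that by (auto simp: Y_def orbit_def)
  have YD: "\<exists>x \<in> X. \<exists>h \<in> ?H. y = x \<cdot> h" if "y \<in> Y" for y using that by (auto simp: Y_def orbit_def)
  have YW: "Y \<subseteq> W" using YD XW W_inv by (metis subsetD subsetI)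
  then have YE: "Y \<subseteq> E" using W(1) by blast
  have e0Y: "e0 \<in> Y" using YI[OF X(3) generate.one] e0 by simp
  have inv: "y \<cdot> k \<in> Y" if "y \<in> Y" and k: "k \<in> ?H" for y k
  proof -
    obtain x h where x: "x \<in> X" "h \<in> ?H" "y = x \<cdot> h" using YD \<open>y \<in> Y\<close> by blast
    then have "y \<cdot> k = x \<cdot> (h \<otimes> k)" using Hc X k by (simp add: act_mult subset_iff)
    then show ?thesis using YI[OF x(1) generate.eng[OF x(2) k]] by simp
  qed
  have "orbit ?H ` Y \<subseteq> orbit ?H ` X"
  proof
    fix V assume "V \<in> orbit ?H ` Y"
    then obtain y where y: "y \<in> Y" "V = orbit ?H y" by blast
    then obtain x where x: "x \<in> X" "\<exists>h \<in> ?H. y = x \<cdot> h" using YD by blast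
    have "orbit ?H x = orbit ?H y" using orbit_eq_iff[OF H] x y X YE by blast
    then show "V \<in> orbit ?H ` X" unfolding y(2) using imageI[OF x(1), of "orbit ?H"] by simp
  qed
  then have "finite (orbit ?H ` Y)" using X finite_surj by blast
  then have "cofinite_subgraph ?H Y"
    unfolding cofinite_subgraph_def using H YE inv by blast
  moreover have "edge_connected p q Y"
  proof (rule edge_connectedI)
    fix P :: "'e \<Rightarrow> bool" and a b
    assume Pp: "\<And>x y. \<lbrakk>x \<in> Y; y \<in> Y; p x = p y\<rbrakk> \<Longrightarrow> P x = P y"
      and Pq: "\<And>x y. \<lbrakk>x \<in> Y; y \<in> Y; q x = q y\<rbrakk> \<Longrightarrow> P x = P y" and ab: "a \<in> Y" "b \<in> Y"
    have piece: "P (x \<cdot> k) = P (e0 \<cdot> k)" if "x \<in> X" and k: "k \<in> ?H" for x k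
    proof (cases "x = e0")
      case False
      then obtain h where h: "h \<in> hs" "x \<in> F h" using \<open>x \<in> X\<close> by (auto simp: X_def)
      let ?F = "(\<lambda>e. e \<cdot> k) ` F h"
      have "F h \<subseteq> E" using F[OF h(1)] W(1) by blast
      then have "edge_connected p q ?F" using translate_connected F[OF h(1)] Hc[OF k] by blast
      moreover have sub: "?F \<subseteq> Y" using YI[OF _ k] h by (auto simp: X_def)
      ultimately show ?thesis
      proof (rule_tac edge_connectedD[of p q ?F P])
        show "P u = P v" if "u \<in> ?F" "v \<in> ?F" "p u = p v" for u v using Pp that sub by blast
        show "P u = P v" if "u \<in> ?F" "v \<in> ?F" "q u = q v" for u v using Pq that sub by blast
      qed (use h F in auto)
    qed simp
    have "\<forall>k \<in> ?H. P (e0 \<cdot> (h \<otimes> k)) = P (e0 \<cdot> k)" if "h \<in> ?H" for h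
      using that
    proof (induction rule: generate.induct)
      case one
      then show ?case using Hc by simp
    next
      case (incl h)
      show ?case
      proof
        fix k assume k: "k \<in> ?H"
        have "e0 \<cdot> h \<in> X" using F[OF incl] incl by (auto simp: X_def)
        then show "P (e0 \<cdot> (h \<otimes> k)) = P (e0 \<cdot> k)"
          using piece[OF _ k] e0 Hc[OF k] incl hs by (simp add: act_mult subset_iff)
      qed
    next
      case (inv h)
      show ?case
      proof
        fix k assume k: "k \<in> ?H"
        have hc: "h \<in> carrier G" using inv hs by blast
        have "e0 \<cdot> h \<in> X" using F[OF inv] inv by (auto simp: X_def)
        moreover have "inv h \<otimes> k \<in> ?H" using generate.eng[OF generate.inv[OF inv] k] .
        ultimately have "P (e0 \<cdot> h \<cdot> (inv h \<otimes> k)) = P (e0 \<cdot> (inv h \<otimes> k))"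
          using piece by blast
        moreover have "e0 \<cdot> h \<cdot> (inv h \<otimes> k) = e0 \<cdot> k"
          using e0 hc Hc[OF k] by (simp add: act_mult)
        ultimately show "P (e0 \<cdot> (inv h \<otimes> k)) = P (e0 \<cdot> k)" by simp
      qed
    next
      case (eng h1 h2)
      show ?case
      proof
        fix k assume k: "k \<in> ?H"
        have "P (e0 \<cdot> (h1 \<otimes> (h2 \<otimes> k))) = P (e0 \<cdot> (h2 \<otimes> k))"
          using eng k generate.eng[OF eng(2) k] by blast
        then show "P (e0 \<cdot> (h1 \<otimes> h2 \<otimes> k)) = P (e0 \<cdot> k)"
          using eng k Hc by (simp add: m_assoc)
      qed
    qed
    then have "P (e0 \<cdot> h) = P e0" if "h \<in> ?H" for h
      using that generate.one[of G hs] Hc[OF that] e0 by (metis act_one r_one)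
    then have "P y = P e0" if "y \<in> Y" for y
      using YD[OF that] piece by metis
    then show "P a = P b" using ab by blast
  qed
  ultimately show thesis using that YW e0Y by blast
qed

end

section \<open>Intersections of conjugates\<close>

context group
begin

lemma mem_conjugate_iff:
  assumes "H \<subseteq> carrier G" "s \<in> carrier G"
  shows "l \<in> conjugate G H s \<longleftrightarrow> l \<in> carrier G \<and> s \<otimes> l \<otimes> inv s \<in> H"
proof
  assume "l \<in> conjugate G H s"
  then obtain h where "h \<in> H" "l = inv s \<otimes> h \<otimes> s" by (auto simp: conjugate_def)
  then show "l \<in> carrier G \<and> s \<otimes> l \<otimes> inv s \<in> H"
    using assms by (auto simp: m_assoc subset_iff inv_solve_left) (simp add: m_assoc[symmetric])
next
  assume l: "l \<in> carrier G \<and> s \<otimes> l \<otimes> inv s \<in> H"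
  then have "l = inv s \<otimes> (s \<otimes> l \<otimes> inv s) \<otimes> s"
    using assms by (simp add: m_assoc) (simp add: m_assoc[symmetric])
  then show "l \<in> conjugate G H s" using l by (auto simp: conjugate_def)
qed

lemma subgroup_conjugate_Int:
  assumes H: "subgroup H G" and K: "subgroup K G" and s: "s \<in> carrier G"
  shows "subgroup (conjugate G H s \<inter> K) G"
proof -
  note iff = mem_conjugate_iff[OF subgroup.subset[OF H] s]
  show ?thesis
  proof (rule subgroupI)
    have "s \<otimes> \<one> \<otimes> inv s = \<one>" using s by simp
    then have "\<one> \<in> conjugate G H s \<inter> K"
      using iff[of \<one>] H K by (simp add: subgroup.one_closed)
    then show "conjugate G H s \<inter> K \<noteq> {}" by blast
  next
    fix a assume a: "a \<in> conjugate G H s \<inter> K"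
    then have "s \<otimes> inv a \<otimes> inv s = inv (s \<otimes> a \<otimes> inv s)"
      using s iff[of a] by (simp add: inv_mult_group m_assoc)
    then show "inv a \<in> conjugate G H s \<inter> K"
      using a iff[of a] iff[of "inv a"] H K by (simp add: subgroup.m_inv_closed)
  next
    fix a b assume ab: "a \<in> conjugate G H s \<inter> K" "b \<in> conjugate G H s \<inter> K"
    then have c: "a \<in> carrier G" "b \<in> carrier G" using iff by auto
    have "(s \<otimes> a \<otimes> inv s) \<otimes> (s \<otimes> b \<otimes> inv s) = s \<otimes> (a \<otimes> ((inv s \<otimes> s) \<otimes> (b \<otimes> inv s)))"
      using s c by (simp only: m_assoc m_closed inv_closed)
    also have "\<dots> = s \<otimes> (a \<otimes> b) \<otimes> inv s" using s c by (simp add: m_assoc)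
    finally have "s \<otimes> (a \<otimes> b) \<otimes> inv s \<in> H"
      using ab iff H by (metis IntD1 subgroup.m_closed)
    then show "a \<otimes> b \<in> conjugate G H s \<inter> K"
      using ab c iff[of "a \<otimes> b"] K by (simp add: subgroup.m_closed)
  qed (use subgroup.subset[OF K] in auto)
qed

end

context free_action
begin

lemma translate_invariant:
  assumes YH: "cofinite_subgraph H YH" and s: "s \<in> carrier G"
    and e: "e \<in> (\<lambda>e. e \<cdot> s) ` YH" and l: "l \<in> conjugate G H s"
  shows "e \<cdot> l \<in> (\<lambda>e. e \<cdot> s) ` YH"
proof -
  note D = cofinite_subgraphD[OF YH]
  obtain y where y: "y \<in> YH" "e = y \<cdot> s" using e by blast
  have lc: "l \<in> carrier G" and lH: "s \<otimes> l \<otimes> inv s \<in> H"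
    using mem_conjugate_iff[OF subgroup.subset[OF D(1)] s] l by blast+
  have "s \<otimes> l = (s \<otimes> l \<otimes> inv s) \<otimes> s" using s lc by (simp add: m_assoc)
  then have "y \<cdot> s \<cdot> l = y \<cdot> (s \<otimes> l \<otimes> inv s) \<cdot> s"
    using s lc D(6)[OF y(1)] by (simp flip: act_mult)
  then show ?thesis using y D(4)[OF y(1) lH] by blast
qed

text \<open>
  An edge of the intersection is determined up to the conjugate intersection by its orbits under the
  conjugate of \<open>H\<close> and under \<open>K\<close>, so the quotient embeds into the product of the two quotients.
\<close>

lemma cofinite_subgraph_Int:
  assumes YH: "cofinite_subgraph H YH" and YK: "cofinite_subgraph K YK" and s: "s \<in> carrier G"
  shows "cofinite_subgraph (conjugate G H s \<inter> K) ((\<lambda>e. e \<cdot> s) ` YH \<inter> YK)"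
proof -
  note DH = cofinite_subgraphD[OF YH] and DK = cofinite_subgraphD[OF YK]
  let ?L = "conjugate G H s \<inter> K" and ?Z = "(\<lambda>e. e \<cdot> s) ` YH \<inter> YK"
  have L: "subgroup ?L G" using subgroup_conjugate_Int[OF DH(1) DK(1) s] .
  note iff = mem_conjugate_iff[OF subgroup.subset[OF DH(1)] s]
  have ZE: "?Z \<subseteq> E" using DK(2) by blast
  have inv: "e \<cdot> l \<in> ?Z" if "e \<in> ?Z" "l \<in> ?L" for e l
  proof -
    have "e \<cdot> l \<in> YK" using that DK(4) by blast
    moreover have "e \<cdot> l \<in> (\<lambda>e. e \<cdot> s) ` YH"
      using translate_invariant[OF YH s] that by blast
    ultimately show ?thesis by blast
  qed
  have "finite (orbit ?L ` ?Z)"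
  proof -
    define f where "f = (\<lambda>e. (orbit H (e \<cdot> inv s), orbit K e))"
    have "f ` ?Z \<subseteq> orbit H ` YH \<times> orbit K ` YK"
      using s DH(6) by (auto simp: f_def)
    then have fin: "finite (f ` ?Z)" using DH(3) DK(3) by (meson finite_SigmaI finite_subset)
    have eq: "orbit ?L x = orbit ?L y" if xy: "x \<in> ?Z" "y \<in> ?Z" and "f x = f y" for x y
    proof -
      obtain x' y' where x': "x' \<in> YH" "x = x' \<cdot> s" "y' \<in> YH" "y = y' \<cdot> s" using xy by blast
      have E: "x' \<in> E" "y' \<in> E" "x \<in> E" "y \<in> E" using x' DH(6) ZE xy by auto
      have "orbit H x' = orbit H y'" "orbit K x = orbit K y"
        using \<open>f x = f y\<close> E s unfolding f_def x' by auto
      then obtain h k where h: "h \<in> H" "y' = x' \<cdot> h" and k: "k \<in> K" "y = x \<cdot> k"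
        using orbit_eq_iff[OF DH(1) E(1,2)] orbit_eq_iff[OF DK(1) E(3,4)] by blast
      have c: "h \<in> carrier G" "k \<in> carrier G" using DH(5) DK(5) h k by auto
      have "x' \<cdot> (h \<otimes> s) = x' \<cdot> (s \<otimes> k)"
        using x' h k c s E by (simp add: act_mult)
      then have "h \<otimes> s = s \<otimes> k" using act_inj E c s by blast
      then have "s \<otimes> k \<otimes> inv s = h" using c s by (metis inv_solve_right m_closed)
      then have "k \<in> ?L" using iff[of k] c h k by simp
      then show ?thesis using orbit_eq_iff[OF L E(3,4)] k by blast
    qed
    have "orbit ?L ` ?Z \<subseteq> (\<lambda>v. orbit ?L (SOME x. x \<in> ?Z \<and> f x = v)) ` f ` ?Z"
    proof
      fix V assume "V \<in> orbit ?L ` ?Z"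
      then obtain x where x: "x \<in> ?Z" "V = orbit ?L x" by blast
      have "(SOME y. y \<in> ?Z \<and> f y = f x) \<in> ?Z \<and> f (SOME y. y \<in> ?Z \<and> f y = f x) = f x"
        by (rule someI[of _ x]) (use x in auto)
      then have "orbit ?L x = orbit ?L (SOME y. y \<in> ?Z \<and> f y = f x)"
        using eq[of x "SOME y. y \<in> ?Z \<and> f y = f x"] x(1) by metis
      then have "V = orbit ?L (SOME y. y \<in> ?Z \<and> f y = f x)" unfolding x(2) .
      then show "V \<in> (\<lambda>v. orbit ?L (SOME x. x \<in> ?Z \<and> f x = v)) ` f ` ?Z"
        by (rule image_eqI) (rule imageI[OF x(1)])
    qed
    then show ?thesis by (rule finite_surj[OF fin])
  qed
  then show ?thesis
    unfolding cofinite_subgraph_def using L ZE inv by blast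
qed

text \<open>
  To a vertex orbit over \<open>s\<close>, containing the end of an edge \<open>e\<close>, assign the orbits \<open>A\<close> and \<open>B\<close> of that
  vertex, translated back by \<open>s\<close>, in \<open>YH\<close> and \<open>YK\<close>. If the vertex is the translate of the representative
  of \<open>A\<close> by \<open>h \<otimes> s\<close> and of the representative of \<open>B\<close> by \<open>k\<close>, assign also \<open>h \<otimes> s \<otimes> inv k\<close>. This is
  injective, since \<open>s\<close> is determined by its double coset, and after translation by \<open>k\<close> the star at the
  vertex is the overlap of the two stars. So \<open>excess_bound\<close> applies to each pair \<open>(A, B)\<close>.
\<close>

theorem pullback_weight_bound:
  fixes n d :: nat
  assumes \<pi>: "equivariant \<pi>"
    and YH: "cofinite_subgraph H YH" and YK: "cofinite_subgraph K YK"
    and fH: "free_at \<pi> H" and fK: "free_at \<pi> K"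
    and degH: "\<And>e. e \<in> YH \<Longrightarrow> card (star \<pi> YH e) \<ge> 2"
    and degK: "\<And>e. e \<in> YK \<Longrightarrow> card (star \<pi> YK e) \<ge> 2"
    and S: "finite S" "S \<subseteq> carrier G"
    and distinct: "\<And>s t h k. \<lbrakk>s \<in> S; t \<in> S; h \<in> H; k \<in> K; t = h \<otimes> s \<otimes> k\<rbrakk> \<Longrightarrow> s = t"
    and "d \<le> n"
    and small: "\<And>L. \<lbrakk>subgroup L G; finite L; card L \<ge> 3\<rbrakk> \<Longrightarrow> d * card L \<le> n * (card L - 2)"
  shows "d * (\<Sum>s \<in> S. weight \<pi> (conjugate G H s \<inter> K) ((\<lambda>e. e \<cdot> s) ` YH \<inter> YK))
    \<le> n * (weight \<pi> H YH * weight \<pi> K YK)"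
proof -
  note DH = cofinite_subgraphD[OF YH] and DK = cofinite_subgraphD[OF YK]
  let ?L = "\<lambda>s. conjugate G H s \<inter> K" and ?Z = "\<lambda>s. (\<lambda>e. e \<cdot> s) ` YH \<inter> YK"
  let ?VH = "vertex_orbit \<pi> H YH ` YH" and ?VK = "vertex_orbit \<pi> K YK ` YK"
  have ZC: "cofinite_subgraph (?L s) (?Z s)" if "s \<in> S" for s
    using cofinite_subgraph_Int[OF YH YK] S that by blast
  have fL: "free_at \<pi> (?L s)" for s using free_at_subset[OF fK] by blast
  define rep where "rep = (\<lambda>V :: 'e set. SOME e. e \<in> V)"
  have rep: "rep (vertex_orbit \<pi> L Y e) \<in> vertex_orbit \<pi> L Y e" if "cofinite_subgraph L Y" "e \<in> Y" for L Y e
    unfolding rep_def by (rule someI, rule mem_vertex_orbit[OF that])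
  have rep_vertex: "rep V \<in> Y" "vertex_orbit \<pi> L Y (rep V) = V"
    if Y: "cofinite_subgraph L Y" and V: "V \<in> vertex_orbit \<pi> L Y ` Y" for L Y V
  proof -
    obtain e where e: "e \<in> Y" "V = vertex_orbit \<pi> L Y e" using V by blast
    show "rep V \<in> Y" using rep[OF Y e(1)] e by (simp add: vertex_orbit_def)
    then show "vertex_orbit \<pi> L Y (rep V) = V"
      using vertex_orbit_disjoint[OF Y \<pi> \<open>rep V \<in> Y\<close> e(1) mem_vertex_orbit[OF Y \<open>rep V \<in> Y\<close>]] rep[OF Y e(1)] e(2) by simp
  qed
  note repH = rep_vertex[OF YH] and repK = rep_vertex[OF YK]
  define cH where "cH = (\<lambda>A. star \<pi> YH (rep A))"
  define cK where "cK = (\<lambda>B. star \<pi> YK (rep B))"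
  have cH: "finite (cH A)" "cH A \<subseteq> E" "card (cH A) \<ge> 2" "card (orbit H ` A) = card (cH A)" if "A \<in> ?VH" for A
    using star_orbits[OF YH \<pi> fH repH(1)[OF that]] repH[OF that] degH DH(2) by (auto simp: cH_def star_def)
  have cK: "finite (cK A)" "cK A \<subseteq> E" "card (cK A) \<ge> 2" "card (orbit K ` A) = card (cK A)" if "A \<in> ?VK" for A
    using star_orbits[OF YK \<pi> fK repK(1)[OF that]] repK[OF that] degK DK(2) by (auto simp: cK_def star_def)
  define Ix where "Ix = (SIGMA s : S. vertex_orbit \<pi> (?L s) (?Z s) ` ?Z s)"
  have fin: "finite ?VH" "finite ?VK" "\<And>s. s \<in> S \<Longrightarrow> finite (vertex_orbit \<pi> (?L s) (?Z s) ` ?Z s)"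
    using finite_vertex_orbits[OF _ \<pi>] YH YK ZC by auto
  \<comment> \<open>\<open>h\<close> and \<open>k\<close> carry the representatives of \<open>A\<close> and \<open>B\<close> to the vertex in question.\<close>
  define good where "good = (\<lambda>(s, V) (A, B, h, k). A \<in> ?VH \<and> B \<in> ?VK \<and> h \<in> H \<and> k \<in> K \<and>
    (\<exists>e \<in> ?Z s. V = vertex_orbit \<pi> (?L s) (?Z s) e \<and> \<pi> (rep A \<cdot> h \<cdot> s) = \<pi> e \<and> \<pi> (rep B \<cdot> k) = \<pi> e))"
  have "\<exists>t. good i t" if i: "i \<in> Ix" for i
  proof -
    obtain s e where s: "s \<in> S" "e \<in> ?Z s" "i = (s, vertex_orbit \<pi> (?L s) (?Z s) e)"
      using i by (auto simp: Ix_def)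
    have sc: "s \<in> carrier G" using S s by blast
    obtain y where y: "y \<in> YH" "e = y \<cdot> s" using s by blast
    have eK: "e \<in> YK" using s by blast
    obtain h where h: "h \<in> H" "\<pi> (rep (vertex_orbit \<pi> H YH y)) = \<pi> (y \<cdot> h)" "rep (vertex_orbit \<pi> H YH y) \<in> YH"
      using rep[OF YH y(1)] by (auto simp: vertex_orbit_def)
    obtain k where k: "k \<in> K" "\<pi> (rep (vertex_orbit \<pi> K YK e)) = \<pi> (e \<cdot> k)" "rep (vertex_orbit \<pi> K YK e) \<in> YK"
      using rep[OF YK eK] by (auto simp: vertex_orbit_def)
    have "\<pi> y = \<pi> (rep (vertex_orbit \<pi> H YH y) \<cdot> inv h)"
      by (rule equivariant_move[OF \<pi> DH(6)[OF h(3)] DH(6)[OF y(1)] DH(5)[OF h(1)] h(2)])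
    then have "\<pi> e = \<pi> (rep (vertex_orbit \<pi> H YH y) \<cdot> inv h \<cdot> s)"
      unfolding y(2)
      by (intro equivariantD[OF \<pi>]) (use DH(6)[OF h(3)] DH(6)[OF y(1)] DH(5)[OF h(1)] sc in auto)
    moreover have "\<pi> e = \<pi> (rep (vertex_orbit \<pi> K YK e) \<cdot> inv k)"
      by (rule equivariant_move[OF \<pi> DK(6)[OF k(3)] DK(6)[OF eK] DK(5)[OF k(1)] k(2)])
    ultimately have "good i (vertex_orbit \<pi> H YH y, vertex_orbit \<pi> K YK e, inv h, inv k)"
      unfolding good_def s(3) prod.case using y(1) eK DH(8)[OF h(1)] DK(8)[OF k(1)] s(2)
      by (intro conjI bexI[of _ e] imageI refl) simp_all
    then show ?thesis by blast
  qed
  then obtain T where T: "\<And>i. i \<in> Ix \<Longrightarrow> good i (T i)" by metis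
  define \<phi> where "\<phi> = (\<lambda>i. case T i of (A, B, h, k) \<Rightarrow> ((A, B), h \<otimes> fst i \<otimes> inv k))"
  define J where "J = (SIGMA (A, B) : ?VH \<times> ?VK. transporters (cH A) (cK B))"
  define wt where "wt = (\<lambda>((A, B), g). overlap (cH A) (cK B) g - 2)"
  have main: "\<phi> i \<in> J \<and> card (orbit (?L (fst i)) ` snd i) - 2 \<le> wt (\<phi> i)" if i: "i \<in> Ix" for i
  proof -
    obtain s V where sV: "i = (s, V)" by (cases i)
    obtain A B h k where Ti: "T i = (A, B, h, k)" by (cases "T i")
    obtain e where t: "A \<in> ?VH" "B \<in> ?VK" "h \<in> H" "k \<in> K" "e \<in> ?Z s" "V = vertex_orbit \<pi> (?L s) (?Z s) e"
      "\<pi> (rep A \<cdot> h \<cdot> s) = \<pi> e" "\<pi> (rep B \<cdot> k) = \<pi> e"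
      using T[OF i] unfolding good_def sV[symmetric] Ti prod.case by (auto simp: sV)
    have sS: "s \<in> S" using i by (simp add: Ix_def sV)
    have c: "s \<in> carrier G" "h \<in> carrier G" "k \<in> carrier G" using S sS DH(5) DK(5) t by auto
    let ?g = "h \<otimes> s \<otimes> inv k"
    have gc: "?g \<in> carrier G" using c by simp
    have rE: "rep A \<in> E" "rep B \<in> E" using repH repK t DH(6) DK(6) by auto
    let ?O = "{x \<in> cH A. x \<cdot> ?g \<in> cK B}"
    have sub: "star \<pi> (?Z s) e \<subseteq> (\<lambda>x. x \<cdot> (h \<otimes> s)) ` ?O"
    proof
      fix z assume "z \<in> star \<pi> (?Z s) e"
      then have z: "z \<in> ?Z s" "\<pi> z = \<pi> e" by (auto simp: star_def)
      obtain y where y: "y \<in> YH" "z = y \<cdot> s" using z by blast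
      have yE: "y \<in> E" "z \<in> E" using DH(6) y DK(6) z by auto
      define x where "x = y \<cdot> inv h"
      have xY: "x \<in> YH" using DH(4)[OF y(1) DH(8)[OF t(3)]] by (simp add: x_def)
      have xE: "x \<in> E" using DH(6) xY by blast
      have xz: "x \<cdot> (h \<otimes> s) = z" using yE c by (simp add: x_def y act_mult)
      have "\<pi> z = \<pi> (rep A \<cdot> (h \<otimes> s))" using t(7) z(2) rE c by (simp add: act_mult)
      then have "\<pi> (rep A) = \<pi> (z \<cdot> inv (h \<otimes> s))"
        by (rule equivariant_move[OF \<pi> yE(2) rE(1) m_closed[OF c(2,1)]])
      moreover have "z \<cdot> inv (h \<otimes> s) = x"
        unfolding xz[symmetric] using xE c by simp
      ultimately have "x \<in> cH A" using xY by (simp add: cH_def star_def)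
      moreover have "x \<cdot> ?g \<in> cK B"
      proof -
        have eq: "x \<cdot> ?g = z \<cdot> inv k" using xz xE c by (simp add: act_mult)
        have "\<pi> z = \<pi> (rep B \<cdot> k)" using t(8) z(2) by simp
        then have "\<pi> (rep B) = \<pi> (z \<cdot> inv k)"
          by (rule equivariant_move[OF \<pi> yE(2) rE(2) c(3)])
        moreover have "z \<cdot> inv k \<in> YK" using z DK(4,8) t by blast
        ultimately show ?thesis unfolding eq by (simp add: cK_def star_def)
      qed
      ultimately show "z \<in> (\<lambda>x. x \<cdot> (h \<otimes> s)) ` ?O" using xz by blast
    qed
    have "finite ?O" using cH(1)[OF t(1)] by simp
    then have "card (star \<pi> (?Z s) e) \<le> card ?O"
      using sub by (meson card_image_le card_mono finite_imageI le_trans)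
    moreover have "card (orbit (?L s) ` V) = card (star \<pi> (?Z s) e)"
      using star_orbits(1)[OF ZC[OF sS] \<pi> fL t(5)] t(6) by simp
    ultimately have "card (orbit (?L s) ` V) \<le> overlap (cH A) (cK B) ?g"
      by (simp add: overlap_def)
    moreover have "e \<in> star \<pi> (?Z s) e" using t(5) by (simp add: star_def)
    then have "?g \<in> transporters (cH A) (cK B)"
      using sub gc unfolding transporters_def by blast
    moreover have "\<phi> i = ((A, B), ?g)"
      unfolding \<phi>_def Ti by (simp add: sV)
    ultimately show ?thesis
      using t(1,2) by (simp add: J_def wt_def sV diff_le_mono)
  qed
  have inj: "inj_on \<phi> Ix"
  proof (rule inj_onI)
    fix i i' assume i: "i \<in> Ix" "i' \<in> Ix" and eq: "\<phi> i = \<phi> i'"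
    obtain s V s' V' where sV: "i = (s, V)" "i' = (s', V')" by (cases i, cases i')
    obtain A B h k where Ti: "T i = (A, B, h, k)" by (cases "T i")
    obtain A' B' h' k' where Ti': "T i' = (A', B', h', k')" by (cases "T i'")
    have same: "A' = A" "B' = B" "h \<otimes> s \<otimes> inv k = h' \<otimes> s' \<otimes> inv k'"
      using eq unfolding \<phi>_def Ti Ti' by (simp_all add: sV)
    obtain e where t: "B \<in> ?VK" "h \<in> H" "k \<in> K" "e \<in> ?Z s" "V = vertex_orbit \<pi> (?L s) (?Z s) e"
      "\<pi> (rep B \<cdot> k) = \<pi> e"
      using T[OF i(1)] unfolding good_def Ti prod.case by (auto simp: sV)
    obtain e' where t': "h' \<in> H" "k' \<in> K" "e' \<in> ?Z s'" "V' = vertex_orbit \<pi> (?L s') (?Z s') e'"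
      "\<pi> (rep B \<cdot> k') = \<pi> e'"
      using T[OF i(2)] unfolding good_def Ti' prod.case by (auto simp: sV same)
    have sS: "s \<in> S" "s' \<in> S" using i by (simp_all add: Ix_def sV)
    have c: "s \<in> carrier G" "h \<in> carrier G" "k \<in> carrier G" "s' \<in> carrier G" "h' \<in> carrier G" "k' \<in> carrier G"
      using S sS DH(5) DK(5) t t' by auto
    have "h \<otimes> s \<otimes> inv k \<otimes> k' = h' \<otimes> s'"
      unfolding same using c by (simp add: m_assoc)
    then have "inv h' \<otimes> (h \<otimes> s \<otimes> inv k \<otimes> k') = s'"
      using c by (simp add: inv_solve_left')
    then have s'_eq: "s' = (inv h' \<otimes> h) \<otimes> s \<otimes> (inv k \<otimes> k')"
      using c by (simp add: m_assoc)
    have ss: "s' = s"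
      using distinct[OF sS DH(9)[OF DH(8)[OF t'(1)] t(2)] DK(9)[OF DK(8)[OF t(3)] t'(2)] s'_eq] by simp
    let ?l = "inv k \<otimes> k'"
    have lc: "?l \<in> carrier G" using c by simp
    have "(inv h' \<otimes> h) \<otimes> (s \<otimes> ?l) = s"
      using s'_eq c by (simp add: ss m_assoc)
    then have "s \<otimes> ?l = inv (inv h' \<otimes> h) \<otimes> s"
      using c by (metis inv_closed inv_solve_left m_closed)
    then have "s \<otimes> ?l \<otimes> inv s = inv (inv h' \<otimes> h)"
      using c by (simp add: m_assoc)
    then have "s \<otimes> ?l \<otimes> inv s \<in> H"
      using DH(8)[OF DH(9)[OF DH(8)[OF t'(1)] t(2)]] by simp
    then have lL: "?l \<in> ?L s"
      using mem_conjugate_iff[OF subgroup.subset[OF DH(1)] c(1)] lc DK(9)[OF DK(8)[OF t(3)] t'(2)] by blast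
    have rE: "rep B \<in> E" "e \<in> E" using repK t DK(6) by auto
    have "\<pi> (e \<cdot> ?l) = \<pi> (rep B \<cdot> k \<cdot> ?l)"
      by (rule equivariantD[OF \<pi>]) (use rE c lc t(6) in auto)
    also have "rep B \<cdot> k \<cdot> ?l = rep B \<cdot> k'"
      using rE c by (simp add: act_mult)
    finally have "\<pi> e' = \<pi> (e \<cdot> ?l)" using t'(5) by simp
    then have "V = V'"
      using vertex_orbit_eq_iff[OF ZC[OF sS(1)] \<pi> t(4)] t'(3,4) t(5) lL ss by blast
    then show "i = i'" using sV ss by simp
  qed
  have fin_trans: "finite (transporters (cH A) (cK B))" if "A \<in> ?VH" "B \<in> ?VK" for A B
    using overlap_triples(1)[OF cH(2)[OF that(1)] cK(2)[OF that(2)] cH(1)[OF that(1)] cK(1)[OF that(2)]] .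
  then have finJ: "finite J" unfolding J_def using fin by (intro finite_SigmaI) auto
  have "(\<Sum>s \<in> S. weight \<pi> (?L s) (?Z s)) = (\<Sum>i \<in> Ix. card (orbit (?L (fst i)) ` snd i) - 2)"
    unfolding weight_def Ix_def using S fin by (subst sum.Sigma) (auto intro!: sum.cong)
  also have "\<dots> \<le> (\<Sum>i \<in> Ix. wt (\<phi> i))" using main by (intro sum_mono) blast
  also have "\<dots> = sum wt (\<phi> ` Ix)" using inj by (simp add: sum.reindex)
  also have "\<dots> \<le> sum wt J" using finJ main by (intro sum_mono2) auto
  also have "\<dots> = (\<Sum>(A, B) \<in> ?VH \<times> ?VK. excess (cH A) (cK B))"
    unfolding J_def wt_def excess_def using fin fin_trans
    by (subst sum.Sigma[symmetric]) (auto intro!: sum.cong)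
  finally have "d * (\<Sum>s \<in> S. weight \<pi> (?L s) (?Z s)) \<le> d * (\<Sum>(A, B) \<in> ?VH \<times> ?VK. excess (cH A) (cK B))"
    by (rule mult_le_mono2)
  also have "\<dots> = (\<Sum>(A, B) \<in> ?VH \<times> ?VK. d * excess (cH A) (cK B))"
    by (simp add: sum_distrib_left case_prod_beta)
  also have "\<dots> \<le> (\<Sum>(A, B) \<in> ?VH \<times> ?VK. n * ((card (cH A) - 2) * (card (cK B) - 2)))"
  proof (rule sum_mono)
    fix x assume "x \<in> ?VH \<times> ?VK"
    then obtain A B where x: "x = (A, B)" and AB: "A \<in> ?VH" "B \<in> ?VK" by blast
    have "d * excess (cH A) (cK B) \<le> n * ((card (cH A) - 2) * (card (cK B) - 2))"
      by (rule excess_bound[OF cH(2)[OF AB(1)] cK(2)[OF AB(2)] cH(1)[OF AB(1)] cK(1)[OF AB(2)]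
            cH(3)[OF AB(1)] cK(3)[OF AB(2)] \<open>d \<le> n\<close>]) (erule (2) small)
    then show "(case x of (A, B) \<Rightarrow> d * excess (cH A) (cK B))
        \<le> (case x of (A, B) \<Rightarrow> n * ((card (cH A) - 2) * (card (cK B) - 2)))"
      by (simp add: x)
  qed
  also have "\<dots> = n * ((\<Sum>A \<in> ?VH. card (cH A) - 2) * (\<Sum>B \<in> ?VK. card (cK B) - 2))"
    unfolding sum_product sum.cartesian_product by (simp add: sum_distrib_left case_prod_beta)
  also have "\<dots> = n * (weight \<pi> H YH * weight \<pi> K YK)"
    using cH(4) cK(4) by (simp add: weight_def cong: sum.cong)
  finally show ?thesis .
qed

end

context tree_action
begin

lemma core_of_generated:
  assumes hs: "finite hs" "hs \<subseteq> carrier G" and "E \<noteq> {}"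
    and fp: "free_at p (generate G hs)" and fq: "free_at q (generate G hs)"
    and nontriv: "generate G hs \<noteq> {\<one>}"
  obtains Y where "cofinite_subgraph (generate G hs) Y" "edge_connected p q Y" "Y \<noteq> {}"
    "\<And>e. e \<in> Y \<Longrightarrow> card (star p Y e) \<ge> 2" "\<And>e. e \<in> Y \<Longrightarrow> card (star q Y e) \<ge> 2"
    "weight p (generate G hs) Y + weight q (generate G hs) Y \<le> 2 * (card hs - 1)"
proof -
  let ?H = "generate G hs"
  have inv: "e \<cdot> h \<in> E" if "e \<in> E" "h \<in> ?H" for e h
    using that generate_in_carrier[OF hs(2) that(2)] by simp
  obtain Y0 where Y0: "cofinite_subgraph ?H Y0" "edge_connected p q Y0" "Y0 \<noteq> {}"
  proof (rule exists_cofinite_subtree[OF hs order_refl tree_connected \<open>E \<noteq> {}\<close>])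
    show "e \<cdot> h \<in> E" if "e \<in> E" "h \<in> ?H" for e h using that by (rule inv)
  qed (rule that)
  obtain Y where Y: "cofinite_subgraph ?H Y" "edge_connected p q Y" "Y \<noteq> {}"
    "\<And>e. e \<in> Y \<Longrightarrow> card (star p Y e) \<ge> 2" "\<And>e. e \<in> Y \<Longrightarrow> card (star q Y e) \<ge> 2"
    by (rule exists_core[OF Y0 p_equiv q_equiv fp fq nontriv]) (rule that)
  have "hs \<subseteq> ?H" using generate.incl by (metis subsetI)
  then have "card (orbit ?H ` Y) + 1 \<le> card hs + card (vertex_orbit p ?H Y ` Y) + card (vertex_orbit q ?H Y ` Y)"
    using rank_lower_bound[OF Y(1-3) hs(1)] by blast
  moreover have "weight p ?H Y + 2 * card (vertex_orbit p ?H Y ` Y) = card (orbit ?H ` Y)"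
    by (rule weight_eq[OF Y(1) p_equiv fp Y(4)])
  moreover have "weight q ?H Y + 2 * card (vertex_orbit q ?H Y ` Y) = card (orbit ?H ` Y)"
    by (rule weight_eq[OF Y(1) q_equiv fq Y(5)])
  ultimately have "weight p ?H Y + weight q ?H Y \<le> 2 * (card hs - 1)" by linarith
  then show thesis using that Y by blast
qed

lemma generating_set_of_core:
  assumes Z: "cofinite_subgraph L Z" "edge_connected p q Z" "Z \<noteq> {}"
    and fp: "free_at p L" and fq: "free_at q L" and nontriv: "L \<noteq> {\<one>}"
  obtains T where "T \<subseteq> L" "finite T" "generate G T = L" "2 * (card T - 1) \<le> weight p L Z + weight q L Z"
proof -
  obtain Y where Y: "Y \<subseteq> Z" "cofinite_subgraph L Y" "edge_connected p q Y" "Y \<noteq> {}"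
    "\<And>e. e \<in> Y \<Longrightarrow> card (star p Y e) \<ge> 2" "\<And>e. e \<in> Y \<Longrightarrow> card (star q Y e) \<ge> 2"
    by (rule exists_core[OF Z p_equiv q_equiv fp fq nontriv]) (rule that)
  obtain T where T: "T \<subseteq> L" "finite T" "generate G T = L"
    "card T + card (vertex_orbit p L Y ` Y) + card (vertex_orbit q L Y ` Y) \<le> card (orbit L ` Y) + 1"
    using generating_set_of_connected_quotient[OF Y(2-4) p_equiv q_equiv fp fq] by blast
  have "weight p L Y + 2 * card (vertex_orbit p L Y ` Y) = card (orbit L ` Y)"
    by (rule weight_eq[OF Y(2) p_equiv fp Y(5)])
  moreover have "weight q L Y + 2 * card (vertex_orbit q L Y ` Y) = card (orbit L ` Y)"
    by (rule weight_eq[OF Y(2) q_equiv fq Y(6)])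
  ultimately have "2 * (card T - 1) \<le> weight p L Y + weight q L Y" using T(4) by linarith
  also have "\<dots> \<le> weight p L Z + weight q L Z"
    by (intro add_mono weight_mono Z Y p_equiv q_equiv)
  finally show thesis using that T by blast
qed

text \<open>
  Both subtrees are invariant under the cyclic group generated by a nontrivial element of \<open>L\<close>. Being finitely
  generated, it preserves a subtree of \<open>Y\<close> with finite quotient, and if that were disjoint from \<open>Z\<close>, then
  \<open>trivial_if_disjoint_subtrees\<close> would apply.
\<close>

lemma subtrees_meet:
  assumes Y: "Y \<subseteq> E" "edge_connected p q Y" "Y \<noteq> {}" "\<And>e l. \<lbrakk>e \<in> Y; l \<in> L\<rbrakk> \<Longrightarrow> e \<cdot> l \<in> Y"
    and Z: "Z \<subseteq> E" "edge_connected p q Z" "Z \<noteq> {}" "\<And>e l. \<lbrakk>e \<in> Z; l \<in> L\<rbrakk> \<Longrightarrow> e \<cdot> l \<in> Z"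
    and L: "subgroup L G" and fp: "free_at p L" and fq: "free_at q L" and nontriv: "L \<noteq> {\<one>}"
  shows "Y \<inter> Z \<noteq> {}"
proof
  assume disj: "Y \<inter> Z = {}"
  obtain l where l: "l \<in> L" "l \<noteq> \<one>" using nontriv L subgroup.one_closed by blast
  let ?C = "generate G {l}"
  have lc: "{l} \<subseteq> carrier G" using l L subgroup.subset by blast
  have CL: "?C \<subseteq> L" using generate_subgroup_incl[OF _ L, of "{l}"] l by blast
  obtain Y' where Y': "Y' \<subseteq> Y" "cofinite_subgraph ?C Y'" "edge_connected p q Y'" "Y' \<noteq> {}"
    using exists_cofinite_subtree[OF _ lc Y(1-3)] Y(4) CL by (metis finite.emptyI finite.insertI subsetD)
  have "?C = {\<one>}"
  proof (rule trivial_if_disjoint_subtrees[OF Y'(2-4) Z(1) _ Z(2,3)])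
    show "e \<cdot> k \<in> Z" if "e \<in> Z" "k \<in> ?C" for e k using Z(4) CL that by blast
    show "Y' \<inter> Z = {}" using disj Y' by blast
    show "free_at p ?C" "free_at q ?C" using fp fq CL free_at_subset by blast+
  qed
  then show False using generate.incl[of l "{l}" G] l by simp
qed

text \<open>
  Free products enter only through their trees, so the inequality is proved for any group acting on a tree
  with trivial edge stabilizers. Generating sets in place of ranks, and finite sets \<open>S\<close> in place of all
  double coset representatives, keep everything in the natural numbers.
\<close>

theorem intersection_ranks:
  fixes n d :: nat
  assumes "E \<noteq> {}"
    and hs: "finite hs" "hs \<subseteq> carrier G" "generate G hs = H" "H \<noteq> {\<one>}"
    and ks: "finite ks" "ks \<subseteq> carrier G" "generate G ks = K" "K \<noteq> {\<one>}"
    and fH: "free_at p H" "free_at q H" and fK: "free_at p K" "free_at q K"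
    and S: "finite S" "S \<subseteq> carrier G"
    and distinct: "\<And>s t h k. \<lbrakk>s \<in> S; t \<in> S; h \<in> H; k \<in> K; t = h \<otimes> s \<otimes> k\<rbrakk> \<Longrightarrow> s = t"
    and "d \<le> n"
    and small: "\<And>L. \<lbrakk>subgroup L G; finite L; card L \<ge> 3\<rbrakk> \<Longrightarrow> d * card L \<le> n * (card L - 2)"
  obtains T where "\<And>s. s \<in> S \<Longrightarrow> T s \<subseteq> conjugate G H s \<inter> K"
    and "\<And>s. s \<in> S \<Longrightarrow> finite (T s)"
    and "\<And>s. s \<in> S \<Longrightarrow> generate G (T s) = conjugate G H s \<inter> K"
    and "d * (\<Sum>s \<in> S. card (T s) - 1) \<le> 2 * n * ((card hs - 1) * (card ks - 1))"
proof -
  obtain YH where YH: "cofinite_subgraph H YH" "edge_connected p q YH" "YH \<noteq> {}"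
    "\<And>e. e \<in> YH \<Longrightarrow> card (star p YH e) \<ge> 2" "\<And>e. e \<in> YH \<Longrightarrow> card (star q YH e) \<ge> 2"
    "weight p H YH + weight q H YH \<le> 2 * (card hs - 1)"
    using core_of_generated[OF hs(1,2) \<open>E \<noteq> {}\<close>] hs(3,4) fH by metis
  obtain YK where YK: "cofinite_subgraph K YK" "edge_connected p q YK" "YK \<noteq> {}"
    "\<And>e. e \<in> YK \<Longrightarrow> card (star p YK e) \<ge> 2" "\<And>e. e \<in> YK \<Longrightarrow> card (star q YK e) \<ge> 2"
    "weight p K YK + weight q K YK \<le> 2 * (card ks - 1)"
    using core_of_generated[OF ks(1,2) \<open>E \<noteq> {}\<close>] ks(3,4) fK by metis
  note DH = cofinite_subgraphD[OF YH(1)] and DK = cofinite_subgraphD[OF YK(1)]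
  let ?L = "\<lambda>s. conjugate G H s \<inter> K" and ?Z = "\<lambda>s. (\<lambda>e. e \<cdot> s) ` YH \<inter> YK"
  have ex: "\<exists>T. T \<subseteq> ?L s \<and> finite T \<and> generate G T = ?L s \<and>
      2 * (card T - 1) \<le> weight p (?L s) (?Z s) + weight q (?L s) (?Z s)" if s: "s \<in> S" for s
  proof (cases "?L s = {\<one>}")
    case True
    then show ?thesis using generate_empty by (intro exI[of _ "{}"]) auto
  next
    case False
    have sc: "s \<in> carrier G" using s S by blast
    have ZC: "cofinite_subgraph (?L s) (?Z s)" using cofinite_subgraph_Int[OF YH(1) YK(1) sc] .
    have fp: "free_at p (?L s)" and fq: "free_at q (?L s)" using fK free_at_subset by blast+
    have YHs: "(\<lambda>e. e \<cdot> s) ` YH \<subseteq> E" using DH(2) sc by auto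
    have conn: "edge_connected p q ((\<lambda>e. e \<cdot> s) ` YH)" using translate_connected[OF DH(2) YH(2) sc] .
    have "?Z s \<noteq> {}"
      by (rule subtrees_meet[OF YHs conn _ _ DK(2) YK(2,3) _ _ fp fq False])
        (use YH(3) translate_invariant[OF YH(1) sc] DK(4) cofinite_subgraphD(1)[OF ZC] in auto)
    moreover have "edge_connected p q (?Z s)"
      by (rule intersection_connected[OF YHs conn DK(2) YK(2)])
    ultimately show ?thesis
      using generating_set_of_core[OF ZC _ _ fp fq False] by metis
  qed
  then obtain T where T: "\<And>s. s \<in> S \<Longrightarrow> T s \<subseteq> ?L s \<and> finite (T s) \<and> generate G (T s) = ?L s \<and>
      2 * (card (T s) - 1) \<le> weight p (?L s) (?Z s) + weight q (?L s) (?Z s)"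
    by metis
  let ?a = "weight p H YH" and ?b = "weight q H YH" and ?x = "weight p K YK" and ?y = "weight q K YK"
  have rearrange: "n * ((2 * u) * (2 * v)) = 2 * (2 * n * (u * v))" "d * (2 * u) = 2 * (d * u)" for u v :: nat
    by simp_all
  have "2 * (\<Sum>s \<in> S. card (T s) - 1) = (\<Sum>s \<in> S. 2 * (card (T s) - 1))"
    by (simp add: sum_distrib_left)
  also have "\<dots> \<le> (\<Sum>s \<in> S. weight p (?L s) (?Z s) + weight q (?L s) (?Z s))"
    using T by (intro sum_mono) blast
  finally have "d * (2 * (\<Sum>s \<in> S. card (T s) - 1))
      \<le> d * (\<Sum>s \<in> S. weight p (?L s) (?Z s)) + d * (\<Sum>s \<in> S. weight q (?L s) (?Z s))"
    by (simp only: sum.distrib add_mult_distrib2[symmetric] mult_le_mono2)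
  also have "\<dots> \<le> n * (?a * ?x) + n * (?b * ?y)"
  proof (rule add_mono)
    show "d * (\<Sum>s \<in> S. weight p (?L s) (?Z s)) \<le> n * (?a * ?x)"
      by (rule pullback_weight_bound[OF p_equiv YH(1) YK(1) fH(1) fK(1)])
        (erule YH(4), erule YK(4), rule S, rule S, erule (4) distinct, rule \<open>d \<le> n\<close>, erule (2) small)
    show "d * (\<Sum>s \<in> S. weight q (?L s) (?Z s)) \<le> n * (?b * ?y)"
      by (rule pullback_weight_bound[OF q_equiv YH(1) YK(1) fH(2) fK(2)])
        (erule YH(5), erule YK(5), rule S, rule S, erule (4) distinct, rule \<open>d \<le> n\<close>, erule (2) small)
  qed
  also have "\<dots> \<le> n * ((?a + ?b) * (?x + ?y))"
    by (simp add: algebra_simps)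
  also have "\<dots> \<le> n * ((2 * (card hs - 1)) * (2 * (card ks - 1)))"
    by (intro mult_le_mono YH YK order_refl)
  finally have "d * (\<Sum>s \<in> S. card (T s) - 1) \<le> 2 * n * ((card hs - 1) * (card ks - 1))"
    unfolding rearrange by simp
  then show thesis using that T by blast
qed

end

section \<open>Free products\<close>

text \<open>
  The condition under which a letter from the factor \<open>j\<close> can be put in front of the normal form \<open>w\<close> without
  merging.
\<close>

definition clear_of :: "'i \<Rightarrow> ('i \<times> 'a) list \<Rightarrow> bool" where
  "clear_of j w \<longleftrightarrow> w = [] \<or> fst (hd w) \<noteq> j"

locale group_family =
  fixes J :: "'i set" and A :: "'i \<Rightarrow> 'a monoid"
  assumes groups: "j \<in> J \<Longrightarrow> group (A j)"
begin

abbreviation "normal_forms \<equiv> normal_words J A"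

lemma Nil_normal [simp]: "[] \<in> normal_forms"
  by (simp add: normal_words_def)

lemma Cons_normal_iff:
  "(j, x) # w \<in> normal_forms \<longleftrightarrow>
    j \<in> J \<and> x \<in> carrier (A j) \<and> x \<noteq> \<one>\<^bsub>A j\<^esub> \<and> w \<in> normal_forms \<and> clear_of j w"
  by (cases w) (auto simp: normal_words_def clear_of_def)

lemma letter_append_normal:
  "\<lbrakk>w \<in> normal_forms; clear_of j w; j \<in> J; x \<in> carrier (A j)\<rbrakk> \<Longrightarrow> letter A j x @ w \<in> normal_forms"
  by (simp add: letter_def Cons_normal_iff)

text \<open>
  Splitting off the leading \<open>j\<close>-letter, possibly trivial, turns multiplication by elements of the factor \<open>j\<close>
  into multiplication within that factor; see \<open>prepend_letter\<close>.
\<close>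

lemma normal_cases:
  assumes "w \<in> normal_forms" "j \<in> J"
  obtains u v where "w = letter A j u @ v" "u \<in> carrier (A j)" "v \<in> normal_forms" "clear_of j v"
proof (cases "clear_of j w")
  case True
  interpret Aj: group "A j" using groups assms by blast
  show ?thesis
    by (rule that[of "\<one>\<^bsub>A j\<^esub>" w]) (use True assms in \<open>auto simp: letter_def\<close>)
next
  case False
  then obtain u v where "w = (j, u) # v"
    by (cases w) (auto simp: clear_of_def)
  then show ?thesis
    using that[of u v] assms by (auto simp: Cons_normal_iff letter_def)
qed

lemma prepend_letter:
  assumes "w \<in> normal_forms" "clear_of j w" "j \<in> J" "x \<in> carrier (A j)" "u \<in> carrier (A j)"
  shows "prepend A (j, x) (letter A j u @ w) = letter A j (x \<otimes>\<^bsub>A j\<^esub> u) @ w"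
proof -
  interpret Aj: group "A j" using groups assms by blast
  show ?thesis
    using assms by (cases w) (auto simp: letter_def clear_of_def)
qed

lemma prepend_normal:
  assumes "w \<in> normal_forms" "j \<in> J" "x \<in> carrier (A j)"
  shows "prepend A (j, x) w \<in> normal_forms"
proof -
  interpret Aj: group "A j" using groups assms by blast
  obtain u v where "w = letter A j u @ v" "u \<in> carrier (A j)" "v \<in> normal_forms" "clear_of j v"
    using normal_cases assms(1,2) by blast
  then show ?thesis
    using assms by (simp add: prepend_letter letter_append_normal)
qed

lemma prepend_one:
  assumes "w \<in> normal_forms" "j \<in> J"
  shows "prepend A (j, \<one>\<^bsub>A j\<^esub>) w = w"
proof -
  interpret Aj: group "A j" using groups assms by blast
  obtain u v where "w = letter A j u @ v" "u \<in> carrier (A j)" "v \<in> normal_forms" "clear_of j v"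
    using normal_cases assms by blast
  then show ?thesis using assms by (simp add: prepend_letter)
qed

lemma prepend_mult:
  assumes "w \<in> normal_forms" "j \<in> J" "x \<in> carrier (A j)" "y \<in> carrier (A j)"
  shows "prepend A (j, x \<otimes>\<^bsub>A j\<^esub> y) w = prepend A (j, x) (prepend A (j, y) w)"
proof -
  interpret Aj: group "A j" using groups assms by blast
  obtain u v where "w = letter A j u @ v" "u \<in> carrier (A j)" "v \<in> normal_forms" "clear_of j v"
    using normal_cases assms(1,2) by blast
  then show ?thesis using assms by (simp add: prepend_letter Aj.m_assoc)
qed

lemma prepend_inv:
  assumes "w \<in> normal_forms" "j \<in> J" "x \<in> carrier (A j)"
  shows "prepend A (j, inv\<^bsub>A j\<^esub> x) (prepend A (j, x) w) = w"
    and "prepend A (j, x) (prepend A (j, inv\<^bsub>A j\<^esub> x) w) = w"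
proof -
  interpret Aj: group "A j" using groups assms by blast
  show "prepend A (j, inv\<^bsub>A j\<^esub> x) (prepend A (j, x) w) = w"
    using assms prepend_mult[of w j "inv\<^bsub>A j\<^esub> x" x] prepend_one by simp
  show "prepend A (j, x) (prepend A (j, inv\<^bsub>A j\<^esub> x) w) = w"
    using assms prepend_mult[of w j x "inv\<^bsub>A j\<^esub> x"] prepend_one by simp
qed

lemma prepend_Cons_normal: "(j, x) # w \<in> normal_forms \<Longrightarrow> prepend A (j, x) w = (j, x) # w"
  by (cases w) (auto simp: Cons_normal_iff letter_def clear_of_def)

abbreviation product_group :: "('i \<times> 'a) list monoid" where "product_group \<equiv> free_product J A"

lemma product_simps [simp]:
  "carrier product_group = normal_forms" "\<one>\<^bsub>product_group\<^esub> = []" "u \<otimes>\<^bsub>product_group\<^esub> v = foldr (prepend A) u v"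
  by (simp_all add: free_product_def)

lemma foldr_normal: "\<lbrakk>u \<in> normal_forms; v \<in> normal_forms\<rbrakk> \<Longrightarrow> foldr (prepend A) u v \<in> normal_forms"
  by (induction u) (auto simp: Cons_normal_iff prepend_normal)

lemma foldr_letter:
  assumes "w \<in> normal_forms" "j \<in> J"
  shows "foldr (prepend A) (letter A j x) w = prepend A (j, x) w"
  using prepend_one[OF assms] by (simp add: letter_def)

lemma foldr_prepend:
  assumes "v \<in> normal_forms" "w \<in> normal_forms" "j \<in> J" "x \<in> carrier (A j)"
  shows "foldr (prepend A) (prepend A (j, x) v) w = prepend A (j, x) (foldr (prepend A) v w)"
proof -
  interpret Aj: group "A j" using groups assms by blast
  obtain u v' where v: "v = letter A j u @ v'" "u \<in> carrier (A j)" "v' \<in> normal_forms" "clear_of j v'"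
    using normal_cases assms(1,3) by blast
  then show ?thesis
    using assms by (simp add: prepend_letter foldr_letter foldr_normal prepend_mult)
qed

lemma foldr_assoc:
  "\<lbrakk>u \<in> normal_forms; v \<in> normal_forms; w \<in> normal_forms\<rbrakk> \<Longrightarrow>
    foldr (prepend A) (foldr (prepend A) u v) w = foldr (prepend A) u (foldr (prepend A) v w)"
  by (induction u) (auto simp: Cons_normal_iff foldr_prepend foldr_normal)

lemma foldr_Nil: "u \<in> normal_forms \<Longrightarrow> foldr (prepend A) u [] = u"
proof (induction u)
  case (Cons a u)
  then show ?case
    by (cases a) (simp add: prepend_Cons_normal Cons_normal_iff)
qed simp

lemma ex_left_inverse: "u \<in> normal_forms \<Longrightarrow> \<exists>v \<in> normal_forms. foldr (prepend A) v u = []"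
proof (induction u)
  case (Cons a u)
  obtain j x where a: "a = (j, x)" by (cases a)
  then have ju: "j \<in> J" "x \<in> carrier (A j)" "u \<in> normal_forms" using Cons.prems by (auto simp: Cons_normal_iff)
  interpret Aj: group "A j" using groups ju by blast
  obtain v where v: "v \<in> normal_forms" "foldr (prepend A) v u = []" using Cons.IH ju by blast
  let ?l = "letter A j (inv\<^bsub>A j\<^esub> x)"
  have l: "?l \<in> normal_forms" using ju letter_append_normal[of "[]" j "inv\<^bsub>A j\<^esub> x"] by (simp add: clear_of_def)
  have "foldr (prepend A) (foldr (prepend A) v ?l) (a # u)
      = foldr (prepend A) v (prepend A (j, inv\<^bsub>A j\<^esub> x) (prepend A (j, x) u))"
    using foldr_assoc[OF v(1) l Cons.prems] foldr_letter[OF Cons.prems ju(1)] prepend_Cons_normal Cons.prems a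
    by simp
  then show ?case
    using v l foldr_normal prepend_inv(1) ju by metis
qed (simp add: bexI[of _ "[]"])

lemma group_product: "group product_group"
  by (rule groupI) (simp_all add: foldr_normal foldr_assoc ex_left_inverse)

lemma letter_normal: "\<lbrakk>j \<in> J; x \<in> carrier (A j)\<rbrakk> \<Longrightarrow> letter A j x \<in> normal_forms"
  using letter_append_normal[of "[]" j x] by (simp add: clear_of_def)

end

section \<open>Potentials on a free group\<close>

context
  fixes F :: "'a monoid" and X :: "'a set" and k :: "'a \<Rightarrow> 'a \<Rightarrow> bool"
  assumes F: "group F" and basis: "is_basis F X"
begin

interpretation F: group F by (rule F)

text \<open>
  The sum of the values of \<open>k\<close> along the path in the Cayley graph of \<open>F\<close> that starts at \<open>v\<close> and follows the
  word \<open>w\<close> from right to left, an edge \<open>(x, u)\<close> leading from \<open>u\<close> to \<open>x \<otimes> u\<close>.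
\<close>

fun path_sum :: "('a \<times> bool) list \<Rightarrow> 'a \<Rightarrow> bool" where
  "path_sum [] v = False"
| "path_sum ((x, b) # w) v = (path_sum w v \<noteq>
    k x (if b then word_value F w \<otimes>\<^bsub>F\<^esub> v else inv\<^bsub>F\<^esub> x \<otimes>\<^bsub>F\<^esub> (word_value F w \<otimes>\<^bsub>F\<^esub> v)))"

lemma X_carrier: "x \<in> X \<Longrightarrow> x \<in> carrier F"
  using basis by (auto simp: is_basis_def)

lemma word_value_Nil: "word_value F [] = \<one>\<^bsub>F\<^esub>"
  by (simp add: word_value_def)

lemma word_value_Cons:
  "word_value F ((x, b) # w) = (if b then x else inv\<^bsub>F\<^esub> x) \<otimes>\<^bsub>F\<^esub> word_value F w"
  by (simp add: word_value_def)

lemma word_value_closed: "w \<in> lists (X \<times> UNIV) \<Longrightarrow> word_value F w \<in> carrier F"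
  by (induction w) (auto simp: word_value_Nil word_value_Cons X_carrier)

lemma word_value_append:
  "\<lbrakk>u \<in> lists (X \<times> UNIV); w \<in> lists (X \<times> UNIV)\<rbrakk> \<Longrightarrow>
    word_value F (u @ w) = word_value F u \<otimes>\<^bsub>F\<^esub> word_value F w"
proof (induction u)
  case (Cons a u)
  obtain x b where a: "a = (x, b)" by (cases a)
  have "x \<in> carrier F" "u \<in> lists (X \<times> UNIV)"
    using Cons.prems(1) X_carrier by (auto simp: a)
  then show ?case
    using Cons word_value_closed[of u] word_value_closed[of w]
    by (cases b) (simp_all add: a word_value_Cons F.m_assoc del: in_lists_conv_set)
qed (simp add: word_value_Nil word_value_closed del: in_lists_conv_set)

lemma path_sum_append:
  "\<lbrakk>u \<in> lists (X \<times> UNIV); w \<in> lists (X \<times> UNIV); v \<in> carrier F\<rbrakk> \<Longrightarrow>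
    path_sum (u @ w) v = (path_sum w v \<noteq> path_sum u (word_value F w \<otimes>\<^bsub>F\<^esub> v))"
proof (induction u)
  case (Cons a u)
  obtain x b where a: "a = (x, b)" by (cases a)
  have "word_value F (u @ w) \<otimes>\<^bsub>F\<^esub> v = word_value F u \<otimes>\<^bsub>F\<^esub> (word_value F w \<otimes>\<^bsub>F\<^esub> v)"
    using Cons.prems by (simp add: word_value_append word_value_closed F.m_assoc)
  then show ?case using Cons by (auto simp: a)
qed simp

lemma not_reduced_split:
  "\<not> reduced_word w \<Longrightarrow> \<exists>u x b v. w = u @ [(x, b), (x, \<not> b)] @ v"
proof (induction w)
  case (Cons a w)
  show ?case
  proof (cases "reduced_word w")
    case True
    then obtain x b c v where "a = (x, b)" "w = (x, c) # v" "b \<noteq> c"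
      using Cons.prems by (cases a; cases w) (auto simp: reduced_word_def)
    then have "a # w = [] @ [(x, b), (x, \<not> b)] @ v" by auto
    then show ?thesis by blast
  next
    case False
    then obtain u x b v where "w = u @ [(x, b), (x, \<not> b)] @ v" using Cons.IH by blast
    then have "a # w = (a # u) @ [(x, b), (x, \<not> b)] @ v" by simp
    then show ?thesis by blast
  qed
qed (simp add: reduced_word_def)

text \<open>
  A nonempty word with trivial value is not reduced, because \<open>X\<close> is a basis; a cancelling pair of letters traverses
  one edge back and forth and can be deleted.
\<close>

lemma path_sum_closed_path:
  "\<lbrakk>w \<in> lists (X \<times> UNIV); v \<in> carrier F; word_value F w = \<one>\<^bsub>F\<^esub>\<rbrakk> \<Longrightarrow> \<not> path_sum w v"
proof (induction "length w" arbitrary: w rule: less_induct)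
  case less
  show ?case
  proof (cases "w = []")
    case False
    then have "\<not> reduced_word w" using basis less.prems by (auto simp: is_basis_def)
    then obtain u x b z where w: "w = u @ [(x, b), (x, \<not> b)] @ z" using not_reduced_split by blast
    let ?c = "[(x, b), (x, \<not> b)]"
    have l: "u \<in> lists (X \<times> UNIV)" "z \<in> lists (X \<times> UNIV)" "?c \<in> lists (X \<times> UNIV)" "x \<in> carrier F"
      using less.prems(1) X_carrier by (auto simp: w)
    have c1: "word_value F ?c = \<one>\<^bsub>F\<^esub>"
      using l by (cases b) (auto simp: word_value_Nil word_value_Cons)
    have c2: "\<not> path_sum ?c y" if "y \<in> carrier F" for y
      using l that by (cases b) (auto simp: word_value_Nil word_value_Cons F.m_assoc[symmetric])
    have uz: "u @ z \<in> lists (X \<times> UNIV)" using l by auto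
    have cz: "word_value F (?c @ z) = word_value F z"
      using l c1 by (simp only: word_value_append[OF l(3,2)] word_value_closed F.l_one)
    have "word_value F (u @ z) = word_value F w"
      unfolding w using l word_value_append[OF l(1), of "?c @ z"] cz word_value_append[OF l(1,2)]
      by (simp add: append_in_lists_conv)
    then have "\<not> path_sum (u @ z) v"
      using less.hyps[of "u @ z"] less.prems uz by (simp add: w)
    moreover have "path_sum w v = path_sum (u @ z) v"
    proof -
      have "?c @ z \<in> lists (X \<times> UNIV)" using l by simp
      then have "path_sum w v = (path_sum (?c @ z) v \<noteq> path_sum u (word_value F z \<otimes>\<^bsub>F\<^esub> v))"
        unfolding w using path_sum_append[OF l(1) _ less.prems(2)] cz by metis
      moreover have "path_sum (?c @ z) v = path_sum z v"
        using path_sum_append[OF l(3,2) less.prems(2)] c2 word_value_closed[OF l(2)] less.prems(2) by simp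
      moreover have "path_sum (u @ z) v = (path_sum z v \<noteq> path_sum u (word_value F z \<otimes>\<^bsub>F\<^esub> v))"
        using path_sum_append[OF l(1,2) less.prems(2)] .
      ultimately show ?thesis by simp
    qed
    ultimately show ?thesis by simp
  qed simp
qed

lemma ex_inverse_word:
  "w \<in> lists (X \<times> UNIV) \<Longrightarrow>
    \<exists>w' \<in> lists (X \<times> UNIV). word_value F w' \<otimes>\<^bsub>F\<^esub> word_value F w = \<one>\<^bsub>F\<^esub>"
proof (induction w)
  case (Cons a w)
  obtain x b where a: "a = (x, b)" by (cases a)
  have x: "x \<in> X" "w \<in> lists (X \<times> UNIV)" using Cons.prems by (auto simp: a)
  obtain w' where w': "w' \<in> lists (X \<times> UNIV)" "word_value F w' \<otimes>\<^bsub>F\<^esub> word_value F w = \<one>\<^bsub>F\<^esub>"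
    using Cons.IH x by blast
  let ?s = "[(x, \<not> b)]"
  have s: "?s \<in> lists (X \<times> UNIV)" using x by simp
  have c: "x \<in> carrier F" "word_value F w \<in> carrier F" "word_value F w' \<in> carrier F"
    using x w' X_carrier word_value_closed by auto
  have "word_value F ?s \<otimes>\<^bsub>F\<^esub> word_value F (a # w) = word_value F w"
    using c by (cases b) (simp_all add: a word_value_Nil word_value_Cons F.m_assoc[symmetric])
  then have "word_value F (w' @ ?s) \<otimes>\<^bsub>F\<^esub> word_value F (a # w) = \<one>\<^bsub>F\<^esub>"
    using word_value_append[OF w'(1) s] w'(2) c word_value_closed[OF s] word_value_closed[OF Cons.prems]
    by (simp add: F.m_assoc)
  moreover have "w' @ ?s \<in> lists (X \<times> UNIV)" using w' s by simp
  ultimately show ?case by blast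
qed (auto simp: word_value_Nil intro!: bexI[of _ "[]"])

lemma ex_word_value: "u \<in> carrier F \<Longrightarrow> \<exists>w \<in> lists (X \<times> UNIV). word_value F w = u"
proof -
  assume "u \<in> carrier F"
  then have "u \<in> generate F X" using basis by (simp add: is_basis_def)
  then show ?thesis
  proof (induction rule: generate.induct)
    case one
    then show ?case by (intro bexI[of _ "[]"]) (auto simp: word_value_Nil)
  next
    case (incl x)
    then show ?case
      using X_carrier by (intro bexI[of _ "[(x, True)]"]) (auto simp: word_value_Nil word_value_Cons)
  next
    case (inv x)
    then show ?case
      using X_carrier by (intro bexI[of _ "[(x, False)]"]) (auto simp: word_value_Nil word_value_Cons)
  next
    case (eng u v)
    then obtain w w' where "w \<in> lists (X \<times> UNIV)" "w' \<in> lists (X \<times> UNIV)"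
      "word_value F w = u" "word_value F w' = v" by blast
    then show ?case
      using word_value_append by (intro bexI[of _ "w @ w'"]) auto
  qed
qed

text \<open>
  The Cayley graph of a free group is a tree: an edge labelling has a potential, its sum along any word
  that represents the end point.
\<close>

lemma free_group_potential:
  obtains C where "\<not> C \<one>\<^bsub>F\<^esub>" "\<And>x u. \<lbrakk>x \<in> X; u \<in> carrier F\<rbrakk> \<Longrightarrow> C (x \<otimes>\<^bsub>F\<^esub> u) = (C u \<noteq> k x u)"
proof -
  have well_def: "path_sum w \<one>\<^bsub>F\<^esub> = path_sum w' \<one>\<^bsub>F\<^esub>"
    if w: "w \<in> lists (X \<times> UNIV)" "w' \<in> lists (X \<times> UNIV)" and eq: "word_value F w = word_value F w'" for w w'
  proof -
    obtain i where i: "i \<in> lists (X \<times> UNIV)" "word_value F i \<otimes>\<^bsub>F\<^esub> word_value F w = \<one>\<^bsub>F\<^esub>"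
      using ex_inverse_word w by blast
    have "\<not> path_sum (i @ w) \<one>\<^bsub>F\<^esub>" "\<not> path_sum (i @ w') \<one>\<^bsub>F\<^esub>"
      using path_sum_closed_path i w eq word_value_append by auto
    then show ?thesis
      using path_sum_append[OF i(1) w(1)] path_sum_append[OF i(1) w(2)] eq by simp
  qed
  define W where "W = (\<lambda>u. SOME w. w \<in> lists (X \<times> UNIV) \<and> word_value F w = u)"
  have W: "W u \<in> lists (X \<times> UNIV) \<and> word_value F (W u) = u" if "u \<in> carrier F" for u
    unfolding W_def by (rule someI_ex) (use ex_word_value[OF that] in blast)
  show thesis
  proof (rule that[of "\<lambda>u. path_sum (W u) \<one>\<^bsub>F\<^esub>"])
    show "\<not> path_sum (W \<one>\<^bsub>F\<^esub>) \<one>\<^bsub>F\<^esub>"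
      using path_sum_closed_path W by simp
  next
    fix x u assume x: "x \<in> X" and u: "u \<in> carrier F"
    let ?w = "(x, True) # W u"
    have "path_sum (W (x \<otimes>\<^bsub>F\<^esub> u)) \<one>\<^bsub>F\<^esub> = path_sum ?w \<one>\<^bsub>F\<^esub>"
      by (rule well_def) (use x u W X_carrier in \<open>auto simp: word_value_Cons\<close>)
    then show "path_sum (W (x \<otimes>\<^bsub>F\<^esub> u)) \<one>\<^bsub>F\<^esub> = (path_sum (W u) \<one>\<^bsub>F\<^esub> \<noteq> k x u)"
      using W[OF u] u by simp
  qed
qed

end

section \<open>The tree of a free product\<close>

locale free_product_with_free_factor = group_family "insert None (Some ` I)" A
  for I :: "'i set" and A :: "'i option \<Rightarrow> 'a monoid" +
  fixes X :: "'a set"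
  assumes basis: "is_basis (A None) X"
begin

lemma X_carrier: "x \<in> X \<Longrightarrow> x \<in> carrier (A None)"
  using basis by (auto simp: is_basis_def)

text \<open>
  The edge \<open>(g, Inl i)\<close> joins \<open>g\<close> to the coset \<open>G\<^sub>i g\<close>. The edges \<open>(g, Inr (x, True))\<close> and
  \<open>(g, Inr (x, False))\<close> join \<open>g\<close> to the midpoints of the Cayley graph edges from \<open>g\<close> to \<open>x g\<close> and from
  the element \<open>inv x\<close> times \<open>g\<close> to \<open>g\<close>. Subdividing the latter edges makes the tree bipartite.
\<close>

definition edges :: "(('i option \<times> 'a) list \<times> ('i + 'a \<times> bool)) set" where
  "edges = normal_forms \<times> (Inl ` I \<union> Inr ` (X \<times> UNIV))"

fun move :: "('i option \<times> 'a) list \<times> ('i + 'a \<times> bool) \<Rightarrow> ('i option \<times> 'a) list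
    \<Rightarrow> ('i option \<times> 'a) list \<times> ('i + 'a \<times> bool)" where
  "move (g, c) h = (foldr (prepend A) g h, c)"

definition coset :: "'i \<Rightarrow> ('i option \<times> 'a) list \<Rightarrow> ('i option \<times> 'a) list set" where
  "coset i g = (\<lambda>a. prepend A (Some i, a) g) ` carrier (A (Some i))"

fun target :: "('i option \<times> 'a) list \<times> ('i + 'a \<times> bool) \<Rightarrow>
    ('i \<times> ('i option \<times> 'a) list set) + ('a \<times> ('i option \<times> 'a) list)" where
  "target (g, Inl i) = Inl (i, coset i g)"
| "target (g, Inr (x, b)) = Inr (x, if b then g else prepend A (None, inv\<^bsub>A None\<^esub> x) g)"

lemma coset_eq:
  assumes "w \<in> normal_forms" "clear_of (Some i) w" "i \<in> I" "u \<in> carrier (A (Some i))"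
  shows "coset i (letter A (Some i) u @ w) = (\<lambda>a. letter A (Some i) a @ w) ` carrier (A (Some i))"
proof -
  interpret Ai: group "A (Some i)" using groups assms by blast
  have "coset i (letter A (Some i) u @ w) = (\<lambda>a. letter A (Some i) (a \<otimes>\<^bsub>A (Some i)\<^esub> u) @ w) ` carrier (A (Some i))"
    unfolding coset_def using assms by (intro image_cong) (simp_all add: prepend_letter)
  also have "\<dots> = (\<lambda>a. letter A (Some i) a @ w) ` ((\<lambda>a. a \<otimes>\<^bsub>A (Some i)\<^esub> u) ` carrier (A (Some i)))"
    by (simp add: image_image)
  also have "(\<lambda>a. a \<otimes>\<^bsub>A (Some i)\<^esub> u) ` carrier (A (Some i)) = carrier (A (Some i))"
  proof (intro equalityI subsetI)
    fix a assume "a \<in> carrier (A (Some i))"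
    then have "a = (a \<otimes>\<^bsub>A (Some i)\<^esub> inv\<^bsub>A (Some i)\<^esub> u) \<otimes>\<^bsub>A (Some i)\<^esub> u"
      using assms by (simp add: Ai.m_assoc)
    then show "a \<in> (\<lambda>a. a \<otimes>\<^bsub>A (Some i)\<^esub> u) ` carrier (A (Some i))"
      using assms \<open>a \<in> carrier (A (Some i))\<close> by blast
  qed (use assms in auto)
  finally show ?thesis .
qed

lemma coset_prepend:
  assumes "g \<in> normal_forms" "i \<in> I" "a \<in> carrier (A (Some i))"
  shows "coset i (prepend A (Some i, a) g) = coset i g"
proof -
  interpret Ai: group "A (Some i)" using groups assms by blast
  obtain u w where "g = letter A (Some i) u @ w" "u \<in> carrier (A (Some i))" "w \<in> normal_forms" "clear_of (Some i) w"
    using normal_cases[OF assms(1), of "Some i"] assms(2) by blast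
  then show ?thesis using assms by (simp add: prepend_letter coset_eq)
qed

lemma mem_coset: "\<lbrakk>g \<in> normal_forms; i \<in> I\<rbrakk> \<Longrightarrow> g \<in> coset i g"
  unfolding coset_def
  by (rule image_eqI[of _ _ "\<one>\<^bsub>A (Some i)\<^esub>"])
    (simp_all add: prepend_one groups group.is_monoid monoid.one_closed)

lemma coset_mult:
  assumes "g \<in> normal_forms" "h \<in> normal_forms" "i \<in> I"
  shows "coset i (foldr (prepend A) g h) = (\<lambda>z. foldr (prepend A) z h) ` coset i g"
  unfolding coset_def image_image using assms by (intro image_cong) (simp_all add: foldr_prepend)

sublocale free_action product_group edges move
proof (intro free_action.intro group_product free_action_axioms.intro)
  fix e g h
  show "move e g \<in> edges" if "e \<in> edges" "g \<in> carrier product_group"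
    using that foldr_normal by (auto simp: edges_def)
  show "move e \<one>\<^bsub>product_group\<^esub> = e" if "e \<in> edges"
    using that by (auto simp: edges_def foldr_Nil)
  show "move e (g \<otimes>\<^bsub>product_group\<^esub> h) = move (move e g) h" if "e \<in> edges" "g \<in> carrier product_group" "h \<in> carrier product_group"
    using that by (auto simp: edges_def foldr_assoc)
  show "g = \<one>\<^bsub>product_group\<^esub>" if e: "e \<in> edges" and "g \<in> carrier product_group" "move e g = e"
  proof -
    obtain u c where "e = (u, c)" "u \<in> normal_forms" using e by (auto simp: edges_def)
    then have "u \<otimes>\<^bsub>product_group\<^esub> g = u" "u \<in> carrier product_group" using that by auto
    then show ?thesis using group.l_cancel_one[OF group_product, of u g] that by simp
  qed
qed

lemma inv_basis_closed: "x \<in> X \<Longrightarrow> inv\<^bsub>A None\<^esub> x \<in> carrier (A None)"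
  using groups X_carrier by (simp add: group.inv_closed)

lemma equivariant_fst: "equivariant fst"
  unfolding equivariant_def by (auto simp: edges_def)

lemma equivariant_target: "equivariant target"
  unfolding equivariant_def
proof (intro ballI impI)
  fix e e' h assume e: "e \<in> edges" "e' \<in> edges" and h: "h \<in> carrier product_group" and eq: "target e = target e'"
  have inl: "target (move (g, Inl i) h) = Inl (i, (\<lambda>z. foldr (prepend A) z h) ` coset i g)"
    if "g \<in> normal_forms" "i \<in> I" for g i
    using that h by (simp add: coset_mult)
  have inr: "target (move (g, Inr (x, b)) h)
      = Inr (x, foldr (prepend A) (if b then g else prepend A (None, inv\<^bsub>A None\<^esub> x) g) h)"
    if "g \<in> normal_forms" "x \<in> X" for g x b
    using that h inv_basis_closed by (simp add: foldr_prepend)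
  obtain g c g' c' where ec: "e = (g, c)" "e' = (g', c')" by (cases e, cases e')
  show "target (move e h) = target (move e' h)"
  proof (cases c)
    case (Inl i)
    then obtain i' where c': "c' = Inl i'" using eq e ec by (cases c') auto
    then have "i' = i" "coset i g = coset i g'" using eq Inl ec by auto
    moreover have "g \<in> normal_forms" "g' \<in> normal_forms" "i \<in> I" using e ec Inl by (auto simp: edges_def)
    ultimately show ?thesis unfolding ec Inl c' by (simp only: inl)
  next
    case (Inr xb)
    obtain x b where xb: "xb = (x, b)" by (cases xb)
    obtain x' b' where c': "c' = Inr (x', b')" using eq e ec Inr xb by (cases c') auto
    have same: "x' = x" "(if b then g else prepend A (None, inv\<^bsub>A None\<^esub> x) g) =
        (if b' then g' else prepend A (None, inv\<^bsub>A None\<^esub> x) g')"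
      using eq Inr xb c' ec by auto
    have mem: "g \<in> normal_forms" "g' \<in> normal_forms" "x \<in> X" using e ec Inr xb by (auto simp: edges_def)
    show ?thesis
      unfolding ec Inr xb c' same(1) inr[OF mem(1,3)] inr[OF mem(2,3)] same(2) ..
  qed
qed

lemma edges_connected: "edge_connected fst target edges"
proof (rule edge_connectedI)
  fix P :: "('i option \<times> 'a) list \<times> ('i + 'a \<times> bool) \<Rightarrow> bool" and e e'
  assume Ps: "\<And>x y. \<lbrakk>x \<in> edges; y \<in> edges; fst x = fst y\<rbrakk> \<Longrightarrow> P x = P y"
    and Pt: "\<And>x y. \<lbrakk>x \<in> edges; y \<in> edges; target x = target y\<rbrakk> \<Longrightarrow> P x = P y"
    and e: "e \<in> edges" "e' \<in> edges"
  define c0 where "c0 = snd e"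
  have c0: "(g, c0) \<in> edges" if "g \<in> normal_forms" for g
    using e that by (auto simp: edges_def c0_def)
  define Q where "Q = (\<lambda>g. P (g, c0))"
  have PQ: "P (g, c) = Q g" if "(g, c) \<in> edges" for g c
    unfolding Q_def by (rule Ps[OF that c0]) (use that in \<open>auto simp: edges_def\<close>)
  have factor: "Q (prepend A (Some i, a) g) = Q g" if "g \<in> normal_forms" "i \<in> I" "a \<in> carrier (A (Some i))" for g i a
  proof -
    have g': "prepend A (Some i, a) g \<in> normal_forms" using that by (simp add: prepend_normal)
    then have mem: "(prepend A (Some i, a) g, Inl i) \<in> edges" "(g, Inl i) \<in> edges"
      using that by (auto simp: edges_def)
    have "P (prepend A (Some i, a) g, Inl i) = P (g, Inl i)"
      by (rule Pt[OF mem]) (use that coset_prepend in simp)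
    then show ?thesis using PQ[OF mem(1)] PQ[OF mem(2)] by simp
  qed
  have basis_step: "Q (prepend A (None, x) g) = Q g" if "g \<in> normal_forms" "x \<in> X" for g x
  proof -
    have x: "x \<in> carrier (A None)" using X_carrier that by blast
    have g': "prepend A (None, x) g \<in> normal_forms" using that x by (simp add: prepend_normal)
    then have mem: "(prepend A (None, x) g, Inr (x, False)) \<in> edges" "(g, Inr (x, True)) \<in> edges"
      using that by (auto simp: edges_def)
    have "P (prepend A (None, x) g, Inr (x, False)) = P (g, Inr (x, True))"
      by (rule Pt[OF mem]) (use that x prepend_inv in simp)
    then show ?thesis using PQ[OF mem(1)] PQ[OF mem(2)] by simp
  qed
  interpret F: group "A None" using groups by blast
  have free: "Q (prepend A (None, u) g) = Q g" if "u \<in> carrier (A None)" "g \<in> normal_forms" for u g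
  proof -
    have "u \<in> generate (A None) X" using that basis by (simp add: is_basis_def)
    then have "u \<in> carrier (A None) \<and> (\<forall>g \<in> normal_forms. Q (prepend A (None, u) g) = Q g)"
    proof (induction rule: generate.induct)
      case one
      then show ?case by (simp add: prepend_one)
    next
      case (incl x)
      then show ?case using X_carrier basis_step by blast
    next
      case (inv x)
      then have x: "x \<in> carrier (A None)" using X_carrier by blast
      have "Q (prepend A (None, inv\<^bsub>A None\<^esub> x) g) = Q g" if "g \<in> normal_forms" for g
        using basis_step[OF prepend_normal[OF that _ F.inv_closed[OF x]] inv] prepend_inv(2)[OF that _ x] by simp
      then show ?case using x by simp
    next
      case (eng u v)
      then show ?case by (simp add: prepend_mult prepend_normal)
    qed
    then show ?thesis using that by blast
  qed
  have all: "Q g = Q []" if "g \<in> normal_forms" for g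
    using that
  proof (induction g)
    case (Cons a g)
    obtain j x where a: "a = (j, x)" by (cases a)
    have jx: "j \<in> insert None (Some ` I)" "x \<in> carrier (A j)" "g \<in> normal_forms"
      using Cons.prems by (auto simp: a Cons_normal_iff)
    have "Q (a # g) = Q (prepend A (j, x) g)"
      using prepend_Cons_normal Cons.prems by (simp add: a)
    also have "\<dots> = Q g" using jx factor free by auto
    finally show ?case using Cons.IH jx by simp
  qed simp
  obtain g c g' c' where ec: "e = (g, c)" "e' = (g', c')" by (cases e, cases e')
  have "g \<in> normal_forms" "g' \<in> normal_forms" using e ec by (auto simp: edges_def)
  then have "Q g = Q g'" using all by metis
  then show "P e = P e'" using PQ e unfolding ec by blast
qed

text \<open>
  A vertex labelling of the normal forms built up letter by letter; \<open>\<delta> j w u\<close> prescribes the change when the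
  letter \<open>(j, u)\<close> is put in front of \<open>w\<close>.
\<close>

primrec potential ::
  "('i option \<Rightarrow> ('i option \<times> 'a) list \<Rightarrow> 'a \<Rightarrow> bool) \<Rightarrow> ('i option \<times> 'a) list \<Rightarrow> bool" where
  "potential \<delta> [] = False"
| "potential \<delta> (a # w) = (potential \<delta> w \<noteq> \<delta> (fst a) w (snd a))"

text \<open>
  For a letter from \<open>G\<^sub>i\<close> the change of the potential is forced by the two edges through the coset vertex.
  For a letter from \<open>F\<close> the potential on the coset \<open>F w\<close> comes from \<open>free_group_potential\<close>, normalized at
  \<open>w\<close>. Uniqueness of normal forms makes the recursion consistent.
\<close>

lemma edges_coboundary:
  fixes f :: "('i option \<times> 'a) list \<times> ('i + 'a \<times> bool) \<Rightarrow> bool"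
  shows "\<exists>c d. \<forall>e \<in> edges. f e \<longleftrightarrow> c (fst e) \<noteq> (d (target e) :: bool)"
proof -
  interpret F: group "A None" using groups by blast
  define k where "k = (\<lambda>w x u. f (letter A None u @ w, Inr (x, True)) \<noteq>
    f (letter A None (x \<otimes>\<^bsub>A None\<^esub> u) @ w, Inr (x, False)))"
  have "\<exists>C. \<not> C \<one>\<^bsub>A None\<^esub> \<and> (\<forall>x \<in> X. \<forall>u \<in> carrier (A None). C (x \<otimes>\<^bsub>A None\<^esub> u) = (C u \<noteq> k w x u))" for w
    using free_group_potential[OF F.is_group basis, of "k w"] by metis
  then obtain C where C1: "\<And>w. \<not> C w \<one>\<^bsub>A None\<^esub>"
    and C: "\<And>w x u. \<lbrakk>x \<in> X; u \<in> carrier (A None)\<rbrakk> \<Longrightarrow> C w (x \<otimes>\<^bsub>A None\<^esub> u) = (C w u \<noteq> k w x u)"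
    by metis
  define \<delta> where "\<delta> = (\<lambda>j w u. case j of None \<Rightarrow> C w u
    | Some i \<Rightarrow> f (w, Inl i) \<noteq> f (letter A (Some i) u @ w, Inl i))"
  let ?c = "potential \<delta>"
  have c_letter: "?c (letter A j u @ w) = (?c w \<noteq> \<delta> j w u)" for j u w
    by (cases j) (auto simp: letter_def \<delta>_def C1)
  define d where "d = (\<lambda>v. case v of Inl (i, V) \<Rightarrow> (\<exists>g \<in> V. ?c g \<noteq> f (g, Inl i))
    | Inr (x, g) \<Rightarrow> ?c g \<noteq> f (g, Inr (x, True)))"
  have "f e \<longleftrightarrow> ?c (fst e) \<noteq> d (target e)" if e: "e \<in> edges" for e
  proof -
    obtain g c where ec: "e = (g, c)" "g \<in> normal_forms" using e by (auto simp: edges_def)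
    show ?thesis
    proof (cases c)
      case (Inl i)
      then have i: "i \<in> I" using e ec by (auto simp: edges_def)
      obtain u w where w: "g = letter A (Some i) u @ w" "u \<in> carrier (A (Some i))" "w \<in> normal_forms" "clear_of (Some i) w"
        using normal_cases[OF ec(2), of "Some i"] i by blast
      \<comment> \<open>The sum of potential and labelling does not depend on the edge at the coset vertex, and is its potential.\<close>
      have const: "(?c (letter A (Some i) a @ w) \<noteq> f (letter A (Some i) a @ w, Inl i)) = (?c w \<noteq> f (w, Inl i))" for a
        unfolding c_letter by (auto simp: \<delta>_def)
      have "d (target e) \<longleftrightarrow> (\<exists>a \<in> carrier (A (Some i)).
          ?c (letter A (Some i) a @ w) \<noteq> f (letter A (Some i) a @ w, Inl i))"
        unfolding ec(1) Inl d_def w(1) using coset_eq[OF w(3,4) i w(2)] by simp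
      also have "\<dots> \<longleftrightarrow> (?c g \<noteq> f (g, Inl i))"
        unfolding const unfolding w(1) const using w(2) by blast
      finally show ?thesis by (auto simp: ec Inl)
    next
      case (Inr xb)
      obtain x b where xb: "xb = (x, b)" by (cases xb)
      have x: "x \<in> X" using e ec Inr xb by (auto simp: edges_def)
      have xc: "x \<in> carrier (A None)" using X_carrier x by blast
      show ?thesis
      proof (cases b)
        case True
        then show ?thesis by (auto simp: ec Inr xb d_def)
      next
        case False
        let ?g' = "prepend A (None, inv\<^bsub>A None\<^esub> x) g"
        have g': "?g' \<in> normal_forms" using ec xc by (simp add: prepend_normal)
        obtain u w where w: "?g' = letter A None u @ w" "u \<in> carrier (A None)" "w \<in> normal_forms" "clear_of None w"
          using normal_cases[OF g', of None] by blast
        have "g = prepend A (None, x) ?g'"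
          using prepend_inv(2)[OF ec(2) _ xc] by simp
        also have "\<dots> = letter A None (x \<otimes>\<^bsub>A None\<^esub> u) @ w"
          unfolding w(1) using prepend_letter[OF w(3,4) _ xc w(2)] by simp
        finally have g: "g = letter A None (x \<otimes>\<^bsub>A None\<^esub> u) @ w" .
        have "?c g = (?c ?g' \<noteq> k w x u)"
          unfolding w(1) unfolding g c_letter using C[OF x w(2)] by (auto simp: \<delta>_def)
        moreover have "k w x u = (f (?g', Inr (x, True)) \<noteq> f (g, Inr (x, False)))"
          unfolding k_def w(1) unfolding g ..
        moreover have "d (target e) = (?c ?g' \<noteq> f (?g', Inr (x, True)))"
          by (simp add: ec Inr xb False d_def)
        ultimately show ?thesis by (auto simp: ec Inr xb False)
      qed
    qed
  qed
  then show ?thesis by blast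
qed

sublocale tree_action product_group edges move fst target
  by unfold_locales (fact equivariant_fst equivariant_target edges_connected edges_coboundary)+

lemma free_at_fst: "H \<subseteq> carrier product_group \<Longrightarrow> free_at fst H"
  unfolding free_at_def
proof (intro ballI impI)
  fix e h assume "H \<subseteq> carrier product_group" "e \<in> edges" "h \<in> H" "fst (move e h) = fst e"
  then have "move e h = e" by (cases e) simp
  then show "h = \<one>\<^bsub>product_group\<^esub>" using act_free \<open>e \<in> edges\<close> \<open>H \<subseteq> carrier product_group\<close> \<open>h \<in> H\<close> by blast
qed

text \<open>
  An element fixing the vertex \<open>G\<^sub>i g\<close> lies in the conjugate of \<open>G\<^sub>i\<close> by \<open>g\<close>, which meets \<open>H\<close> trivially.
\<close>

lemma free_at_target:
  assumes H: "H \<in> factor_free_subgroups product_group (Some ` I) A"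
  shows "free_at target H"
  unfolding free_at_def
proof (intro ballI impI)
  fix e h assume e: "e \<in> edges" and h: "h \<in> H" and eq: "target (move e h) = target e"
  have hN: "h \<in> normal_forms" using H h subgroup.subset by (fastforce simp: factor_free_subgroups_def)
  obtain g c where ec: "e = (g, c)" "g \<in> normal_forms" using e by (auto simp: edges_def)
  show "h = \<one>\<^bsub>product_group\<^esub>"
  proof (cases c)
    case (Inl i)
    then have i: "i \<in> I" using e ec by (auto simp: edges_def)
    have gh: "foldr (prepend A) g h \<in> normal_forms" using foldr_normal ec hN by blast
    have "coset i (foldr (prepend A) g h) = coset i g" using eq by (simp add: ec Inl)
    then have "foldr (prepend A) g h \<in> coset i g" using mem_coset[OF gh i] by simp
    then obtain a where a: "a \<in> carrier (A (Some i))" "foldr (prepend A) g h = prepend A (Some i, a) g"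
      by (auto simp: coset_def)
    let ?l = "letter A (Some i) a"
    have l: "?l \<in> carrier product_group" using letter_normal a i by simp
    have gc: "g \<in> carrier product_group" "h \<in> carrier product_group" using ec hN by auto
    have "g \<otimes>\<^bsub>product_group\<^esub> h = ?l \<otimes>\<^bsub>product_group\<^esub> g" using a foldr_letter[OF ec(2)] i by simp
    then have "h = inv\<^bsub>product_group\<^esub> g \<otimes>\<^bsub>product_group\<^esub> (?l \<otimes>\<^bsub>product_group\<^esub> g)"
      using inv_solve_left[OF gc(2,1) m_closed[OF l gc(1)]] by metis
    then have "h = inv\<^bsub>product_group\<^esub> g \<otimes>\<^bsub>product_group\<^esub> ?l \<otimes>\<^bsub>product_group\<^esub> g"
      using m_assoc[OF inv_closed[OF gc(1)] l gc(1)] by metis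
    moreover have "?l \<in> factor A (Some i)" using a by (simp add: factor_def)
    ultimately have "h \<in> conjugate product_group (factor A (Some i)) g"
      unfolding conjugate_def by blast
    moreover have "H \<inter> conjugate product_group (factor A (Some i)) g = {\<one>\<^bsub>product_group\<^esub>}"
      using H gc(1) i unfolding factor_free_subgroups_def by blast
    ultimately show ?thesis using h by blast
  next
    case (Inr xb)
    obtain x b where xb: "xb = (x, b)" by (cases xb)
    have x: "x \<in> X" using e ec Inr xb by (auto simp: edges_def)
    let ?g = "if b then g else prepend A (None, inv\<^bsub>A None\<^esub> x) g"
    have gN: "?g \<in> normal_forms" using inv_basis_closed[OF x] ec prepend_normal by simp
    have "foldr (prepend A) ?g h = ?g"
      using eq foldr_prepend[OF ec(2) hN _ inv_basis_closed[OF x]] by (auto simp: ec Inr xb split: if_splits)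
    then have "?g \<otimes>\<^bsub>product_group\<^esub> h = ?g" "?g \<in> carrier product_group" "h \<in> carrier product_group" using gN hN by auto
    then show ?thesis using l_cancel_one by blast
  qed
qed

end

section \<open>Ranks and double cosets\<close>

lemma Inf_enat_mem: "(M :: enat set) \<noteq> {} \<Longrightarrow> Inf M \<in> M"
  unfolding Inf_enat_def by (auto intro: LeastI)

context
  fixes G :: "'a monoid" (structure)
  assumes G: "group G"
begin

interpretation group G by (rule G)

lemma rank_attained:
  assumes H: "subgroup H G" and "fin_gen (G\<lparr>carrier := H\<rparr>)"
  obtains S where "finite S" "S \<subseteq> H" "generate G S = H" "group_rank (G\<lparr>carrier := H\<rparr>) = enat (card S)"
proof -
  let ?M = "{S. S \<subseteq> H \<and> generate (G\<lparr>carrier := H\<rparr>) S = H}"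
  have rank: "group_rank (G\<lparr>carrier := H\<rparr>) = Inf (ecard ` ?M)" by (simp add: group_rank_def)
  obtain S0 where S0: "S0 \<in> ?M" "finite S0" using assms(2) by (auto simp: fin_gen_def)
  then have "Inf (ecard ` ?M) \<in> ecard ` ?M" by (intro Inf_enat_mem) blast
  then obtain S where S: "S \<in> ?M" "Inf (ecard ` ?M) = ecard S" by blast
  have "ecard S \<le> ecard S0" unfolding S(2)[symmetric] using S0 by (intro INF_lower)
  then have "finite S" using S0 by (auto simp: ecard_def split: if_splits)
  moreover have "generate G S = H" using S generate_consistent[OF _ H, of S] by auto
  ultimately show thesis using that S rank by (auto simp: ecard_def)
qed

lemma reduced_rank_le:
  assumes L: "subgroup L G" and T: "T \<subseteq> L" "finite T" "generate G T = L"
  shows "reduced_rank (G\<lparr>carrier := L\<rparr>) \<le> enat (card T - 1)"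
proof -
  have "generate (G\<lparr>carrier := L\<rparr>) T = L" using generate_consistent[OF T(1) L] T(3) by simp
  then have "group_rank (G\<lparr>carrier := L\<rparr>) \<le> ecard T"
    unfolding group_rank_def using T by (intro INF_lower) simp
  then have "group_rank (G\<lparr>carrier := L\<rparr>) \<le> enat (card T)" using T by (simp add: ecard_def)
  then show ?thesis
    unfolding reduced_rank_def by (cases "group_rank (G\<lparr>carrier := L\<rparr>)") (auto simp: one_enat_def)
qed

text \<open>
  \<open>\<theta>\<close> is decreasing, so its value at the least order \<open>m\<close> of a subgroup with at least three elements, the
  fraction \<open>m / (m - 2)\<close>, bounds \<open>l / (l - 2)\<close> for the order \<open>l\<close> of any finite such subgroup. If there is
  none, \<open>n = d = 1\<close> will do.
\<close>

lemma theta_alpha3_eq: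
  obtains n d :: nat where "d \<le> n" "d > 0"
    "\<And>L. \<lbrakk>subgroup L G; finite L; card L \<ge> 3\<rbrakk> \<Longrightarrow> d * card L \<le> n * (card L - 2)"
    "theta (ennreal_of_enat (alpha3 G)) = ennreal (real n / real d)"
proof (cases "alpha3 G")
  case infinity
  have False if "subgroup L G" "finite L" "card L \<ge> 3" for L
  proof -
    have "ecard L \<ge> 3" using that by (simp add: ecard_def numeral_eq_enat)
    then have "alpha3 G \<le> ecard L" unfolding alpha3_def using that by (intro INF_lower) simp
    then show False using infinity that by (simp add: ecard_def)
  qed
  then show thesis
    by (intro that[of 1 1]) (auto simp: infinity theta_def)
next
  case (enat m)
  have "3 \<le> alpha3 G" unfolding alpha3_def by (rule INF_greatest) simp
  then have m: "m \<ge> 3" by (simp add: enat numeral_eq_enat)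
  have le: "m \<le> card L" if "subgroup L G" "finite L" "card L \<ge> 3" for L
  proof -
    have "ecard L \<ge> 3" using that by (simp add: ecard_def numeral_eq_enat)
    then have "alpha3 G \<le> ecard L" unfolding alpha3_def using that by (intro INF_lower) simp
    then show ?thesis using enat that by (simp add: ecard_def)
  qed
  have small: "(m - 2) * l \<le> m * (l - 2)" if "m \<le> l" for l
    using that by (simp add: diff_mult_distrib diff_mult_distrib2 diff_le_mono2)
  have "theta (ennreal_of_enat (alpha3 G)) = of_nat m / (of_nat m - 2)"
    by (simp add: theta_def enat)
  also have "(of_nat m :: ennreal) - 2 = of_nat (m - 2)"
    using m ennreal_minus[of 2 "real m"] by (simp add: ennreal_of_nat_eq_real_of_nat of_nat_diff)
  also have "of_nat m / (of_nat (m - 2) :: ennreal) = ennreal (real m / real (m - 2))"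
    using m by (simp add: ennreal_of_nat_eq_real_of_nat divide_ennreal)
  finally show thesis
    using m le small by (intro that[of "m - 2" m]) auto
qed

lemma double_coset_reps_unique:
  assumes S: "double_coset_reps G H K S" and H: "subgroup H G" and K: "subgroup K G"
    and "s \<in> S" "t \<in> S" "h \<in> H" "k \<in> K" "t = h \<otimes> s \<otimes> k"
  shows "s = t"
proof -
  have tc: "t \<in> carrier G" "s \<in> carrier G" using S assms by (auto simp: double_coset_reps_def)
  have hk: "h \<in> carrier G" "k \<in> carrier G" using assms H K by (auto dest: subgroup.mem_carrier)
  have "t = \<one> \<otimes> t \<otimes> \<one>" using tc by simp
  then have t: "t \<in> (H #> t) <#> K"
    unfolding r_coset_def set_mult_def using subgroup.one_closed[OF H] subgroup.one_closed[OF K] by blast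
  have "s = inv h \<otimes> t \<otimes> inv k"
    unfolding assms(8) using tc hk by (simp add: m_assoc) (simp add: m_assoc[symmetric])
  then have s: "s \<in> (H #> t) <#> K"
    unfolding r_coset_def set_mult_def
    using subgroup.m_inv_closed[OF H \<open>h \<in> H\<close>] subgroup.m_inv_closed[OF K \<open>k \<in> K\<close>] by blast
  have "\<exists>!x. x \<in> S \<and> x \<in> (H #> t) <#> K" using S tc by (simp add: double_coset_reps_def)
  then show ?thesis using s t assms by blast
qed

end

theorem theorem6p3:
  fixes I :: "'i set" and Gi :: "'i \<Rightarrow> 'a monoid" and F :: "'a monoid"
    and A :: "'i option \<Rightarrow> 'a monoid"
    and G :: "('i option \<times> 'a) list monoid"
    and \<F> :: "('i option \<times> 'a) list set set"
    and H K S :: "('i option \<times> 'a) list set"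
  assumes groups: "\<And>i. i \<in> I \<Longrightarrow> group (Gi i)"
    and free: "free_group F"
    and A_def: "A = case_option F Gi"
    and G_def: "G = free_product (insert None (Some ` I)) A"
    and \<F>_def: "\<F> = factor_free_subgroups G (Some ` I) A"
    and rank_ge_2: "\<exists>L \<in> \<F>. group_rank (G\<lparr>carrier := L\<rparr>) \<ge> 2"
    and H: "H \<in> \<F>"
    and K: "K \<in> \<F>"
    and S: "double_coset_reps G H K S"
  shows "(\<Sum>\<^sub>\<infinity>s\<in>S. ennreal_of_enat (reduced_rank (G\<lparr>carrier := conjugate G H s \<inter> K\<rparr>)))
    \<le> 2 * theta (ennreal_of_enat (alpha3 G))
        * ennreal_of_enat (reduced_rank (G\<lparr>carrier := H\<rparr>))
        * ennreal_of_enat (reduced_rank (G\<lparr>carrier := K\<rparr>))"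
proof -
  obtain X where F: "group F" and X: "is_basis F X" using free by (auto simp: free_group_def)
  interpret T: free_product_with_free_factor I A X
    using F X groups
    by (intro free_product_with_free_factor.intro group_family.intro
        free_product_with_free_factor_axioms.intro) (auto simp: A_def)
  interpret G: group G unfolding G_def by (rule T.group_product)
  have sub: "subgroup H G" "subgroup K G"
    and fg: "fin_gen (G\<lparr>carrier := H\<rparr>)" "fin_gen (G\<lparr>carrier := K\<rparr>)"
    using H K by (auto simp: \<F>_def factor_free_subgroups_def)
  obtain hs where hs: "finite hs" "hs \<subseteq> H" "generate G hs = H" "group_rank (G\<lparr>carrier := H\<rparr>) = enat (card hs)"
    using rank_attained[OF G.is_group sub(1) fg(1)] by blast
  obtain ks where ks: "finite ks" "ks \<subseteq> K" "generate G ks = K" "group_rank (G\<lparr>carrier := K\<rparr>) = enat (card ks)"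
    using rank_attained[OF G.is_group sub(2) fg(2)] by blast
  have rr: "reduced_rank (G\<lparr>carrier := H\<rparr>) = enat (card hs - 1)" "reduced_rank (G\<lparr>carrier := K\<rparr>) = enat (card ks - 1)"
    using hs(4) ks(4) by (simp_all add: reduced_rank_def one_enat_def)
  have SG: "S \<subseteq> carrier G" using S by (simp add: double_coset_reps_def)
  obtain n d :: nat where nd: "d \<le> n" "d > 0"
    "\<And>L. \<lbrakk>subgroup L G; finite L; card L \<ge> 3\<rbrakk> \<Longrightarrow> d * card L \<le> n * (card L - 2)"
    "theta (ennreal_of_enat (alpha3 G)) = ennreal (real n / real d)"
    by (rule theta_alpha3_eq[OF G.is_group]) (rule that)
  let ?L = "\<lambda>s. conjugate G H s \<inter> K"
  have subL: "subgroup (?L s) G" if "s \<in> S" for s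
    using G.subgroup_conjugate_Int[OF sub] SG that by blast
  have bound: "(\<Sum>s \<in> S0. ennreal_of_enat (reduced_rank (G\<lparr>carrier := ?L s\<rparr>)))
      \<le> 2 * theta (ennreal_of_enat (alpha3 G))
        * ennreal_of_enat (reduced_rank (G\<lparr>carrier := H\<rparr>))
        * ennreal_of_enat (reduced_rank (G\<lparr>carrier := K\<rparr>))"
    if S0: "finite S0" "S0 \<subseteq> S" for S0
  proof (cases "H = {\<one>\<^bsub>G\<^esub>} \<or> K = {\<one>\<^bsub>G\<^esub>}")
    case True
    have "ennreal_of_enat (reduced_rank (G\<lparr>carrier := ?L s\<rparr>)) = 0" if s: "s \<in> S0" for s
    proof -
      have sc: "s \<in> carrier G" using s S0 SG by blast
      have "?L s = {\<one>\<^bsub>G\<^esub>}"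
      proof
        show "?L s \<subseteq> {\<one>\<^bsub>G\<^esub>}" using True sc by (auto simp: conjugate_def)
        show "{\<one>\<^bsub>G\<^esub>} \<subseteq> ?L s" using subgroup.one_closed[OF subL[of s]] s S0 by blast
      qed
      then have "generate G {} = ?L s" using G.generate_empty by simp
      then have "reduced_rank (G\<lparr>carrier := ?L s\<rparr>) \<le> enat (card ({} :: ('i option \<times> 'a) list set) - 1)"
        using reduced_rank_le[OF G.is_group, of "?L s" "{}"] subL s S0 by blast
      then have "reduced_rank (G\<lparr>carrier := ?L s\<rparr>) = 0" by (simp add: zero_enat_def[symmetric])
      then show ?thesis by simp
    qed
    then show ?thesis by simp
  next
    case False
    have HG: "H \<subseteq> carrier G" "K \<subseteq> carrier G" using sub subgroup.subset by auto
    \<comment> \<open>If there were no edges, there would be neither factors \<open>Gi\<close> nor basis elements, and \<open>G\<close> would be trivial.\<close>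
    have edges: "T.edges \<noteq> {}"
    proof
      assume "T.edges = {}"
      moreover have "T.normal_forms \<noteq> {}" using T.Nil_normal by blast
      ultimately have empty: "I = {}" "X = {}" by (auto simp: T.edges_def)
      have "carrier F = {\<one>\<^bsub>F\<^esub>}"
        using X group.generate_empty[OF F] by (simp add: is_basis_def empty)
      then have "carrier (A None) = {\<one>\<^bsub>A None\<^esub>}" by (simp add: A_def)
      moreover have "w \<in> T.normal_forms" if "w \<in> carrier G" for w
        using that by (simp add: G_def)
      ultimately have "w = []" if "w \<in> carrier G" for w
        using that T.Cons_normal_iff empty(1) by (cases w) fastforce+
      then have "H \<subseteq> {\<one>\<^bsub>G\<^esub>}" using HG by (auto simp: G_def)
      then show False using False subgroup.one_closed[OF sub(1)] by blast
    qed
    have free_src: "T.free_at fst H" "T.free_at fst K"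
      using HG T.free_at_fst by (auto simp: G_def)
    have free_tgt: "T.free_at T.target H" "T.free_at T.target K"
      using H K T.free_at_target by (auto simp: \<F>_def G_def)
    have distinct: "s = t" if "s \<in> S0" "t \<in> S0" "h \<in> H" "k \<in> K" "t = h \<otimes>\<^bsub>G\<^esub> s \<otimes>\<^bsub>G\<^esub> k" for s t h k
      using double_coset_reps_unique[OF G.is_group S sub _ _ that(3,4,5)] that S0 by blast
    have in_G: "hs \<subseteq> carrier G" "ks \<subseteq> carrier G" "S0 \<subseteq> carrier G"
      using hs ks HG S0 SG by auto
    have nontriv: "H \<noteq> {\<one>\<^bsub>G\<^esub>}" "K \<noteq> {\<one>\<^bsub>G\<^esub>}" using False by auto
    obtain U where U: "\<And>s. s \<in> S0 \<Longrightarrow> U s \<subseteq> ?L s" "\<And>s. s \<in> S0 \<Longrightarrow> finite (U s)"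
      "\<And>s. s \<in> S0 \<Longrightarrow> generate G (U s) = ?L s"
      "d * (\<Sum>s \<in> S0. card (U s) - 1) \<le> 2 * n * ((card hs - 1) * (card ks - 1))"
    proof (rule T.intersection_ranks[folded G_def, OF edges hs(1) in_G(1) hs(3) nontriv(1)
          ks(1) in_G(2) ks(3) nontriv(2) free_src(1)[folded G_def] free_tgt(1)[folded G_def]
          free_src(2)[folded G_def] free_tgt(2)[folded G_def] S0(1) in_G(3)])
      show "s = t" if "s \<in> S0" "t \<in> S0" "h \<in> H" "k \<in> K" "t = h \<otimes>\<^bsub>G\<^esub> s \<otimes>\<^bsub>G\<^esub> k" for s t h k
        using that by (rule distinct)
      show "d * card L \<le> n * (card L - 2)" if "subgroup L G" "finite L" "card L \<ge> 3" for L
        using that by (rule nd(3))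
    qed (rule nd(1), rule that)
    let ?u = "\<Sum>s \<in> S0. card (U s) - 1"
    have "(\<Sum>s \<in> S0. ennreal_of_enat (reduced_rank (G\<lparr>carrier := ?L s\<rparr>)))
        \<le> (\<Sum>s \<in> S0. ennreal_of_enat (enat (card (U s) - 1)))"
    proof (rule sum_mono)
      fix s assume s: "s \<in> S0"
      then have "reduced_rank (G\<lparr>carrier := ?L s\<rparr>) \<le> enat (card (U s) - 1)"
        using S0 by (intro reduced_rank_le[OF G.is_group subL U(1-3)]) auto
      then show "ennreal_of_enat (reduced_rank (G\<lparr>carrier := ?L s\<rparr>))
          \<le> ennreal_of_enat (enat (card (U s) - 1))"
        by (simp only: ennreal_of_enat_le_iff)
    qed
    also have "\<dots> = ennreal (real ?u)"
      by (simp add: ennreal_of_nat_eq_real_of_nat)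
    also have "\<dots> \<le> ennreal (2 * (real n / real d) * real (card hs - 1) * real (card ks - 1))"
    proof (rule ennreal_leI)
      have "real (d * ?u) \<le> real (2 * n * ((card hs - 1) * (card ks - 1)))"
        using U(4) by (rule of_nat_mono)
      then show "real ?u \<le> 2 * (real n / real d) * real (card hs - 1) * real (card ks - 1)"
        using nd(2) by (simp add: field_simps)
    qed
    also have "\<dots> = 2 * ennreal (real n / real d) * of_nat (card hs - 1) * of_nat (card ks - 1)"
    proof -
      have "ennreal (2 * x * y * z) = 2 * ennreal x * ennreal y * ennreal z"
        if "x \<ge> 0" "y \<ge> 0" "z \<ge> 0" for x y z :: real
        using that by (simp add: ennreal_mult)
      from this[of "real n / real d" "real (card hs - 1)" "real (card ks - 1)"] show ?thesis
        by (simp only: ennreal_of_nat_eq_real_of_nat of_nat_0_le_iff divide_nonneg_nonneg)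
    qed
    finally show ?thesis by (simp add: rr nd(4))
  qed
  show ?thesis
    by (rule infsum_le_finite_sums) (use bound in \<open>auto intro: nonneg_summable_on_complete\<close>)
qed

end
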